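(* Let $n\ge 1$, let $\mathbb{H}^n$ be the Heisenberg group with homogeneous dimension $Q=2n+2$, and let $0<\lambda<Q$. Let $1\le p,q\le\infty$ and define $r$ by $\frac{1}{r}=\frac{1}{p}+\frac{1}{q}-\frac{\lambda}{Q}>0$. For $f\in L^p(\mathbb{H}^n)$, $g\in L^q(\mathbb{H}^n)$ consider $$B_\lambda(f,g)(x)=\int_{\mathbb{H}^n} f(xy^{-1})\,g(xy)\,\frac{dy}{|y|^{Q-\lambda}} .$$ Then: (a) If $1<p,q\le\infty$, there is a constant $K$ (independent of $f,g$) such that $$\|B_\lambda(f,g)\|_{L^r(\mathbb{H}^n)}\le K\,\|f\|_{L^p(\mathbb{H}^n)}\|g\|_{L^q(\mathbb{H}^n)}.$$ (b) If $1\le p,q\le\infty$ with $p=1$ or $q=1$, there is a constant $K$ such that $$\|B_\lambda(f,g)\|_{L^{r,\infty}(\mathbb{H}^n)}\le K\,\|f\|_{L^p(\mathbb{H}^n)}\|g\|_{L^q(\mathbb{H}^n)}.$$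
   Context: $\mathbb{H}^n=\mathbb{C}^n\times\mathbb{R}$ with group law $(z,t)\cdot(w,s)=(z+w,\,t+s+\tfrac12\operatorname{Im}(z\cdot\bar w))$; the inverse of $(z,t)$ is $(-z,-t)$. The Koranyi norm is $|(z,t)|=(|z|^4+t^2)^{1/4}$, homogeneous of degree 1 for the dilations $\delta_r(z,t)=(rz,r^2t)$. Haar measure is Lebesgue measure $dz\,dt$, and $Q=2n+2$ is the homogeneous dimension. $L^{r,\infty}$ denotes the weak $L^r$ (Lorentz) space with quasi-norm $\sup_{t>0} t\,|\{|h|>t\}|^{1/r}$. *)

theory Defs
  imports "HOL-Analysis.Analysis"
begin

type_synonym 'n heis = "(complex^'n) \<times> real"

definition heis_mult :: "'n::finite heis \<Rightarrow> 'n heis \<Rightarrow> 'n heis" where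
  "heis_mult x y = (case x of (z, t) \<Rightarrow> case y of (w, s) \<Rightarrow>
      (z + w, t + s + (1/2) * Im (\<Sum>i\<in>UNIV. z$i * cnj (w$i))))"

definition heis_inv :: "'n::finite heis \<Rightarrow> 'n heis" where
  "heis_inv x = (case x of (z, t) \<Rightarrow> (-z, -t))"

definition koranyi :: "'n::finite heis \<Rightarrow> real" where
  "koranyi x = (case x of (z, t) \<Rightarrow> ((norm z)^4 + t^2) powr (1/4))"

definition hom_dim :: "'n::finite itself \<Rightarrow> real" where
  "hom_dim _ = 2 * real CARD('n) + 2"

definition enn_powr :: "ennreal \<Rightarrow> real \<Rightarrow> ennreal" where
  "enn_powr a e = (if a = \<infinity> then \<infinity> else ennreal (enn2real a powr e))"

definition exp_inv :: "ennreal \<Rightarrow> real" where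
  "exp_inv p = (if p = \<infinity> then 0 else 1 / enn2real p)"

definition Lp_norm :: "'a measure \<Rightarrow> ennreal \<Rightarrow> ('a \<Rightarrow> complex) \<Rightarrow> ennreal" where
  "Lp_norm M p f =
     (if p = \<infinity> then Inf {C::ennreal. AE x in M. ennreal (cmod (f x)) \<le> C}
      else enn_powr (\<integral>\<^sup>+ x. ennreal (cmod (f x) powr enn2real p) \<partial>M) (1 / enn2real p))"

definition in_Lp :: "'a measure \<Rightarrow> ennreal \<Rightarrow> ('a \<Rightarrow> complex) \<Rightarrow> bool" where
  "in_Lp M p f \<longleftrightarrow> f \<in> borel_measurable M \<and> Lp_norm M p f < \<infinity>"

definition weak_Lr_norm :: "'a measure \<Rightarrow> real \<Rightarrow> ('a \<Rightarrow> complex) \<Rightarrow> ennreal" where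
  "weak_Lr_norm M r h =
     (SUP t\<in>{0<..}. ennreal t * enn_powr (emeasure M {x\<in>space M. cmod (h x) > t}) (1 / r))"

definition B_lambda :: "real \<Rightarrow> ('n::finite heis \<Rightarrow> complex) \<Rightarrow> ('n heis \<Rightarrow> complex) \<Rightarrow> 'n heis \<Rightarrow> complex" where
  "B_lambda lam f g x = (\<integral> y. f (heis_mult x (heis_inv y)) * g (heis_mult x y)
       / complex_of_real (koranyi y powr (hom_dim TYPE('n) - lam)) \<partial>lebesgue)"

end

theory Submission
  imports Defs
begin

text \<open>
  Write \<open>a = 1/p\<close>, \<open>b = 1/q\<close> and cut the kernel into dyadic pieces living on boxes of homogeneous
  radius \<open>2\<^sup>k\<close>. The substitution \<open>(x, y) \<mapsto> (x y\<^sup>-\<^sup>1, x y)\<close> has constant Jacobian, because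
  \<open>x y = (x y\<^sup>-\<^sup>1) (y y)\<close> and \<open>y y = 2 y\<close>; this gives a Young inequality for each piece. As a piece
  only sees \<open>f\<close> and \<open>g\<close> near \<open>x\<close>, averaging the localized inequality over all translates of a box
  extends it to every target exponent \<open>s\<close> with \<open>1/s \<le> a + b \<le> 1 + 1/s\<close>, including \<open>s < 1\<close>. The condition
  \<open>0 < lam < Q\<close> places \<open>r\<close> strictly inside this range.

  Exponents \<open>s\<close> on both sides of \<open>r\<close> bound the \<open>k\<close>-th piece by geometric sequences that balance at one
  scale depending on the height, and summing over \<open>k\<close> gives the weak type estimate. For the strong type
  estimate \<open>f\<close> and \<open>g\<close> are truncated, at scale \<open>k\<close>, at heights \<open>2\<close> to the power \<open>- k Q a\<close> and \<open>- k Q b\<close>,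
  and the two parts are measured with exponents slightly above and below \<open>a\<close> and \<open>b\<close>.
\<close>

section \<open>Powers and Hoelder's inequality for extended nonnegative functions\<close>


text \<open>Since \<open>1/r = a + b - lam/Q\<close> can come close to \<open>2\<close>, the target
  \<open>L^r\<close> need not be normed: no Minkowski inequality adds up the scales and no duality
  is at hand, so sums over scales are handled term by term. The range of \<open>s\<close> has two
  sources: \<open>a + b \<le> 1 + 1/s\<close> is the Young relation relaxed by Hoelder's inequality
  on a box, and \<open>1/s \<le> a + b\<close> lets local norms that are \<open>l^(1/a)\<close> and
  \<open>l^(1/b)\<close> over the translates multiply into \<open>l^s\<close>. The room on both
  sides of \<open>r\<close> comes from \<open>a + b - 1/r = lam/Q\<close> lying strictly between 0
  and 1. With fixed \<open>a\<close> and \<open>b\<close> each scale has only a uniform bound, and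
  weights decaying away from a critical scale make the sum converge; as that scale moves with the
  height, only a weak estimate results. Truncation makes the norms themselves summable over the
  scales: the height is natural because a function of unit \<open>L^p\<close> norm spread over a set
  of volume \<open>2^(kQ)\<close> has size \<open>2^(-kQa)\<close>. It uses exponents
  \<open>a + \<epsilon> \<le> 1\<close>, hence \<open>p, q > 1\<close> in the strong estimate. For
  \<open>p = \<infinity>\<close> there is nothing to truncate; as \<open>a + b > lam/Q\<close>, one
  of \<open>a\<close>, \<open>b\<close> is positive and supplies the summability.\<close>

lemma enn_powr_0 [simp]: "enn_powr 0 e = 0"
  and enn_powr_top [simp]: "enn_powr \<infinity> e = \<infinity>" "enn_powr top e = top"
  and enn_powr_one [simp]: "enn_powr 1 e = 1"
  by (auto simp: enn_powr_def)

lemma enn_powr_ennreal: "0 \<le> a \<Longrightarrow> enn_powr (ennreal a) e = ennreal (a powr e)"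
  by (simp add: enn_powr_def)

lemma enn_powr_1 [simp]: "enn_powr a 1 = a"
  by (cases a) (auto simp: enn_powr_def)

lemma enn_powr_eq_0_iff [simp]: "enn_powr a e = 0 \<longleftrightarrow> a = 0"
  by (cases a) (auto simp: enn_powr_def)

lemma enn_powr_eq_top_iff [simp]: "enn_powr a e = top \<longleftrightarrow> a = top"
  by (cases a) (auto simp: enn_powr_def)

text \<open>The conventions \<open>0 powr e = 0\<close> and \<open>enn_powr \<infinity> e = \<infinity>\<close>, for every \<open>e\<close>, make the power laws hold
  without side conditions.\<close>

lemma enn_powr_mult: "enn_powr (a * b) e = enn_powr a e * enn_powr b e"
proof (cases "a = top \<or> b = top")
  case True
  then show ?thesis
    by (cases "a = 0 \<or> b = 0") (auto simp: ennreal_mult_eq_top_iff ennreal_top_mult ennreal_mult_top)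
next
  case False
  then obtain x y where "a = ennreal x" "0 \<le> x" "b = ennreal y" "0 \<le> y"
    by (metis ennreal_cases)
  then show ?thesis
    by (simp add: enn_powr_ennreal powr_mult flip: ennreal_mult)
qed

lemma enn_powr_add: "enn_powr a (d + e) = enn_powr a d * enn_powr a e"
  by (cases a) (auto simp: enn_powr_ennreal powr_add ennreal_mult)

lemma enn_powr_powr: "enn_powr (enn_powr a d) e = enn_powr a (d * e)"
  by (cases a) (auto simp: enn_powr_ennreal powr_powr)

lemma enn_powr_mono: "a \<le> b \<Longrightarrow> 0 \<le> e \<Longrightarrow> enn_powr a e \<le> enn_powr b e"
  by (cases a; cases b) (auto simp: enn_powr_ennreal top_unique intro!: ennreal_leI powr_mono2)

lemma enn_powr_less_mono: "a < b \<Longrightarrow> 0 < e \<Longrightarrow> enn_powr a e < enn_powr b e"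
  by (cases a; cases b) (auto simp: enn_powr_ennreal ennreal_less_iff intro!: powr_less_mono2)

lemma enn_powr_le_iff: "0 < e \<Longrightarrow> enn_powr a e \<le> enn_powr b e \<longleftrightarrow> a \<le> b"
  by (meson enn_powr_less_mono enn_powr_mono leD le_less_linear less_imp_le)

lemma enn_powr_mono_exponent_le1: "a \<le> 1 \<Longrightarrow> d \<le> e \<Longrightarrow> enn_powr a e \<le> enn_powr a d"
  by (cases a) (auto simp: enn_powr_ennreal ennreal_le_1 intro!: ennreal_leI powr_mono')

lemma enn_powr_le_1: "a \<le> 1 \<Longrightarrow> 0 \<le> e \<Longrightarrow> enn_powr a e \<le> 1"
  using enn_powr_mono[of a 1 e] by simp

lemma measurable_enn_powr [measurable (raw)]:
  assumes [measurable]: "f \<in> borel_measurable M"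
  shows "(\<lambda>x. enn_powr (f x) e) \<in> borel_measurable M"
  unfolding enn_powr_def by measurable

text \<open>A quasi-triangle inequality that treats \<open>e < 1\<close> and
  \<open>e \<ge> 1\<close> alike, from \<open>a + b \<le> 2 * max a b\<close>.\<close>

lemma enn_powr_add_le:
  assumes "0 \<le> e"
  shows "enn_powr (a + b) e \<le> enn_powr 2 e * (enn_powr a e + enn_powr b e)"
proof -
  have "a + b \<le> 2 * max a b"
    by (metis add_mono max.cobounded1 max.cobounded2 mult_2)
  then have "enn_powr (a + b) e \<le> enn_powr 2 e * enn_powr (max a b) e"
    using enn_powr_mono[OF _ assms] by (simp add: flip: enn_powr_mult)
  also have "enn_powr (max a b) e \<le> enn_powr a e + enn_powr b e"
    by (cases "a \<le> b") (auto simp: max_def)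
  finally show ?thesis by (simp add: mult_left_mono)
qed

text \<open>Weighted AM-GM. Infinite arguments are set apart because of the endpoints: for
  \<open>\<theta> = 0\<close> and \<open>a = top\<close> the factor \<open>enn_powr a 0\<close> is
  \<open>top\<close>, while \<open>ennreal 0 * a\<close> is \<open>0\<close>.\<close>

lemma enn_powr_mult_le_weighted:
  assumes "0 \<le> \<theta>" "\<theta> \<le> 1"
  shows "enn_powr a \<theta> * enn_powr b (1 - \<theta>) \<le> ennreal \<theta> * a + ennreal (1 - \<theta>) * b
     \<or> a = top \<or> b = top"
proof (cases "a = top \<or> b = top \<or> a = 0 \<or> b = 0")
  case False
  then obtain x y where xy: "a = ennreal x" "0 < x" "b = ennreal y" "0 < y"
    by (metis ennreal_cases ennreal_eq_0_iff not_le)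
  then show ?thesis
    using Youngs_inequality_0[of \<theta> "1 - \<theta>" x y] assms
    by (simp add: enn_powr_ennreal flip: ennreal_mult ennreal_plus)
qed auto

theorem nn_integral_Hoelder:
  assumes [measurable]: "u \<in> borel_measurable M" "v \<in> borel_measurable M"
    and \<theta>: "0 \<le> \<theta>" "\<theta> \<le> 1"
  shows "(\<integral>\<^sup>+x. enn_powr (u x) \<theta> * enn_powr (v x) (1 - \<theta>) \<partial>M)
     \<le> enn_powr (\<integral>\<^sup>+x. u x \<partial>M) \<theta> * enn_powr (\<integral>\<^sup>+x. v x \<partial>M) (1 - \<theta>)"
proof -
  define U where "U = (\<integral>\<^sup>+x. u x \<partial>M)"
  define V where "V = (\<integral>\<^sup>+x. v x \<partial>M)"
  consider "U = 0 \<or> V = 0" | "U \<noteq> 0" "V \<noteq> 0" "U = top \<or> V = top" | "U \<noteq> 0" "V \<noteq> 0" "U \<noteq> top" "V \<noteq> top"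
    by blast
  then show ?thesis
  proof cases
    case 1
    then have "AE x in M. u x = 0 \<or> v x = 0"
      by (auto simp: U_def V_def nn_integral_0_iff_AE)
    then have "AE x in M. enn_powr (u x) \<theta> * enn_powr (v x) (1 - \<theta>) = 0"
      by eventually_elim auto
    then have "(\<integral>\<^sup>+x. enn_powr (u x) \<theta> * enn_powr (v x) (1 - \<theta>) \<partial>M) = 0"
      by (simp only: nn_integral_0_iff_AE measurable_enn_powr borel_measurable_times_ennreal assms)
    then show ?thesis by simp
  next
    case 2
    then have "enn_powr U \<theta> * enn_powr V (1 - \<theta>) = top"
      by (auto simp: ennreal_mult_eq_top_iff)
    then show ?thesis by (simp add: U_def V_def)
  next
    case 3
    then obtain x y where xy: "U = ennreal x" "0 < x" "V = ennreal y" "0 < y"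
      by (metis ennreal_cases ennreal_eq_0_iff not_le)
    define C where "C = enn_powr U \<theta> * enn_powr V (1 - \<theta>)"
    have fin: "AE x in M. u x \<noteq> top \<and> v x \<noteq> top"
      using nn_integral_noteq_infinite[of u M] nn_integral_noteq_infinite[of v M] 3
      by (auto simp: U_def V_def)
    have div: "ennreal x * (a * ennreal (1 / x)) = a" if "0 < x" for a x
    proof -
      have "ennreal x * (a * ennreal (1 / x)) = a * (ennreal x * ennreal (1 / x))"
        by (simp add: ac_simps)
      then show ?thesis using that by (simp flip: ennreal_mult)
    qed
    \<comment> \<open>AM-GM is applied to \<open>u / U\<close> and \<open>v / V\<close>, which have
      integral 1; the bound then integrates to
      \<open>C * (\<theta> + (1 - \<theta>)) = C\<close>.\<close>
    have "AE z in M. enn_powr (u z) \<theta> * enn_powr (v z) (1 - \<theta>)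
       \<le> C * (ennreal \<theta> * (u z * ennreal (1 / x)) + ennreal (1 - \<theta>) * (v z * ennreal (1 / y)))"
      using fin
    proof eventually_elim
      case (elim z)
      have "enn_powr (u z) \<theta> * enn_powr (v z) (1 - \<theta>)
        = enn_powr (U * (u z * ennreal (1 / x))) \<theta> * enn_powr (V * (v z * ennreal (1 / y))) (1 - \<theta>)"
        using xy by (simp add: div)
      also have "\<dots> = C * (enn_powr (u z * ennreal (1 / x)) \<theta> * enn_powr (v z * ennreal (1 / y)) (1 - \<theta>))"
        by (simp add: C_def enn_powr_mult ac_simps)
      also have "\<dots> \<le> C * (ennreal \<theta> * (u z * ennreal (1 / x)) + ennreal (1 - \<theta>) * (v z * ennreal (1 / y)))"
        using enn_powr_mult_le_weighted[OF \<theta>, of "u z * ennreal (1 / x)" "v z * ennreal (1 / y)"] elim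
        by (intro mult_left_mono) (auto simp: ennreal_mult_eq_top_iff)
      finally show ?case .
    qed
    then have "(\<integral>\<^sup>+x. enn_powr (u x) \<theta> * enn_powr (v x) (1 - \<theta>) \<partial>M)
      \<le> (\<integral>\<^sup>+z. C * (ennreal \<theta> * (u z * ennreal (1 / x)) + ennreal (1 - \<theta>) * (v z * ennreal (1 / y))) \<partial>M)"
      by (rule nn_integral_mono_AE)
    also have "\<dots> = C * (ennreal \<theta> * (U * ennreal (1 / x)) + ennreal (1 - \<theta>) * (V * ennreal (1 / y)))"
      by (simp add: nn_integral_cmult nn_integral_add nn_integral_multc U_def V_def)
    also have "\<dots> = C"
      using xy \<theta> by (simp flip: ennreal_mult ennreal_plus)
    finally show ?thesis by (simp add: C_def U_def V_def)
  qed
qed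

text \<open>The first two factors are grouped with total weight \<open>d = a + b\<close> and
  separated by a second application with weights \<open>a / d\<close> and \<open>b / d\<close>;
  \<open>0 < a\<close> makes the division legitimate.\<close>

corollary nn_integral_Hoelder3:
  assumes [measurable]: "u \<in> borel_measurable M" "v \<in> borel_measurable M" "w \<in> borel_measurable M"
    and "0 < a" "0 \<le> b" "0 \<le> c" and abc: "a + b + c = 1"
  shows "(\<integral>\<^sup>+x. enn_powr (u x) a * enn_powr (v x) b * enn_powr (w x) c \<partial>M)
     \<le> enn_powr (\<integral>\<^sup>+x. u x \<partial>M) a * enn_powr (\<integral>\<^sup>+x. v x \<partial>M) b * enn_powr (\<integral>\<^sup>+x. w x \<partial>M) c"
proof -
  define d where "d = a + b"
  have d: "0 < d" "c = 1 - d" "d \<le> 1" "b / d = 1 - a / d" "a / d \<le> 1"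
    using assms by (auto simp: d_def field_simps)
  let ?uv = "\<lambda>x. enn_powr (u x) (a / d) * enn_powr (v x) (1 - a / d)"
  have "enn_powr (u x) a * enn_powr (v x) b = enn_powr (?uv x) d" for x
    using d by (simp add: enn_powr_mult enn_powr_powr flip: d(4))
  then have "(\<integral>\<^sup>+x. enn_powr (u x) a * enn_powr (v x) b * enn_powr (w x) c \<partial>M)
    \<le> enn_powr (\<integral>\<^sup>+x. ?uv x \<partial>M) d * enn_powr (\<integral>\<^sup>+x. w x \<partial>M) c"
    using d nn_integral_Hoelder[of ?uv M w d] by simp
  also have "\<dots> \<le> enn_powr (enn_powr (\<integral>\<^sup>+x. u x \<partial>M) (a / d) * enn_powr (\<integral>\<^sup>+x. v x \<partial>M) (1 - a / d)) d
     * enn_powr (\<integral>\<^sup>+x. w x \<partial>M) c"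
    using d \<open>0 < a\<close> by (intro mult_right_mono enn_powr_mono nn_integral_Hoelder) auto
  also have "\<dots> = enn_powr (\<integral>\<^sup>+x. u x \<partial>M) a * enn_powr (\<integral>\<^sup>+x. v x \<partial>M) b * enn_powr (\<integral>\<^sup>+x. w x \<partial>M) c"
    using d by (simp add: enn_powr_mult enn_powr_powr flip: d(4))
  finally show ?thesis .
qed

section \<open>Geometry and invariant measure of the Heisenberg group\<close>


lemma heis_mult_eq:
  "heis_mult x y = (fst x + fst y, snd x + snd y + (1/2) * Im (\<Sum>i\<in>UNIV. fst x $ i * cnj (fst y $ i)))"
  by (simp add: heis_mult_def split: prod.split)

lemma heis_inv_eq_uminus: "heis_inv x = - x"
  by (simp add: heis_inv_def uminus_prod_def split: prod.split)

lemma heis_mult_assoc: "heis_mult (heis_mult x y) z = heis_mult x (heis_mult y z)"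
  by (simp add: heis_mult_eq add.assoc algebra_simps sum.distrib)

lemma Im_self_pairing [simp]: "Im (\<Sum>i\<in>UNIV. z $ i * cnj (z $ i)) = 0"
  for z :: "complex^'n::finite"
  by (simp add: Im_sum)

lemma heis_mult_inv_right [simp]: "heis_mult (heis_mult x y) (heis_inv y) = x"
  unfolding heis_mult_assoc
  by (simp add: heis_inv_eq_uminus heis_mult_eq sum_negf prod_eq_iff)

lemma heis_mult_self: "heis_mult y y = 2 *\<^sub>R y"
  by (simp add: heis_mult_eq prod_eq_iff scaleR_2)

lemma measurable_heis_mult [measurable (raw)]:
  fixes f g :: "'a \<Rightarrow> 'n::finite heis"
  assumes "f \<in> borel_measurable M" "g \<in> borel_measurable M"
  shows "(\<lambda>x. heis_mult (f x) (g x)) \<in> borel_measurable M"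
  by (rule borel_measurable_continuous_Pair[OF assms])
     (unfold heis_mult_eq, intro continuous_intros)

lemma measurable_heis_inv [measurable (raw)]:
  fixes f :: "'a \<Rightarrow> 'n::finite heis"
  assumes "f \<in> borel_measurable M"
  shows "(\<lambda>x. heis_inv (f x)) \<in> borel_measurable M"
  using assms unfolding heis_inv_eq_uminus by measurable

section \<open>Invariance of Lebesgue measure under translations and inversion of the group\<close>

lemma nn_integral_lborel_plus:
  fixes F :: "'a::euclidean_space \<Rightarrow> ennreal"
  assumes [measurable]: "F \<in> borel_measurable borel"
  shows "(\<integral>\<^sup>+x. F (c + x) \<partial>lborel) = (\<integral>\<^sup>+x. F x \<partial>lborel)"
  by (subst (2) lborel_distr_plus[of c, symmetric]) (simp add: nn_integral_distr)

lemma nn_integral_lborel_scaleR: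
  fixes F :: "'a::euclidean_space \<Rightarrow> ennreal"
  assumes [measurable]: "F \<in> borel_measurable borel" and "c \<noteq> 0"
  shows "(\<integral>\<^sup>+x. F x \<partial>lborel) = ennreal (\<bar>c\<bar> ^ DIM('a)) * (\<integral>\<^sup>+x. F (c *\<^sub>R x) \<partial>lborel)"
  by (subst lborel_affine[OF \<open>c \<noteq> 0\<close>, of 0])
     (simp add: nn_integral_density nn_integral_distr nn_integral_cmult)

lemma nn_integral_lborel_uminus:
  fixes F :: "'a::euclidean_space \<Rightarrow> ennreal"
  assumes "F \<in> borel_measurable borel"
  shows "(\<integral>\<^sup>+x. F (- x) \<partial>lborel) = (\<integral>\<^sup>+x. F x \<partial>lborel)"
  using nn_integral_lborel_scaleR[OF assms, of "-1"] by simp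

text \<open>Left and right translations of the group both have this shape: a translation of the
  first coordinate and, over each fixed first coordinate, a translation of the line. Fubini then
  gives the invariance on both sides.\<close>

lemma nn_integral_lborel_shear:
  fixes F :: "'a::euclidean_space \<times> real \<Rightarrow> ennreal"
  assumes [measurable]: "F \<in> borel_measurable borel" "\<phi> \<in> borel_measurable borel"
  shows "(\<integral>\<^sup>+x. F (c + fst x, \<phi> (fst x) + snd x) \<partial>lborel) = (\<integral>\<^sup>+x. F x \<partial>lborel)"
proof -
  have "(\<integral>\<^sup>+x. F (c + fst x, \<phi> (fst x) + snd x) \<partial>lborel)
      = (\<integral>\<^sup>+z. \<integral>\<^sup>+t. F (c + z, \<phi> z + t) \<partial>lborel \<partial>lborel)"
    unfolding lborel_prod[symmetric]
    by (subst lborel.nn_integral_fst[symmetric]) simp_all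
  also have "\<dots> = (\<integral>\<^sup>+z. \<integral>\<^sup>+t. F (c + z, t) \<partial>lborel \<partial>lborel)"
    by (intro nn_integral_cong nn_integral_lborel_plus) measurable
  also have "\<dots> = (\<integral>\<^sup>+z. \<integral>\<^sup>+t. F (z, t) \<partial>lborel \<partial>lborel)"
    by (rule nn_integral_lborel_plus[of "\<lambda>z. \<integral>\<^sup>+t. F (z, t) \<partial>lborel"]) measurable
  also have "\<dots> = (\<integral>\<^sup>+x. F x \<partial>lborel)"
    by (subst lborel.nn_integral_fst) (simp_all add: lborel_prod borel_prod)
  finally show ?thesis .
qed

lemma nn_integral_heis_left_translate:
  fixes F :: "'n::finite heis \<Rightarrow> ennreal"
  assumes [measurable]: "F \<in> borel_measurable borel"
  shows "(\<integral>\<^sup>+y. F (heis_mult x y) \<partial>lborel) = (\<integral>\<^sup>+y. F y \<partial>lborel)"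
proof -
  let ?\<phi> = "\<lambda>w. snd x + (1/2) * Im (\<Sum>i\<in>UNIV. fst x $ i * cnj (w $ i))"
  have "?\<phi> \<in> borel_measurable borel"
    by (intro borel_measurable_continuous_onI continuous_intros)
  from nn_integral_lborel_shear[OF assms this, of "fst x"] show ?thesis
    by (simp add: heis_mult_eq ac_simps)
qed

lemma nn_integral_heis_right_translate:
  fixes F :: "'n::finite heis \<Rightarrow> ennreal"
  assumes [measurable]: "F \<in> borel_measurable borel"
  shows "(\<integral>\<^sup>+x. F (heis_mult x y) \<partial>lborel) = (\<integral>\<^sup>+x. F x \<partial>lborel)"
proof -
  let ?\<phi> = "\<lambda>w. snd y + (1/2) * Im (\<Sum>i\<in>UNIV. w $ i * cnj (fst y $ i))"
  have "?\<phi> \<in> borel_measurable borel"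
    by (intro borel_measurable_continuous_onI continuous_intros)
  from nn_integral_lborel_shear[OF assms this, of "fst y"] show ?thesis
    by (simp add: heis_mult_eq ac_simps)
qed

lemma nn_integral_heis_inv:
  fixes F :: "'n::finite heis \<Rightarrow> ennreal"
  assumes "F \<in> borel_measurable borel"
  shows "(\<integral>\<^sup>+x. F (heis_inv x) \<partial>lborel) = (\<integral>\<^sup>+x. F x \<partial>lborel)"
  unfolding heis_inv_eq_uminus by (rule nn_integral_lborel_uminus[OF assms])

lemma nn_integral_heis_left_translate_inv:
  fixes F :: "'n::finite heis \<Rightarrow> ennreal"
  assumes [measurable]: "F \<in> borel_measurable borel"
  shows "(\<integral>\<^sup>+y. F (heis_mult x (heis_inv y)) \<partial>lborel) = (\<integral>\<^sup>+y. F y \<partial>lborel)"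
  by (subst nn_integral_heis_inv[of "\<lambda>y. F (heis_mult x y)"])
     (simp_all add: nn_integral_heis_left_translate)

text \<open>The case \<open>L^1 x L^1 -> L^1\<close>, to which Young's inequality reduces. For fixed
  \<open>y\<close>, right translation of \<open>x\<close> by \<open>y\<close> turns
  \<open>x y^-1\<close> into \<open>x\<close> and \<open>x y\<close> into
  \<open>x (y y)\<close>.\<close>

lemma nn_integral_heis_bilinear:
  fixes u v :: "'n::finite heis \<Rightarrow> ennreal"
  assumes [measurable]: "u \<in> borel_measurable borel" "v \<in> borel_measurable borel"
  shows "(\<integral>\<^sup>+x. \<integral>\<^sup>+y. u (heis_mult x (heis_inv y)) * v (heis_mult x y) \<partial>lborel \<partial>lborel)
    \<le> (\<integral>\<^sup>+x. u x \<partial>lborel) * (\<integral>\<^sup>+x. v x \<partial>lborel)"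
proof -
  have "(\<integral>\<^sup>+x. \<integral>\<^sup>+y. u (heis_mult x (heis_inv y)) * v (heis_mult x y) \<partial>lborel \<partial>lborel)
    = (\<integral>\<^sup>+y. \<integral>\<^sup>+x. u (heis_mult x (heis_inv y)) * v (heis_mult x y) \<partial>lborel \<partial>lborel)"
    by (rule lborel_pair.Fubini'[symmetric]) measurable
  also have "\<dots> = (\<integral>\<^sup>+y. \<integral>\<^sup>+x. u x * v (heis_mult x (2 *\<^sub>R y)) \<partial>lborel \<partial>lborel)"
  proof (rule nn_integral_cong)
    fix y :: "'n heis"
    show "(\<integral>\<^sup>+x. u (heis_mult x (heis_inv y)) * v (heis_mult x y) \<partial>lborel)
      = (\<integral>\<^sup>+x. u x * v (heis_mult x (2 *\<^sub>R y)) \<partial>lborel)"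
      using nn_integral_heis_right_translate[of "\<lambda>x. u (heis_mult x (heis_inv y)) * v (heis_mult x y)" y]
      by (simp add: heis_mult_assoc[of _ y y] heis_mult_self)
  qed
  also have "\<dots> = (\<integral>\<^sup>+x. \<integral>\<^sup>+y. u x * v (heis_mult x (2 *\<^sub>R y)) \<partial>lborel \<partial>lborel)"
    by (rule lborel_pair.Fubini') measurable
  also have "\<dots> \<le> (\<integral>\<^sup>+x. u x * (\<integral>\<^sup>+x. v x \<partial>lborel) \<partial>lborel)"
  proof (rule nn_integral_mono)
    \<comment> \<open>The map \<open>y \<mapsto> 2 y\<close> is the Euclidean dilation, with the
      same factor in all coordinates, not the homogeneous one. Its Jacobian is at least 1, and the
      gain is given away.\<close>
    fix x :: "'n heis"
    have "(\<integral>\<^sup>+y. v (heis_mult x (2 *\<^sub>R y)) \<partial>lborel)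
      \<le> ennreal (\<bar>2\<bar> ^ DIM('n heis)) * (\<integral>\<^sup>+y. v (heis_mult x (2 *\<^sub>R y)) \<partial>lborel)"
      using mult_right_mono[OF ennreal_leI[of 1 "\<bar>2\<bar> ^ DIM('n heis)"]] by (simp add: one_le_power del: DIM_prod)
    also have "\<dots> = (\<integral>\<^sup>+x. v x \<partial>lborel)"
      by (subst nn_integral_lborel_scaleR[symmetric, of "\<lambda>y. v (heis_mult x y)"])
         (simp_all add: nn_integral_heis_left_translate)
    finally show "(\<integral>\<^sup>+y. u x * v (heis_mult x (2 *\<^sub>R y)) \<partial>lborel) \<le> u x * (\<integral>\<^sup>+x. v x \<partial>lborel)"
      by (simp add: nn_integral_cmult mult_left_mono)
  qed
  also have "\<dots> = (\<integral>\<^sup>+x. u x \<partial>lborel) * (\<integral>\<^sup>+x. v x \<partial>lborel)"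
    by (simp add: nn_integral_multc)
  finally show ?thesis .
qed

text \<open>A point \<open>x\<close> lies in the translate \<open>z S\<close> for a set of
  \<open>z\<close> of measure \<open>|S|\<close>, because inversion and right translations preserve
  the measure. This is how an estimate on translates of a single box becomes global.\<close>

lemma nn_integral_heis_average:
  fixes F :: "'n::finite heis \<Rightarrow> ennreal"
  assumes [measurable]: "F \<in> borel_measurable borel" "S \<in> sets borel"
  shows "(\<integral>\<^sup>+z. \<integral>\<^sup>+x. indicator S (heis_mult (heis_inv z) x) * F x \<partial>lborel \<partial>lborel)
    = emeasure lborel S * (\<integral>\<^sup>+x. F x \<partial>lborel)"
proof -
  have "(\<integral>\<^sup>+z. \<integral>\<^sup>+x. indicator S (heis_mult (heis_inv z) x) * F x \<partial>lborel \<partial>lborel)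
    = (\<integral>\<^sup>+x. \<integral>\<^sup>+z. indicator S (heis_mult (heis_inv z) x) * F x \<partial>lborel \<partial>lborel)"
    by (rule lborel_pair.Fubini'[symmetric]) measurable
  also have "\<dots> = (\<integral>\<^sup>+x. emeasure lborel S * F x \<partial>lborel)"
  proof (rule nn_integral_cong)
    fix x :: "'n heis"
    have "(\<integral>\<^sup>+z. indicator S (heis_mult (heis_inv z) x) \<partial>lborel) = (\<integral>\<^sup>+z. indicator S (heis_mult z x) \<partial>lborel :: ennreal)"
      by (rule nn_integral_heis_inv[of "\<lambda>z. indicator S (heis_mult z x)"]) measurable
    also have "\<dots> = (\<integral>\<^sup>+z. indicator S z \<partial>lborel)"
      by (rule nn_integral_heis_right_translate) measurable
    finally show "(\<integral>\<^sup>+z. indicator S (heis_mult (heis_inv z) x) * F x \<partial>lborel) = emeasure lborel S * F x"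
      by (simp add: nn_integral_multc)
  qed
  also have "\<dots> = emeasure lborel S * (\<integral>\<^sup>+x. F x \<partial>lborel)"
    by (simp add: nn_integral_cmult)
  finally show ?thesis .
qed

text \<open>A product set in place of the Koranyi ball of the same radius, which it contains. Its
  volume is explicit, and the height \<open>\<rho>\<^sup>2\<close> makes it scale under the
  homogeneous dilations, so the volume grows like \<open>\<rho>\<close> to the power
  \<open>Q\<close>.\<close>

definition heis_box :: "real \<Rightarrow> 'n::finite heis set" where
  "heis_box \<rho> = ball 0 \<rho> \<times> {- \<rho>\<^sup>2 <..< \<rho>\<^sup>2}"

definition heis_box_vol :: "'n::finite itself \<Rightarrow> real" where
  "heis_box_vol _ = 2 * unit_ball_vol (DIM(complex^'n))"

lemma heis_box_vol_pos: "0 < heis_box_vol TYPE('n::finite)"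
  by (simp add: heis_box_vol_def)

lemma sets_heis_box [measurable]: "heis_box \<rho> \<in> sets borel"
  unfolding heis_box_def by (intro borel_open open_Times) auto

lemma emeasure_heis_box:
  assumes "0 < \<rho>"
  shows "emeasure lborel (heis_box \<rho> :: 'n::finite heis set)
    = ennreal (heis_box_vol TYPE('n) * \<rho> powr hom_dim TYPE('n))"
proof -
  have "emeasure lborel (heis_box \<rho> :: 'n heis set)
    = emeasure lborel (ball 0 \<rho> :: (complex^'n) set) * emeasure lborel {- \<rho>\<^sup>2 <..< \<rho>\<^sup>2}"
    unfolding heis_box_def lborel_prod[symmetric]
    by (rule lborel.emeasure_pair_measure_Times) auto
  also have "\<dots> = ennreal (unit_ball_vol (DIM(complex^'n)) * \<rho> ^ DIM(complex^'n) * (2 * \<rho>\<^sup>2))"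
    using assms by (simp add: emeasure_ball flip: ennreal_mult)
  also have "\<dots> = ennreal (heis_box_vol TYPE('n) * (\<rho> ^ (2 * CARD('n) + 2)))"
    by (simp add: heis_box_vol_def power_add power2_eq_square mult_ac)
  also have "\<rho> ^ (2 * CARD('n) + 2) = \<rho> powr hom_dim TYPE('n)"
    using assms by (subst powr_realpow[symmetric]) (simp_all add: hom_dim_def add.commute)
  finally show ?thesis .
qed

lemma koranyi_less_imp_heis_box:
  assumes "koranyi y < \<rho>"
  shows "y \<in> heis_box \<rho>"
proof -
  obtain z t where y: "y = (z, t)" by (cases y)
  define m where "m = (norm z)^4 + t^2"
  have m: "0 \<le> m" "m powr (1/4) < \<rho>"
    using assms by (auto simp: m_def koranyi_def y)
  then have \<rho>: "0 < \<rho>" by (smt (verit) powr_ge_zero)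
  have "m = (m powr (1/4)) powr 4"
    using m by (simp add: powr_powr)
  also have "\<dots> < \<rho> powr 4"
    using m by (intro powr_less_mono2) auto
  also have "\<dots> = \<rho> ^ 4"
    using \<rho> by (simp add: powr_numeral)
  finally have "m < \<rho> ^ 4" .
  moreover have "(norm z)^4 \<le> m" "t\<^sup>2 \<le> m"
    by (simp_all add: m_def)
  ultimately have "(norm z)^4 < \<rho>^4" "\<bar>t\<bar>^2 < (\<rho>^2)^2"
    unfolding power_mult[symmetric] power2_abs by simp_all
  then have "norm z < \<rho>" "\<bar>t\<bar> < \<rho>^2"
    using \<rho> by (auto intro: power_less_imp_less_base[of _ 4] power_less_imp_less_base[of _ 2])
  then show ?thesis by (auto simp: y heis_box_def)
qed

lemma Im_pairing_le: "\<bar>Im (\<Sum>i\<in>UNIV. z $ i * cnj (w $ i))\<bar> \<le> norm z * norm w"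
  for z w :: "complex^'n::finite"
proof -
  have "\<bar>Im (\<Sum>i\<in>UNIV. z $ i * cnj (w $ i))\<bar> \<le> cmod (\<Sum>i\<in>UNIV. z $ i * cnj (w $ i))"
    by (rule abs_Im_le_cmod)
  also have "\<dots> \<le> (\<Sum>i\<in>UNIV. cmod (z $ i) * cmod (w $ i))"
    by (rule order_trans[OF norm_sum]) (simp add: norm_mult)
  also have "\<dots> \<le> L2_set (\<lambda>i. cmod (z $ i)) UNIV * L2_set (\<lambda>i. cmod (w $ i)) UNIV"
    using L2_set_mult_ineq[of "\<lambda>i. cmod (z $ i)" "\<lambda>i. cmod (w $ i)" UNIV] by simp
  finally show ?thesis by (simp add: norm_vec_def)
qed

text \<open>By Cauchy-Schwarz the twist contributes at most \<open>\<rho> * \<sigma> / 2\<close> to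
  the last coordinate, which fits into the cross term of
  \<open>(\<rho> + \<sigma>)\<^sup>2\<close>.\<close>

lemma heis_box_mult:
  assumes "x \<in> heis_box \<rho>" "y \<in> heis_box \<sigma>"
  shows "heis_mult x y \<in> heis_box (\<rho> + \<sigma>)"
proof -
  obtain z t w s where xy: "x = (z, t)" "y = (w, s)" by (metis surj_pair)
  have *: "norm z < \<rho>" "\<bar>t\<bar> < \<rho>^2" "norm w < \<sigma>" "\<bar>s\<bar> < \<sigma>^2"
    using assms by (auto simp: xy heis_box_def)
  have "\<bar>Im (\<Sum>i\<in>UNIV. z $ i * cnj (w $ i))\<bar> \<le> \<rho> * \<sigma>"
    using * by (intro order_trans[OF Im_pairing_le] mult_mono) (auto intro: less_imp_le order_trans[OF norm_ge_zero])
  moreover have "0 \<le> \<rho> * \<sigma>"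
    using * by (smt (verit) norm_ge_zero mult_nonneg_nonneg)
  ultimately have "\<bar>t + s + 1/2 * Im (\<Sum>i\<in>UNIV. z $ i * cnj (w $ i))\<bar> < (\<rho> + \<sigma>)^2"
    using * unfolding power2_sum by linarith
  moreover have "norm (z + w) < \<rho> + \<sigma>"
    using * norm_triangle_ineq[of z w] by linarith
  ultimately show ?thesis
    by (auto simp: xy heis_mult_eq heis_box_def)
qed

lemma heis_box_inv [simp]: "heis_inv x \<in> heis_box \<rho> \<longleftrightarrow> x \<in> heis_box \<rho>"
  by (cases x) (auto simp: heis_inv_eq_uminus heis_box_def uminus_prod_def)

section \<open>Bilinear averages over boxes\<close>


text \<open>The parameter is the reciprocal of the usual exponent. For \<open>a = 0\<close> a pointwise supremum suffices,
  since functions may be modified on null sets.\<close>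

definition recip_norm :: "real \<Rightarrow> ('a::euclidean_space \<Rightarrow> ennreal) \<Rightarrow> ennreal" where
  "recip_norm a f = (if a = 0 then (SUP x. f x) else enn_powr (\<integral>\<^sup>+x. enn_powr (f x) (1 / a) \<partial>lborel) a)"

lemma recip_norm_mono:
  assumes "\<And>x. f x \<le> g x" "0 \<le> a"
  shows "recip_norm a f \<le> recip_norm a g"
  using assms by (auto simp: recip_norm_def intro!: SUP_mono enn_powr_mono nn_integral_mono)

lemma enn_powr_indicator [simp]: "enn_powr (indicator S x) e = indicator S x"
  by (auto simp: indicator_def)

text \<open>Inclusion of Lebesgue spaces on a set, by Hoelder against its indicator. As the
  parameters are reciprocals, \<open>a \<le> b\<close> lowers the exponent of integrability.\<close>

lemma recip_norm_indicator_le: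
  fixes f :: "'a::euclidean_space \<Rightarrow> ennreal"
  assumes [measurable]: "f \<in> borel_measurable borel" "S \<in> sets borel"
    and ab: "0 \<le> a" "a \<le> b" "0 < b"
  shows "recip_norm b (\<lambda>x. indicator S x * f x)
    \<le> enn_powr (emeasure lborel S) (b - a) * recip_norm a (\<lambda>x. indicator S x * f x)"
proof (cases "a = 0")
  case True
  define G where "G = (SUP x. indicator S x * f x)"
  have "(\<integral>\<^sup>+x. enn_powr (indicator S x * f x) (1 / b) \<partial>lborel) \<le> (\<integral>\<^sup>+x. enn_powr G (1 / b) * indicator S x \<partial>lborel)"
  proof (rule nn_integral_mono)
    fix x
    have "enn_powr (indicator S x * f x) (1 / b) = enn_powr (indicator S x * f x) (1 / b) * indicator S x"
      by (auto simp: indicator_def)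
    also have "\<dots> \<le> enn_powr G (1 / b) * indicator S x"
      using ab by (intro mult_right_mono enn_powr_mono) (auto simp: G_def intro: SUP_upper)
    finally show "enn_powr (indicator S x * f x) (1 / b) \<le> enn_powr G (1 / b) * indicator S x" .
  qed
  also have "\<dots> = enn_powr G (1 / b) * emeasure lborel S"
    by (simp add: nn_integral_cmult)
  finally have "recip_norm b (\<lambda>x. indicator S x * f x) \<le> enn_powr (enn_powr G (1 / b) * emeasure lborel S) b"
    using ab by (auto simp: recip_norm_def intro!: enn_powr_mono)
  then show ?thesis
    using ab True by (simp add: enn_powr_mult enn_powr_powr recip_norm_def G_def mult.commute)
next
  case False
  define \<theta> where "\<theta> = a / b"
  have \<theta>: "0 \<le> \<theta>" "\<theta> \<le> 1" "0 < a" using ab False by (auto simp: \<theta>_def)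
  let ?h = "\<lambda>x. enn_powr (indicator S x * f x) (1 / a)"
  have "enn_powr (indicator S x * f x) (1 / b) = enn_powr (?h x) \<theta> * enn_powr (indicator S x) (1 - \<theta>)" for x
    using \<theta> ab unfolding enn_powr_powr by (auto simp: \<theta>_def indicator_def)
  then have "(\<integral>\<^sup>+x. enn_powr (indicator S x * f x) (1 / b) \<partial>lborel)
    = (\<integral>\<^sup>+x. enn_powr (?h x) \<theta> * enn_powr (indicator S x) (1 - \<theta>) \<partial>lborel)"
    by (simp only:)
  also have "\<dots> \<le> enn_powr (\<integral>\<^sup>+x. ?h x \<partial>lborel) \<theta> * enn_powr (\<integral>\<^sup>+x. indicator S x \<partial>lborel) (1 - \<theta>)"
    using \<theta> by (intro nn_integral_Hoelder) auto
  finally have "recip_norm b (\<lambda>x. indicator S x * f x)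
    \<le> enn_powr (enn_powr (\<integral>\<^sup>+x. ?h x \<partial>lborel) \<theta> * enn_powr (emeasure lborel S) (1 - \<theta>)) b"
    using ab by (auto simp: recip_norm_def intro!: enn_powr_mono)
  also have "\<dots> = enn_powr (emeasure lborel S) (b - a) * recip_norm a (\<lambda>x. indicator S x * f x)"
    using ab \<theta> by (simp add: enn_powr_mult enn_powr_powr recip_norm_def \<theta>_def mult.commute[of b] left_diff_distrib)
      (simp add: mult.commute)
  finally show ?thesis .
qed

text \<open>With \<open>m\<close> the larger of \<open>x^(1/a)\<close> and \<open>y^(1/b)\<close>,
  the left-hand side is at most \<open>m^(s(a + b))\<close>, and \<open>m \<le> 1\<close> absorbs
  the excess of \<open>s(a + b)\<close> over 1. A factor with exponent parameter zero is only
  bounded by 1 and contributes no term.\<close>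

lemma enn_powr_product_le_sum:
  assumes "x \<le> 1" "y \<le> 1" and ab: "0 \<le> a" "0 \<le> b" and "0 < s" and s: "1 \<le> s * (a + b)"
  shows "enn_powr (x * y) s \<le> (if 0 < a then enn_powr x (1 / a) else 0) + (if 0 < b then enn_powr y (1 / b) else 0)"
proof -
  have one: "enn_powr z s \<le> enn_powr z (1 / c)" if "z \<le> 1" "0 < c" "1 \<le> s * c" for z c
    using that by (intro enn_powr_mono_exponent_le1) (auto simp: field_simps)
  consider "a = 0" "0 < b" | "b = 0" "0 < a" | "0 < a" "0 < b"
    using ab s \<open>0 < s\<close> by (cases "a = 0"; cases "b = 0") auto
  then show ?thesis
  proof cases
    case 1
    have "enn_powr (x * y) s \<le> enn_powr y s"
      using assms mult_right_mono[of x 1 y] by (intro enn_powr_mono) auto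
    with 1 one[of y b] assms show ?thesis by auto
  next
    case 2
    have "enn_powr (x * y) s \<le> enn_powr x s"
      using assms mult_left_mono[of y 1 x] by (intro enn_powr_mono) auto
    with 2 one[of x a] assms show ?thesis by auto
  next
    case 3
    define m where "m = max (enn_powr x (1 / a)) (enn_powr y (1 / b))"
    have "m \<le> 1" using 3 assms by (auto simp: m_def intro!: enn_powr_le_1)
    have "enn_powr (x * y) s = enn_powr (enn_powr x (1 / a)) (a * s) * enn_powr (enn_powr y (1 / b)) (b * s)"
      using 3 by (simp add: enn_powr_mult enn_powr_powr)
    also have "\<dots> \<le> enn_powr m (a * s) * enn_powr m (b * s)"
      using 3 assms by (intro mult_mono enn_powr_mono) (auto simp: m_def)
    also have "\<dots> = enn_powr m (s * (a + b))"
      by (simp add: algebra_simps enn_powr_add)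
    also have "\<dots> \<le> enn_powr m 1"
      by (rule enn_powr_mono_exponent_le1[OF \<open>m \<le> 1\<close> s])
    also have "\<dots> \<le> enn_powr x (1 / a) + enn_powr y (1 / b)"
      by (auto simp: m_def)
    finally show ?thesis using 3 by simp
  qed
qed

text \<open>Applied with Lebesgue measure over the centres of boxes and with counting measure over
  the scales. Hoelder alone would require \<open>s * (a + b) = 1\<close>; the uniform bounds
  \<open>F\<close> and \<open>G\<close> admit larger values, because after division by them all
  factors are at most 1. The constant 2 counts the two summands of
  \<open>enn_powr_product_le_sum\<close>.\<close>

lemma nn_integral_product_powr_le:
  assumes ab: "0 \<le> a" "0 \<le> b" and "0 < s" and s: "1 \<le> s * (a + b)"
    and F: "F < top" "\<And>i. X i \<le> F" and G: "G < top" "\<And>i. Y i \<le> G"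
    and X: "0 < a \<Longrightarrow> X \<in> borel_measurable M"
      "0 < a \<Longrightarrow> (\<integral>\<^sup>+i. enn_powr (X i) (1 / a) \<partial>M) \<le> K * enn_powr F (1 / a)"
    and Y: "0 < b \<Longrightarrow> Y \<in> borel_measurable M"
      "0 < b \<Longrightarrow> (\<integral>\<^sup>+i. enn_powr (Y i) (1 / b) \<partial>M) \<le> K * enn_powr G (1 / b)"
  shows "(\<integral>\<^sup>+i. enn_powr (X i * Y i) s \<partial>M) \<le> 2 * K * enn_powr (F * G) s"
proof (cases "F = 0 \<or> G = 0")
  case True
  then have "X i * Y i = 0" for i
    using F(2)[of i] G(2)[of i] by auto
  then have "(\<integral>\<^sup>+i. enn_powr (X i * Y i) s \<partial>M) = (\<integral>\<^sup>+i. 0 \<partial>M)"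
    by (simp only: enn_powr_0)
  then show ?thesis by simp
next
  case False
  then obtain c d where cd: "F = ennreal c" "0 < c" "G = ennreal d" "0 < d"
    using F G by (metis ennreal_cases ennreal_eq_0_iff not_le less_top)
  have nrm: "ennreal (1 / c) * (z * ennreal c) = z" "ennreal c * (ennreal (1 / c) * z) = z" if "0 < c" for z c
  proof -
    have "ennreal (1 / c) * (z * ennreal c) = (ennreal (1 / c) * ennreal c) * z"
       "ennreal c * (ennreal (1 / c) * z) = (ennreal (1 / c) * ennreal c) * z"
      by (simp_all add: ac_simps)
    then show "ennreal (1 / c) * (z * ennreal c) = z" "ennreal c * (ennreal (1 / c) * z) = z"
      using that by (simp_all flip: ennreal_mult)
  qed
  define x y where "x i = ennreal (1 / c) * X i" and "y i = ennreal (1 / d) * Y i" for i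
  have X_eq: "X i = F * x i" and Y_eq: "Y i = G * y i" for i
    using cd by (simp_all add: x_def y_def nrm)
  have le1: "ennreal (1 / c) * z \<le> 1" if "0 < c" "z \<le> ennreal c" for z c
    using mult_left_mono[OF that(2), of "ennreal (1 / c)"] that(1) by (simp flip: ennreal_mult)
  have xy1: "x i \<le> 1" "y i \<le> 1" for i
    using F G cd by (auto simp: x_def y_def intro!: le1)
  have int: "(\<integral>\<^sup>+i. enn_powr (ennreal (1 / c) * Z i) (1 / a) \<partial>M) \<le> K"
    if "0 < c" "Z \<in> borel_measurable M" "(\<integral>\<^sup>+i. enn_powr (Z i) (1 / a) \<partial>M) \<le> K * enn_powr (ennreal c) (1 / a)"
    for Z :: "'a \<Rightarrow> ennreal" and c a
  proof -
    note [measurable] = that(2)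
    have "(\<integral>\<^sup>+i. enn_powr (ennreal (1 / c) * Z i) (1 / a) \<partial>M)
      = enn_powr (ennreal (1 / c)) (1 / a) * (\<integral>\<^sup>+i. enn_powr (Z i) (1 / a) \<partial>M)"
      by (simp add: enn_powr_mult nn_integral_cmult)
    also have "\<dots> \<le> enn_powr (ennreal (1 / c)) (1 / a) * (K * enn_powr (ennreal c) (1 / a))"
      by (intro mult_left_mono that) simp
    also have "\<dots> = K * enn_powr (ennreal (1 / c) * ennreal c) (1 / a)"
      by (simp add: enn_powr_mult ac_simps)
    also have "\<dots> = K" using that(1) by (simp flip: ennreal_mult)
    finally show ?thesis .
  qed
  have K: "0 < a \<Longrightarrow> (\<integral>\<^sup>+i. enn_powr (x i) (1 / a) \<partial>M) \<le> K" "0 < b \<Longrightarrow> (\<integral>\<^sup>+i. enn_powr (y i) (1 / b) \<partial>M) \<le> K"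
    using X Y cd by (auto simp: x_def y_def intro!: int)
  have meas: "0 < a \<Longrightarrow> x \<in> borel_measurable M" "0 < b \<Longrightarrow> y \<in> borel_measurable M"
    using X Y unfolding x_def y_def by auto
  define A where "A i = (if 0 < a then enn_powr (x i) (1 / a) else 0)" for i
  define B where "B i = (if 0 < b then enn_powr (y i) (1 / b) else 0)" for i
  have [measurable]: "A \<in> borel_measurable M" "B \<in> borel_measurable M"
    using meas by (cases "0 < a"; cases "0 < b"; auto simp: A_def[abs_def] B_def[abs_def] intro: measurable_enn_powr)+
  have "(\<integral>\<^sup>+i. enn_powr (X i * Y i) s \<partial>M) \<le> (\<integral>\<^sup>+i. enn_powr (F * G) s * (A i + B i) \<partial>M)"
  proof (rule nn_integral_mono)
    fix i
    have "enn_powr (X i * Y i) s = enn_powr (F * G) s * enn_powr (x i * y i) s"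
      by (simp add: X_eq Y_eq enn_powr_mult ac_simps)
    also have "\<dots> \<le> enn_powr (F * G) s * (A i + B i)"
      unfolding A_def B_def using assms xy1 by (intro mult_left_mono enn_powr_product_le_sum) auto
    finally show "enn_powr (X i * Y i) s \<le> enn_powr (F * G) s * (A i + B i)" .
  qed
  also have "\<dots> = enn_powr (F * G) s * ((\<integral>\<^sup>+i. A i \<partial>M) + (\<integral>\<^sup>+i. B i \<partial>M))"
    by (simp add: nn_integral_cmult nn_integral_add)
  also have "\<dots> \<le> enn_powr (F * G) s * (K + K)"
    using K by (intro mult_left_mono add_mono) (cases "0 < a"; cases "0 < b"; simp add: A_def B_def)+
  finally show ?thesis by (simp add: mult_2[symmetric] ac_simps)
qed

definition heis_bilinear :: "real \<Rightarrow> ('n::finite heis \<Rightarrow> ennreal) \<Rightarrow> ('n heis \<Rightarrow> ennreal) \<Rightarrow> 'n heis \<Rightarrow> ennreal" where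
  "heis_bilinear \<rho> f g x =
     (\<integral>\<^sup>+y. indicator (heis_box \<rho>) y * (f (heis_mult x (heis_inv y)) * g (heis_mult x y)) \<partial>lborel)"

lemma measurable_heis_bilinear [measurable (raw)]:
  fixes f g :: "'n::finite heis \<Rightarrow> ennreal"
  assumes [measurable]: "f \<in> borel_measurable borel" "g \<in> borel_measurable borel"
  shows "heis_bilinear \<rho> f g \<in> borel_measurable borel"
  unfolding heis_bilinear_def[abs_def] by measurable

text \<open>With \<open>f = u^a\<close> and \<open>g = v^b\<close>, the relation
  \<open>a + b = 1 + \<tau>\<close> gives \<open>u^a v^b = (u v)^\<tau> u^(1 - b) v^(1 - a)\<close>,
  where the weights \<open>\<tau>\<close>, \<open>1 - b\<close>, \<open>1 - a\<close> add up to 1.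
  After Hoelder in \<open>y\<close> the last two factors are constant in \<open>x\<close> by
  invariance, and \<open>W\<close> is integrated with the \<open>L^1\<close> case.\<close>

lemma heis_bilinear_Young:
  fixes f g :: "'n::finite heis \<Rightarrow> ennreal"
  assumes [measurable]: "f \<in> borel_measurable borel" "g \<in> borel_measurable borel"
    and \<tau>: "0 < \<tau>" "\<tau> \<le> a" "a \<le> 1" and b: "b = 1 + \<tau> - a"
  shows "(\<integral>\<^sup>+x. enn_powr (heis_bilinear \<rho> f g x) (1 / \<tau>) \<partial>lborel)
    \<le> enn_powr (recip_norm a f * recip_norm b g) (1 / \<tau>)"
proof -
  have ab: "0 < a" "0 < b" "b \<le> 1" using \<tau> b by auto
  define u v where "u x = enn_powr (f x) (1 / a)" and "v x = enn_powr (g x) (1 / b)" for x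
  have [measurable]: "u \<in> borel_measurable borel" "v \<in> borel_measurable borel"
    unfolding u_def[abs_def] v_def[abs_def] by measurable
  define U V where "U = (\<integral>\<^sup>+x. u x \<partial>lborel)" and "V = (\<integral>\<^sup>+x. v x \<partial>lborel)"
  define W where "W x = (\<integral>\<^sup>+y. u (heis_mult x (heis_inv y)) * v (heis_mult x y) \<partial>lborel)" for x
  have [measurable]: "W \<in> borel_measurable borel" unfolding W_def[abs_def] by measurable
  have fg: "f x = enn_powr (u x) a" "g x = enn_powr (v x) b" for x
    using ab by (simp_all add: u_def v_def enn_powr_powr)
  have pw: "heis_bilinear \<rho> f g x \<le> enn_powr (W x) \<tau> * enn_powr U (1 - b) * enn_powr V (1 - a)" for x
  proof -
    have "heis_bilinear \<rho> f g x \<le> (\<integral>\<^sup>+y. enn_powr (u (heis_mult x (heis_inv y)) * v (heis_mult x y)) \<tau>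
        * enn_powr (u (heis_mult x (heis_inv y))) (1 - b) * enn_powr (v (heis_mult x y)) (1 - a) \<partial>lborel)"
      unfolding heis_bilinear_def
    proof (rule nn_integral_mono)
      fix y :: "'n heis"
      have e: "enn_powr p a * enn_powr q b = enn_powr (p * q) \<tau> * enn_powr p (1 - b) * enn_powr q (1 - a)" for p q
      proof -
        have "a = \<tau> + (1 - b)" "b = \<tau> + (1 - a)" using b by auto
        then have "enn_powr p a = enn_powr p \<tau> * enn_powr p (1 - b)" "enn_powr q b = enn_powr q \<tau> * enn_powr q (1 - a)"
          by (metis enn_powr_add)+
        then show ?thesis by (simp add: enn_powr_mult ac_simps)
      qed
      show "indicator (heis_box \<rho>) y * (f (heis_mult x (heis_inv y)) * g (heis_mult x y))
        \<le> enn_powr (u (heis_mult x (heis_inv y)) * v (heis_mult x y)) \<tau>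
        * enn_powr (u (heis_mult x (heis_inv y))) (1 - b) * enn_powr (v (heis_mult x y)) (1 - a)"
        unfolding fg e by (auto simp: indicator_def)
    qed
    also have "\<dots> \<le> enn_powr (W x) \<tau> * enn_powr (\<integral>\<^sup>+y. u (heis_mult x (heis_inv y)) \<partial>lborel) (1 - b)
         * enn_powr (\<integral>\<^sup>+y. v (heis_mult x y) \<partial>lborel) (1 - a)"
      unfolding W_def using \<tau> b ab by (intro nn_integral_Hoelder3) auto
    finally show ?thesis
      by (simp add: U_def V_def nn_integral_heis_left_translate nn_integral_heis_left_translate_inv)
  qed
  have "(\<integral>\<^sup>+x. enn_powr (heis_bilinear \<rho> f g x) (1 / \<tau>) \<partial>lborel)
    \<le> (\<integral>\<^sup>+x. enn_powr (enn_powr (W x) \<tau> * enn_powr U (1 - b) * enn_powr V (1 - a)) (1 / \<tau>) \<partial>lborel)"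
    using \<tau> by (intro nn_integral_mono enn_powr_mono pw) auto
  also have "\<dots> = (\<integral>\<^sup>+x. W x * (enn_powr U ((1 - b) / \<tau>) * enn_powr V ((1 - a) / \<tau>)) \<partial>lborel)"
    using \<tau> by (simp add: enn_powr_mult enn_powr_powr ac_simps)
  also have "\<dots> = (\<integral>\<^sup>+x. W x \<partial>lborel) * (enn_powr U ((1 - b) / \<tau>) * enn_powr V ((1 - a) / \<tau>))"
    by (rule nn_integral_multc) measurable
  also have "\<dots> \<le> (U * V) * (enn_powr U ((1 - b) / \<tau>) * enn_powr V ((1 - a) / \<tau>))"
    unfolding W_def U_def V_def by (intro mult_right_mono nn_integral_heis_bilinear) auto
  also have "\<dots> = (enn_powr U 1 * enn_powr U ((1 - b) / \<tau>)) * (enn_powr V 1 * enn_powr V ((1 - a) / \<tau>))"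
    by (simp add: ac_simps)
  also have "\<dots> = enn_powr U (a / \<tau>) * enn_powr V (b / \<tau>)"
    unfolding enn_powr_add[symmetric] using \<tau> b by (simp add: add_divide_eq_iff add_diff_eq add.commute)
  also have "\<dots> = enn_powr (recip_norm a f * recip_norm b g) (1 / \<tau>)"
    using ab by (simp add: recip_norm_def enn_powr_mult enn_powr_powr U_def V_def u_def v_def)
  finally show ?thesis .
qed

text \<open>If \<open>x\<close> lies in the box around \<open>z\<close>, then \<open>x y\<close> and
  \<open>x y^-1\<close> both lie in the doubled box around \<open>z\<close>, since \<open>y\<close>
  and \<open>y^-1\<close> belong to the box of the same radius.\<close>

lemma heis_bilinear_localize:
  fixes f g :: "'n::finite heis \<Rightarrow> ennreal"
  assumes x: "heis_mult (heis_inv z) x \<in> heis_box \<rho>"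
  shows "heis_bilinear \<rho> f g x
    \<le> heis_bilinear \<rho> (\<lambda>w. indicator {w. heis_mult (heis_inv z) w \<in> heis_box (2 * \<rho>)} w * f w)
                       (\<lambda>w. indicator {w. heis_mult (heis_inv z) w \<in> heis_box (2 * \<rho>)} w * g w) x"
  unfolding heis_bilinear_def
proof (rule nn_integral_mono)
  fix y :: "'n heis"
  have "heis_mult (heis_inv z) (heis_mult x y) \<in> heis_box (2 * \<rho>)
     \<and> heis_mult (heis_inv z) (heis_mult x (heis_inv y)) \<in> heis_box (2 * \<rho>)" if "y \<in> heis_box \<rho>"
    using heis_box_mult[OF x, of y \<rho>] heis_box_mult[OF x, of "heis_inv y" \<rho>] that
    by (simp add: heis_mult_assoc)
  then show "indicator (heis_box \<rho>) y * (f (heis_mult x (heis_inv y)) * g (heis_mult x y))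
    \<le> indicator (heis_box \<rho>) y *
       (indicator {w. heis_mult (heis_inv z) w \<in> heis_box (2 * \<rho>)} (heis_mult x (heis_inv y)) * f (heis_mult x (heis_inv y))
      * (indicator {w. heis_mult (heis_inv z) w \<in> heis_box (2 * \<rho>)} (heis_mult x y) * g (heis_mult x y)))"
    by (auto simp: indicator_def)
qed

lemma nn_integral_local_recip_norm:
  fixes f :: "'n::finite heis \<Rightarrow> ennreal"
  assumes [measurable]: "f \<in> borel_measurable borel" "S \<in> sets borel" and "0 < a"
  shows "(\<integral>\<^sup>+z. enn_powr (recip_norm a (\<lambda>w. indicator {w. heis_mult (heis_inv z) w \<in> S} w * f w)) (1 / a) \<partial>lborel)
    = emeasure lborel S * enn_powr (recip_norm a f) (1 / a)" (is "?L = _")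
    and "(\<lambda>z. recip_norm a (\<lambda>w. indicator {w. heis_mult (heis_inv z) w \<in> S} w * f w)) \<in> borel_measurable borel"
proof -
  have eq: "enn_powr (indicator {w. heis_mult (heis_inv z) w \<in> S} w * f w) (1 / a)
    = indicator S (heis_mult (heis_inv z) w) * enn_powr (f w) (1 / a)" for z w
    by (auto simp: indicator_def)
  have "?L = (\<integral>\<^sup>+z. \<integral>\<^sup>+w. indicator S (heis_mult (heis_inv z) w) * enn_powr (f w) (1 / a) \<partial>lborel \<partial>lborel)"
    using \<open>0 < a\<close> by (simp add: recip_norm_def eq enn_powr_powr)
  also have "\<dots> = emeasure lborel S * enn_powr (recip_norm a f) (1 / a)"
    using \<open>0 < a\<close> by (subst nn_integral_heis_average) (auto simp: recip_norm_def enn_powr_powr)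
  finally show "?L = emeasure lborel S * enn_powr (recip_norm a f) (1 / a)" .
  show "(\<lambda>z. recip_norm a (\<lambda>w. indicator {w. heis_mult (heis_inv z) w \<in> S} w * f w)) \<in> borel_measurable borel"
    using \<open>0 < a\<close> unfolding recip_norm_def eq by simp
qed

text \<open>The power of \<open>\<rho>\<close> is the one forced by dilations. After taking
  \<open>s\<close>-th roots, \<open>Q\<close> comes from the integral over \<open>y\<close>,
  \<open>Q/s\<close> from the one over \<open>x\<close>, and \<open>- Q a\<close> and
  \<open>- Q b\<close> from the two norms.\<close>

theorem heis_bilinear_bound:
  assumes ab: "0 \<le> a" "a \<le> 1" "0 \<le> b" "b \<le> 1" and "0 < s"
    and s1: "1 / s \<le> a + b" and s2: "a + b \<le> 1 + 1 / s"
  obtains C where "0 < C"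
    "\<And>\<rho> (f :: 'n::finite heis \<Rightarrow> ennreal) g. 0 < \<rho> \<Longrightarrow> f \<in> borel_measurable borel \<Longrightarrow> g \<in> borel_measurable borel \<Longrightarrow>
       recip_norm a f < top \<Longrightarrow> recip_norm b g < top \<Longrightarrow>
       (\<integral>\<^sup>+x. enn_powr (heis_bilinear \<rho> f g x) s \<partial>lborel)
         \<le> ennreal (C * \<rho> powr (hom_dim TYPE('n) * (1 + s - s * (a + b)))) * enn_powr (recip_norm a f * recip_norm b g) s"
proof -
  define Q c where "Q = hom_dim TYPE('n)" and "c = heis_box_vol TYPE('n)"
  have "0 < c" by (simp add: c_def heis_box_vol_pos)
  \<comment> \<open>Young's inequality has a target exponent \<open>1 / \<tau> \<ge> 1\<close>, so
    \<open>1 / \<tau>\<close> is the larger of \<open>s\<close> and 1. The pair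
    \<open>(a, b)\<close> is raised to a point \<open>(a', b')\<close> of the Young line
    \<open>a' + b' = 1 + \<tau>\<close>; the maximum in \<open>a'\<close> secures
    \<open>\<tau> \<le> a'\<close>, that is \<open>b' \<le> 1\<close>.\<close>
  define \<tau> where "\<tau> = min (1 / s) 1"
  define a' b' where "a' = max a \<tau>" and "b' = 1 + \<tau> - a'"
  have \<tau>: "0 < \<tau>" "\<tau> \<le> 1" "\<tau> \<le> a'" "a' \<le> 1" "a \<le> a'" "b \<le> b'" "0 < b'"
  proof -
    show "0 < \<tau>" "\<tau> \<le> 1" "\<tau> \<le> a'" "a \<le> a'"
      using \<open>0 < s\<close> by (auto simp: \<tau>_def a'_def)
    moreover show "a' \<le> 1" using ab by (auto simp: a'_def \<tau>_def)
    ultimately show "b \<le> b'" "0 < b'"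
      using ab s2 by (auto simp: b'_def) (auto simp: a'_def \<tau>_def)
  qed
  have s\<tau>: "s * \<tau> \<le> 1" "0 \<le> s * \<tau>"
    using \<open>0 < s\<close> \<tau> by (auto simp: \<tau>_def min_def field_simps)
  \<comment> \<open>\<open>e\<close> is \<open>s\<close> times the total increase
    \<open>(a' - a) + (b' - b)\<close>, hence the power of the doubled volume lost by the
    inclusions. \<open>C\<close> collects what remains of
    \<open>2 * v1 powr (- (s * \<tau>)) * v2 powr (1 + e)\<close> besides the power of
    \<open>\<rho>\<close>.\<close>
  define e where "e = s * (1 + \<tau> - (a + b))"
  have "0 \<le> e" using \<open>0 < s\<close> \<tau> by (auto simp: e_def a'_def b'_def)
  define C where "C = 2 * c powr (1 + e - s * \<tau>) * 2 powr (Q * (1 + e))"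
  show thesis
  proof (rule that[of C])
    show "0 < C" using \<open>0 < c\<close> by (simp add: C_def)
    fix \<rho> :: real and f g :: "'n heis \<Rightarrow> ennreal"
    assume \<rho>: "0 < \<rho>" and [measurable]: "f \<in> borel_measurable borel" "g \<in> borel_measurable borel"
      and fin: "recip_norm a f < top" "recip_norm b g < top"
    define v1 v2 where "v1 = c * \<rho> powr Q" and "v2 = c * (2 * \<rho>) powr Q"
    have v: "0 < v1" "0 < v2" using \<open>0 < c\<close> \<rho> by (auto simp: v1_def v2_def)
    have vol: "emeasure lborel (heis_box \<rho> :: 'n heis set) = ennreal v1"
       "emeasure lborel (heis_box (2 * \<rho>) :: 'n heis set) = ennreal v2"
      using \<rho> by (simp_all add: emeasure_heis_box v1_def v2_def c_def Q_def)
    define S where "S z = {w. heis_mult (heis_inv z) w \<in> heis_box (2 * \<rho>)}" for z :: "'n heis"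
    have S_meas [measurable]: "S z \<in> sets borel" for z
      unfolding S_def by measurable
    have S_vol: "emeasure lborel {w. heis_mult (heis_inv z) w \<in> heis_box \<sigma>} = emeasure lborel (heis_box \<sigma> :: 'n heis set)"
      for z :: "'n heis" and \<sigma>
    proof -
      have "emeasure lborel {w. heis_mult (heis_inv z) w \<in> heis_box \<sigma>}
        = (\<integral>\<^sup>+w. indicator {w. heis_mult (heis_inv z) w \<in> heis_box \<sigma>} w \<partial>lborel)"
        by (subst nn_integral_indicator) measurable
      also have "\<dots> = (\<integral>\<^sup>+w. indicator (heis_box \<sigma>) (heis_mult (heis_inv z) w) \<partial>lborel)"
        by (intro nn_integral_cong) (simp add: indicator_def)
      also have "\<dots> = emeasure lborel (heis_box \<sigma> :: 'n heis set)"
        by (subst nn_integral_heis_left_translate) simp_all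
      finally show ?thesis .
    qed
    define fz gz where "fz z w = indicator (S z) w * f w" and "gz z w = indicator (S z) w * g w" for z w
    have [measurable]: "fz z \<in> borel_measurable borel" "gz z \<in> borel_measurable borel" for z
      unfolding fz_def gz_def by measurable
    \<comment> \<open>For \<open>a = 0\<close> the local norm is a supremum, whose measurability in
      \<open>z\<close> is not clear. The global supremum, constant in \<open>z\<close>, takes its
      place; likewise for \<open>b\<close>.\<close>
    define X Y where "X z = (if a = 0 then recip_norm a f else recip_norm a (fz z))"
      and "Y z = (if b = 0 then recip_norm b g else recip_norm b (gz z))" for z
    have loc: "recip_norm a (fz z) \<le> recip_norm a f" "recip_norm b (gz z) \<le> recip_norm b g" for z
      unfolding fz_def gz_def using ab by (auto intro!: recip_norm_mono simp: indicator_def)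
    have le: "X z \<le> recip_norm a f" "Y z \<le> recip_norm b g" for z
      using loc by (auto simp: X_def Y_def)
    have [measurable]: "X \<in> borel_measurable borel" "Y \<in> borel_measurable borel"
      unfolding X_def[abs_def] Y_def[abs_def] fz_def gz_def S_def using ab
      by (cases "a = 0"; cases "b = 0"; simp add: nn_integral_local_recip_norm(2))+
    have X_int: "(\<integral>\<^sup>+z. enn_powr (X z) (1 / a) \<partial>lborel) = ennreal v2 * enn_powr (recip_norm a f) (1 / a)" if "0 < a"
      using nn_integral_local_recip_norm(1)[OF _ sets_heis_box that, of f "2 * \<rho>"] that
      by (simp add: X_def fz_def[abs_def] S_def vol)
    have Y_int: "(\<integral>\<^sup>+z. enn_powr (Y z) (1 / b) \<partial>lborel) = ennreal v2 * enn_powr (recip_norm b g) (1 / b)" if "0 < b"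
      using nn_integral_local_recip_norm(1)[OF _ sets_heis_box that, of g "2 * \<rho>"] that
      by (simp add: Y_def gz_def[abs_def] S_def vol)
    have prod: "(\<integral>\<^sup>+z. enn_powr (X z * Y z) s \<partial>lborel) \<le> 2 * ennreal v2 * enn_powr (recip_norm a f * recip_norm b g) s"
      using \<open>0 < s\<close> ab s1 fin le
      by (intro nn_integral_product_powr_le[of a b]) (auto simp: field_simps X_int Y_int)
    have XY: "recip_norm a (fz z) \<le> X z" "recip_norm b (gz z) \<le> Y z" for z
      using loc[of z] by (auto simp: X_def Y_def)
    \<comment> \<open>Hoelder on the small box passes from the exponent \<open>1 / \<tau>\<close> to
      \<open>s\<close> and costs \<open>v1 powr (1 - s * \<tau>)\<close>; the inclusions on the
      doubled box pass from \<open>a'\<close>, \<open>b'\<close> back to \<open>a\<close>,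
      \<open>b\<close> and cost \<open>v2 powr e\<close>.\<close>
    have inner: "(\<integral>\<^sup>+x. indicator (heis_box \<rho>) (heis_mult (heis_inv z) x) * enn_powr (heis_bilinear \<rho> f g x) s \<partial>lborel)
      \<le> ennreal (v1 powr (1 - s * \<tau>) * v2 powr e) * enn_powr (X z * Y z) s" for z
    proof -
      have "(\<integral>\<^sup>+x. indicator (heis_box \<rho>) (heis_mult (heis_inv z) x) * enn_powr (heis_bilinear \<rho> f g x) s \<partial>lborel)
        \<le> (\<integral>\<^sup>+x. enn_powr (enn_powr (heis_bilinear \<rho> (fz z) (gz z) x) (1 / \<tau>)) (s * \<tau>)
           * enn_powr (indicator {w. heis_mult (heis_inv z) w \<in> heis_box \<rho>} x) (1 - s * \<tau>) \<partial>lborel)"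
        using heis_bilinear_localize[of z _ \<rho> f g] \<tau> \<open>0 < s\<close>
        by (intro nn_integral_mono) (auto simp: indicator_def enn_powr_powr fz_def[abs_def] gz_def[abs_def] S_def intro!: enn_powr_mono)
      also have "\<dots> \<le> enn_powr (\<integral>\<^sup>+x. enn_powr (heis_bilinear \<rho> (fz z) (gz z) x) (1 / \<tau>) \<partial>lborel) (s * \<tau>)
         * enn_powr (\<integral>\<^sup>+x. indicator {w. heis_mult (heis_inv z) w \<in> heis_box \<rho>} x \<partial>lborel) (1 - s * \<tau>)"
        by (intro nn_integral_Hoelder s\<tau>) measurable
      also have "\<dots> \<le> enn_powr (enn_powr (recip_norm a' (fz z) * recip_norm b' (gz z)) (1 / \<tau>)) (s * \<tau>)
         * enn_powr (ennreal v1) (1 - s * \<tau>)"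
        using \<tau> s\<tau> by (intro mult_mono enn_powr_mono heis_bilinear_Young) (auto simp: b'_def S_vol vol)
      also have "\<dots> = ennreal (v1 powr (1 - s * \<tau>)) * enn_powr (recip_norm a' (fz z) * recip_norm b' (gz z)) s"
        using \<tau> v by (simp add: enn_powr_powr enn_powr_ennreal mult.commute)
      also have "recip_norm a' (fz z) * recip_norm b' (gz z)
        \<le> (enn_powr (ennreal v2) (a' - a) * X z) * (enn_powr (ennreal v2) (b' - b) * Y z)"
        using recip_norm_indicator_le[of f "S z" a a'] recip_norm_indicator_le[of g "S z" b b'] \<tau> ab
        by (intro mult_mono order_trans[OF _ mult_left_mono, OF _ XY(1)] order_trans[OF _ mult_left_mono, OF _ XY(2)])
           (auto simp: fz_def[abs_def] gz_def[abs_def] S_vol vol S_def)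
      also have "\<dots> = enn_powr (ennreal v2) (1 + \<tau> - (a + b)) * (X z * Y z)"
      proof -
        have "1 + \<tau> - (a + b) = (a' - a) + (b' - b)" by (simp add: b'_def)
        then show ?thesis by (simp only: enn_powr_add ac_simps)
      qed
      finally have "(\<integral>\<^sup>+x. indicator (heis_box \<rho>) (heis_mult (heis_inv z) x) * enn_powr (heis_bilinear \<rho> f g x) s \<partial>lborel)
        \<le> ennreal (v1 powr (1 - s * \<tau>)) * enn_powr (enn_powr (ennreal v2) (1 + \<tau> - (a + b)) * (X z * Y z)) s"
        using \<open>0 < s\<close> by (simp add: enn_powr_mono mult_left_mono)
      also have "\<dots> = ennreal (v1 powr (1 - s * \<tau>) * v2 powr e) * enn_powr (X z * Y z) s"
        unfolding enn_powr_mult[of _ "X z * Y z"] enn_powr_powr e_def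
        using v by (simp add: enn_powr_ennreal ennreal_mult ac_simps)
      finally show ?thesis .
    qed
    define k where "k = v1 powr (1 - s * \<tau>) * v2 powr e"
    have "0 < k" using v by (simp add: k_def)
    define N where "N = enn_powr (recip_norm a f * recip_norm b g) s"
    \<comment> \<open>Averaging over \<open>z\<close> produces the volume of the small box on the
      left and, through the local norms, that of the doubled box on the right.\<close>
    have "ennreal v1 * (\<integral>\<^sup>+x. enn_powr (heis_bilinear \<rho> f g x) s \<partial>lborel)
      = (\<integral>\<^sup>+z. \<integral>\<^sup>+x. indicator (heis_box \<rho>) (heis_mult (heis_inv z) x) * enn_powr (heis_bilinear \<rho> f g x) s \<partial>lborel \<partial>lborel)"
      unfolding vol(1)[symmetric] by (rule nn_integral_heis_average[symmetric]) measurable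
    also have "\<dots> \<le> (\<integral>\<^sup>+z. ennreal k * enn_powr (X z * Y z) s \<partial>lborel)"
      unfolding k_def by (rule nn_integral_mono[OF inner])
    also have "\<dots> = ennreal k * (\<integral>\<^sup>+z. enn_powr (X z * Y z) s \<partial>lborel)"
      by (rule nn_integral_cmult) measurable
    also have "\<dots> \<le> ennreal k * (2 * ennreal v2 * N)"
      using prod by (intro mult_left_mono) (auto simp: N_def)
    finally have "ennreal (1 / v1) * (ennreal v1 * (\<integral>\<^sup>+x. enn_powr (heis_bilinear \<rho> f g x) s \<partial>lborel))
      \<le> ennreal (1 / v1) * (ennreal k * (2 * ennreal v2 * N))"
      by (rule mult_left_mono) simp
    then have "(\<integral>\<^sup>+x. enn_powr (heis_bilinear \<rho> f g x) s \<partial>lborel) \<le> ennreal (1 / v1 * (k * (2 * v2))) * N"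
    proof -
      have "ennreal (1 / v1 * (k * (2 * v2))) = ennreal (1 / v1) * (ennreal k * (2 * ennreal v2))"
        using v \<open>0 < k\<close>
        by (simp only: ennreal_mult less_imp_le mult_nonneg_nonneg divide_nonneg_nonneg zero_le_one zero_le_numeral ennreal_numeral)
      moreover have "ennreal (1 / v1) * (ennreal v1 * z) = z" for z
        using v by (simp add: mult.assoc[symmetric] flip: ennreal_mult)
      ultimately show "(\<integral>\<^sup>+x. enn_powr (heis_bilinear \<rho> f g x) s \<partial>lborel) \<le> ennreal (1 / v1 * (k * (2 * v2))) * N"
        if "ennreal (1 / v1) * (ennreal v1 * (\<integral>\<^sup>+x. enn_powr (heis_bilinear \<rho> f g x) s \<partial>lborel))
          \<le> ennreal (1 / v1) * (ennreal k * (2 * ennreal v2 * N))"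
        using that by (simp add: mult.assoc)
    qed
    also have "1 / v1 * (k * (2 * v2)) = C * \<rho> powr (Q * (1 + s - s * (a + b)))"
    proof -
      have "1 / v1 * (k * (2 * v2)) = 2 * v1 powr (- (s * \<tau>)) * v2 powr (1 + e)"
        using v by (simp add: k_def powr_diff powr_add powr_minus field_simps)
      also have "\<dots> = 2 * (c powr (- (s * \<tau>)) * c powr (1 + e)) * 2 powr (Q * (1 + e)) * (\<rho> powr (Q * - (s * \<tau>)) * \<rho> powr (Q * (1 + e)))"
        unfolding v1_def v2_def using \<open>0 < c\<close> \<rho> by (simp add: powr_mult powr_powr mult_ac)
      also have "\<dots> = C * \<rho> powr (Q * (1 + s - s * (a + b)))"
        unfolding powr_add[symmetric] C_def by (simp add: e_def algebra_simps)
      finally show ?thesis .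
    qed
    finally show "(\<integral>\<^sup>+x. enn_powr (heis_bilinear \<rho> f g x) s \<partial>lborel)
         \<le> ennreal (C * \<rho> powr (hom_dim TYPE('n) * (1 + s - s * (a + b)))) * enn_powr (recip_norm a f * recip_norm b g) s"
      by (simp add: Q_def N_def)
  qed
qed

section \<open>Sums over dyadic scales\<close>


text \<open>Uniformity in the real centre \<open>c\<close> is what matters: the shift by the floor
  of \<open>c\<close> changes distances by at most 1, at the cost of a factor
  \<open>2 powr \<delta>\<close>. The two half-lines both contain 0, which is harmless for an upper
  bound.\<close>

lemma nn_integral_geometric_int:
  assumes "0 < \<delta>"
  obtains G where "0 < G"
    "\<And>c. (\<integral>\<^sup>+k. ennreal (2 powr (- \<delta> * \<bar>real_of_int k - c\<bar>)) \<partial>count_space UNIV) \<le> ennreal G"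
proof -
  define q where "q = 2 powr (- \<delta>)"
  have q: "0 < q" "q < 1" using assms powr_less_mono[of "- \<delta>" 0 2] by (auto simp: q_def)
  define h where "h k = ennreal (q ^ nat \<bar>k\<bar>)" for k :: int
  have qpow: "2 powr (- \<delta> * real n) = q ^ n" for n
    using q by (simp add: q_def powr_powr flip: powr_realpow)
  have geom: "(\<Sum>n. ennreal (q ^ n)) = ennreal (1 / (1 - q))"
    using q by (intro suminf_ennreal_eq geometric_sums) auto
  have bij: "bij_betw int UNIV {0..}" "bij_betw (\<lambda>n. - int n) UNIV {..0}"
    by (auto simp: bij_betw_def inj_on_def image_def) (metis nonneg_int_cases, metis nonpos_int_cases)
  have "(\<integral>\<^sup>+k. h k \<partial>count_space UNIV) \<le> (\<integral>\<^sup>+k. h k * indicator {0..} k + h k * indicator {..0} k \<partial>count_space UNIV)"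
    by (intro nn_integral_mono) (auto simp: indicator_def)
  also have "\<dots> = (\<integral>\<^sup>+k. h k \<partial>count_space {0..}) + (\<integral>\<^sup>+k. h k \<partial>count_space {..0})"
    by (simp add: nn_integral_add nn_integral_count_space_indicator)
  also have "(\<integral>\<^sup>+k. h k \<partial>count_space {0..}) = (\<Sum>n. ennreal (q ^ n))"
    by (simp add: h_def nn_integral_count_space_nat flip: nn_integral_bij_count_space[OF bij(1)])
  also have "(\<integral>\<^sup>+k. h k \<partial>count_space {..0}) = (\<Sum>n. ennreal (q ^ n))"
    by (simp add: h_def nn_integral_count_space_nat flip: nn_integral_bij_count_space[OF bij(2)])
  finally have h: "(\<integral>\<^sup>+k. h k \<partial>count_space UNIV) \<le> ennreal (2 / (1 - q))"
    using q by (simp add: geom flip: ennreal_plus)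
  show thesis
  proof (rule that[of "2 powr \<delta> * (2 / (1 - q))"])
    show "0 < 2 powr \<delta> * (2 / (1 - q))" using q by simp
    fix c :: real
    have bij: "bij_betw (\<lambda>j. j + \<lfloor>c\<rfloor>) UNIV UNIV"
      by (rule bij_betwI[of _ _ _ "\<lambda>j. j - \<lfloor>c\<rfloor>"]) auto
    have "(\<integral>\<^sup>+k. ennreal (2 powr (- \<delta> * \<bar>real_of_int k - c\<bar>)) \<partial>count_space UNIV)
      = (\<integral>\<^sup>+j. ennreal (2 powr (- \<delta> * \<bar>real_of_int (j + \<lfloor>c\<rfloor>) - c\<bar>)) \<partial>count_space UNIV)"
      by (rule nn_integral_bij_count_space[OF bij, symmetric])
    also have "\<dots> \<le> (\<integral>\<^sup>+j. ennreal (2 powr \<delta>) * h j \<partial>count_space UNIV)"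
    proof (rule nn_integral_mono)
      fix j :: int
      have "\<bar>real_of_int j\<bar> - 1 \<le> \<bar>real_of_int (j + \<lfloor>c\<rfloor>) - c\<bar>"
        using of_int_floor_le[of c] real_of_int_floor_add_one_gt[of c] by (simp; linarith)
      then have "- \<delta> * \<bar>real_of_int (j + \<lfloor>c\<rfloor>) - c\<bar> \<le> \<delta> + - \<delta> * real (nat \<bar>j\<bar>)"
        using assms mult_left_mono[of "\<bar>real_of_int j\<bar> - 1" "\<bar>real_of_int (j + \<lfloor>c\<rfloor>) - c\<bar>" \<delta>] by (simp add: algebra_simps)
      then have "2 powr (- \<delta> * \<bar>real_of_int (j + \<lfloor>c\<rfloor>) - c\<bar>) \<le> 2 powr \<delta> * q ^ nat \<bar>j\<bar>"
        unfolding qpow[symmetric] powr_add[symmetric] by (intro powr_mono) auto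
      then show "ennreal (2 powr (- \<delta> * \<bar>real_of_int (j + \<lfloor>c\<rfloor>) - c\<bar>)) \<le> ennreal (2 powr \<delta>) * h j"
        using q by (simp add: h_def flip: ennreal_mult)
    qed
    also have "\<dots> = ennreal (2 powr \<delta>) * (\<integral>\<^sup>+j. h j \<partial>count_space UNIV)"
      by (rule nn_integral_cmult) simp
    also have "\<dots> \<le> ennreal (2 powr \<delta>) * ennreal (2 / (1 - q))"
      by (intro mult_left_mono h) simp
    also have "\<dots> = ennreal (2 powr \<delta> * (2 / (1 - q)))"
      using q by (simp flip: ennreal_mult)
    finally show "(\<integral>\<^sup>+k. ennreal (2 powr (- \<delta> * \<bar>real_of_int k - c\<bar>)) \<partial>count_space UNIV) \<le> ennreal (2 powr \<delta> * (2 / (1 - q)))" .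
  qed
qed

text \<open>The gain \<open>2 powr (2 * (\<eta> * d))\<close> is spent in halves: one half cancels
  the weight \<open>2 powr (- \<eta> * d)\<close>, the other survives as decay of \<open>y\<close>.
  As \<open>w \<le> 1\<close>, the root \<open>1 / s\<close> may be replaced by
  \<open>1 / s1\<close>, so that both exponents yield the same decay.\<close>

lemma dyadic_term_bound:
  fixes t y :: real
  assumes "0 < t" "0 \<le> y" "0 < s" "s \<le> s1" "1 \<le> C" "0 \<le> \<eta> * d"
    and m: "M = t powr (r - s) * 2 powr e" "2 * (\<eta> * d) \<le> e"
    and less: "C * (2 powr (- \<eta> * d) * (M * y powr s)) < t powr r"
  shows "y \<le> t * (C powr (- 1 / s1) * 2 powr (- (\<eta> / s1) * d))"
proof -
  define w where "w = 2 powr (- \<eta> * d) / C"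
  have w: "0 < w" "w \<le> 1"
  proof -
    have "2 powr (- \<eta> * d) \<le> 2 powr 0"
      using assms by (intro powr_mono) auto
    then show "0 < w" "w \<le> 1"
      using \<open>1 \<le> C\<close> by (auto simp: w_def)
  qed
  have "C * (2 powr (- \<eta> * d) * (t powr (r - s) * 2 powr (2 * (\<eta> * d)) * y powr s)) \<le> C * (2 powr (- \<eta> * d) * (M * y powr s))"
    unfolding m(1) using assms by (intro mult_left_mono mult_right_mono powr_mono) auto
  with less have "C * (2 powr (- \<eta> * d) * (t powr (r - s) * 2 powr (2 * (\<eta> * d)) * y powr s)) < t powr r"
    by linarith
  also have "C * (2 powr (- \<eta> * d) * (t powr (r - s) * 2 powr (2 * (\<eta> * d)) * y powr s))
    = C * (t powr (r - s) * (2 powr (- \<eta> * d) * 2 powr (2 * (\<eta> * d))) * y powr s)"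
    by (simp add: mult_ac)
  also have "\<dots> = t powr r * y powr s / (t powr s * w)"
    unfolding powr_add[symmetric] w_def using \<open>0 < t\<close> \<open>1 \<le> C\<close> by (simp add: powr_diff field_simps powr_minus)
  finally have "y powr s < t powr s * w"
    using \<open>0 < t\<close> w by (simp add: field_simps)
  then have "(y powr s) powr (1 / s) \<le> (t powr s * w) powr (1 / s)"
    using assms by (intro powr_mono2) auto
  then have "y \<le> t * w powr (1 / s)"
    using assms w by (simp add: powr_powr powr_mult)
  also have "w powr (1 / s) \<le> w powr (1 / s1)"
    using assms w by (intro powr_mono') (auto simp: frac_le)
  also have "w powr (1 / s1) = C powr (- 1 / s1) * 2 powr (- (\<eta> / s1) * d)"
    using assms unfolding w_def by (simp add: powr_mult powr_divide powr_powr powr_minus_divide mult_ac)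
  finally show ?thesis using \<open>0 < t\<close> by (simp add: mult_left_mono)
qed

text \<open>The elementary core of real interpolation: if the terms of a sum are compared with a geometric
  sequence, two power sums with exponents on either side of \<^term>\<open>r\<close> control the \<^term>\<open>r\<close>-th power of
  the sum, and only the indices near the height of the sum matter.\<close>

lemma dyadic_sum_powr_bound:
  assumes s: "0 < s0" "s0 < r" "r < s1" and "0 < \<kappa>"
  obtains C \<eta> where "0 < C" "0 < \<eta>"
    "\<And>(x :: int \<Rightarrow> ennreal) c. ennreal (2 powr (- \<kappa> * c)) \<le> (\<integral>\<^sup>+k. x k \<partial>count_space UNIV) \<Longrightarrow>
      ennreal (2 powr (- \<kappa> * c * r)) \<le> ennreal C * (\<integral>\<^sup>+k. ennreal (2 powr (- \<eta> * \<bar>real_of_int k - c\<bar>)) *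
        (ennreal (2 powr (- \<kappa> * k * (r - s0))) * enn_powr (x k) s0
         + ennreal (2 powr (- \<kappa> * k * (r - s1))) * enn_powr (x k) s1) \<partial>count_space UNIV)"
proof -
  \<comment> \<open>Half of the smaller gap, so that the term bound finds its factor 2.\<close>
  define \<eta> where "\<eta> = \<kappa> * min (r - s0) (s1 - r) / 2"
  have \<eta>: "0 < \<eta>" "2 * \<eta> \<le> \<kappa> * (r - s0)" "2 * \<eta> \<le> \<kappa> * (s1 - r)"
    using assms by (auto simp: \<eta>_def)
  obtain G where G: "0 < G" "\<And>c. (\<integral>\<^sup>+k. ennreal (2 powr (- (\<eta> / s1) * \<bar>real_of_int k - c\<bar>)) \<partial>count_space UNIV) \<le> ennreal G"
    using nn_integral_geometric_int[of "\<eta> / s1"] \<eta> s by auto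
  \<comment> \<open>Chosen so that \<open>C powr (- 1 / s1)\<close> is at most
    \<open>1 / (2 * G)\<close>: the geometric majorant of the \<open>x k\<close> then sums to less
    than the height \<open>t\<close>.\<close>
  define C where "C = max 1 (2 * G) powr s1"
  have "C powr (- 1 / s1) = 1 / max 1 (2 * G)"
    using s unfolding C_def powr_powr by (simp add: powr_minus_divide)
  also have "\<dots> \<le> 1 / (2 * G)" using G by (intro frac_le) auto
  finally have CG: "C powr (- 1 / s1) * G < 1"
    using G(1) by (simp add: field_simps)
  have "1 \<le> C" using s by (auto simp: C_def intro!: ge_one_powr_ge_zero)
  show thesis
  proof (rule that[of C \<eta>])
    show "0 < C" "0 < \<eta>" using \<open>1 \<le> C\<close> \<eta> by auto
    fix x :: "int \<Rightarrow> ennreal" and c :: real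
    define t where "t = 2 powr (- \<kappa> * c)"
    have t: "0 < t" by (simp add: t_def)
    assume "ennreal (2 powr (- \<kappa> * c)) \<le> (\<integral>\<^sup>+k. x k \<partial>count_space UNIV)"
    then have sum: "ennreal t \<le> (\<integral>\<^sup>+k. x k \<partial>count_space UNIV)" by (simp add: t_def)
    define Z where "Z k = ennreal (2 powr (- \<eta> * \<bar>real_of_int k - c\<bar>)) *
        (ennreal (2 powr (- \<kappa> * k * (r - s0))) * enn_powr (x k) s0
         + ennreal (2 powr (- \<kappa> * k * (r - s1))) * enn_powr (x k) s1)" for k
    have "ennreal (t powr r) \<le> ennreal C * (\<integral>\<^sup>+k. Z k \<partial>count_space UNIV)"
    \<comment> \<open>If the weighted sum were smaller, so would be each of its terms. This puts
      every \<open>x k\<close> below a geometric sequence around \<open>c\<close> whose sum is less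
      than \<open>t\<close>.\<close>
    proof (rule ccontr)
      assume "\<not> ?thesis"
      then have *: "ennreal C * (\<integral>\<^sup>+k. Z k \<partial>count_space UNIV) < ennreal (t powr r)" by simp
      have Zk: "ennreal C * Z k < ennreal (t powr r)" for k
        by (rule le_less_trans[OF mult_left_mono *]) (auto intro!: nn_integral_ge_point)
      have "x k \<le> ennreal (t * C powr (- 1 / s1)) * ennreal (2 powr (- (\<eta> / s1) * \<bar>real_of_int k - c\<bar>))" for k
      proof -
        have "x k \<noteq> top"
        proof
          assume "x k = top"
          then have "Z k = top" by (simp add: Z_def ennreal_mult_eq_top_iff)
          with Zk[of k] \<open>1 \<le> C\<close> show False by (simp add: ennreal_mult_top)
        qed
        then obtain y where y: "x k = ennreal y" "0 \<le> y" by (metis ennreal_cases)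
        define d where "d = \<bar>real_of_int k - c\<bar>"
        have "Z k = ennreal (2 powr (- \<eta> * d) * (2 powr (- \<kappa> * k * (r - s0)) * y powr s0 + 2 powr (- \<kappa> * k * (r - s1)) * y powr s1))"
          using y by (simp add: Z_def d_def enn_powr_ennreal ennreal_mult ennreal_plus)
        with Zk[of k] \<open>1 \<le> C\<close> have le: "C * (2 powr (- \<eta> * d) * (2 powr (- \<kappa> * k * (r - s0)) * y powr s0 + 2 powr (- \<kappa> * k * (r - s1)) * y powr s1)) < t powr r"
          by (simp add: ennreal_less_iff flip: ennreal_mult)
        have le': "C * (2 powr (- \<eta> * d) * (2 powr (- \<kappa> * k * (r - s)) * y powr s)) < t powr r" if "s = s0 \<or> s = s1" for s
          by (rule le_less_trans[OF _ le]) (use that \<open>1 \<le> C\<close> in \<open>auto intro!: mult_left_mono\<close>)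
        have m: "2 powr (- \<kappa> * k * (r - s)) = t powr (r - s) * 2 powr (\<kappa> * (c - k) * (r - s))" for s
          by (simp add: t_def powr_powr algebra_simps flip: powr_add)
        have "y \<le> t * (C powr (- 1 / s1) * 2 powr (- (\<eta> / s1) * d))"
        \<comment> \<open>The weight exceeds its value at the critical scale by the factor
          \<open>2 powr (\<kappa> * (c - k) * (r - s))\<close>. This is a gain for
          \<open>s0 < r\<close> at scales up to \<open>c\<close> and for \<open>s1 > r\<close>
          beyond it.\<close>
        proof (cases "k \<le> c")
          case True
          then have d: "d = c - k" by (simp add: d_def)
          have "2 * (\<eta> * d) \<le> \<kappa> * (c - k) * (r - s0)"
            using mult_right_mono[OF \<eta>(2), of d] True by (simp add: d mult_ac)
          then show ?thesis
            using dyadic_term_bound[of t y s0 s1 C \<eta> d _ r, OF t y(2) _ _ \<open>1 \<le> C\<close> _ m[of s0] _ le'[of s0]] s \<eta> by (auto simp: d_def)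
        next
          case False
          then have d: "d = k - c" by (simp add: d_def)
          have "2 * (\<eta> * d) \<le> \<kappa> * (c - k) * (r - s1)"
            using mult_right_mono[OF \<eta>(3), of d] False by (simp add: d algebra_simps)
          then show ?thesis
            using dyadic_term_bound[of t y s1 s1 C \<eta> d _ r, OF t y(2) _ _ \<open>1 \<le> C\<close> _ m[of s1] _ le'[of s1]] s \<eta> by (auto simp: d_def)
        qed
        then show ?thesis
          using t by (simp add: y d_def mult_ac flip: ennreal_mult)
      qed
      then have "(\<integral>\<^sup>+k. x k \<partial>count_space UNIV)
        \<le> (\<integral>\<^sup>+k. ennreal (t * C powr (- 1 / s1)) * ennreal (2 powr (- (\<eta> / s1) * \<bar>real_of_int k - c\<bar>)) \<partial>count_space UNIV)"
        by (rule nn_integral_mono)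
      also have "\<dots> = ennreal (t * C powr (- 1 / s1)) * (\<integral>\<^sup>+k. ennreal (2 powr (- (\<eta> / s1) * \<bar>real_of_int k - c\<bar>)) \<partial>count_space UNIV)"
        by (rule nn_integral_cmult) simp
      also have "\<dots> \<le> ennreal (t * C powr (- 1 / s1)) * ennreal G"
        by (intro mult_left_mono G) simp
      also have "\<dots> = ennreal (t * (C powr (- 1 / s1) * G))"
        using t G(1) by (simp add: mult_ac flip: ennreal_mult)
      also have "\<dots> < ennreal t"
        using t CG G(1) by (intro ennreal_lessI) auto
      finally show False using sum by simp
    qed
    then show "ennreal (2 powr (- \<kappa> * c * r)) \<le> ennreal C * (\<integral>\<^sup>+k. ennreal (2 powr (- \<eta> * \<bar>real_of_int k - c\<bar>)) *
        (ennreal (2 powr (- \<kappa> * k * (r - s0))) * enn_powr (x k) s0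
         + ennreal (2 powr (- \<kappa> * k * (r - s1))) * enn_powr (x k) s1) \<partial>count_space UNIV)"
      by (simp add: t_def powr_powr Z_def)
  qed
qed

section \<open>Weak type estimate\<close>


lemma borel_measurable_nn_integral_count_space [measurable (raw)]:
  fixes h :: "'i::countable \<Rightarrow> 'a \<Rightarrow> ennreal"
  assumes "\<And>k. h k \<in> borel_measurable M"
  shows "(\<lambda>x. \<integral>\<^sup>+k. h k x \<partial>count_space UNIV) \<in> borel_measurable M"
proof -
  have "case_prod h \<in> borel_measurable (count_space UNIV \<Otimes>\<^sub>M M)"
    using assms by (intro measurable_pair_measure_countable1) auto
  then have "(\<lambda>(x, k). h k x) \<in> borel_measurable (M \<Otimes>\<^sub>M count_space UNIV)"
    using measurable_pair_swap by (fastforce simp: split_beta)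
  then show ?thesis
    by (intro sigma_finite_measure.borel_measurable_nn_integral sigma_finite_measure_count_space) simp
qed

text \<open>The weights are at most 1, and the right-hand side without them does not depend on the
  height. The heights approach the sum from below, which also covers an infinite sum.\<close>

lemma dyadic_sum_powr_le:
  assumes s: "0 < s0" "s0 < r" "r < s1" and "0 < \<kappa>"
  obtains C where "0 < C"
    "\<And>x :: int \<Rightarrow> ennreal. enn_powr (\<integral>\<^sup>+k. x k \<partial>count_space UNIV) r \<le> ennreal C * (\<integral>\<^sup>+k.
        (ennreal (2 powr (- \<kappa> * k * (r - s0))) * enn_powr (x k) s0
         + ennreal (2 powr (- \<kappa> * k * (r - s1))) * enn_powr (x k) s1) \<partial>count_space UNIV)"
proof -
  obtain C \<eta> where C: "0 < C" "0 < \<eta>" and bound: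
    "\<And>(x :: int \<Rightarrow> ennreal) c. ennreal (2 powr (- \<kappa> * c)) \<le> (\<integral>\<^sup>+k. x k \<partial>count_space UNIV) \<Longrightarrow>
      ennreal (2 powr (- \<kappa> * c * r)) \<le> ennreal C * (\<integral>\<^sup>+k. ennreal (2 powr (- \<eta> * \<bar>real_of_int k - c\<bar>)) *
        (ennreal (2 powr (- \<kappa> * k * (r - s0))) * enn_powr (x k) s0
         + ennreal (2 powr (- \<kappa> * k * (r - s1))) * enn_powr (x k) s1) \<partial>count_space UNIV)"
    by (rule dyadic_sum_powr_bound[OF assms]) (rule that)
  show thesis
  proof (rule that[OF C(1)], rule ccontr)
    fix x :: "int \<Rightarrow> ennreal"
    define E where "E = ennreal C * (\<integral>\<^sup>+k.
        (ennreal (2 powr (- \<kappa> * k * (r - s0))) * enn_powr (x k) s0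
         + ennreal (2 powr (- \<kappa> * k * (r - s1))) * enn_powr (x k) s1) \<partial>count_space UNIV)"
    assume "\<not> enn_powr (\<integral>\<^sup>+k. x k \<partial>count_space UNIV) r \<le> ennreal C * (\<integral>\<^sup>+k.
        (ennreal (2 powr (- \<kappa> * k * (r - s0))) * enn_powr (x k) s0
         + ennreal (2 powr (- \<kappa> * k * (r - s1))) * enn_powr (x k) s1) \<partial>count_space UNIV)"
    then have "E < enn_powr (\<integral>\<^sup>+k. x k \<partial>count_space UNIV) r"
      by (simp add: E_def not_le)
    then have "enn_powr E (1 / r) < (\<integral>\<^sup>+k. x k \<partial>count_space UNIV)"
      using enn_powr_less_mono[of E _ "1 / r"] s by (fastforce simp: enn_powr_powr)
    then obtain w where w: "enn_powr E (1 / r) < w" "w < (\<integral>\<^sup>+k. x k \<partial>count_space UNIV)"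
      using dense by blast
    then obtain t where t: "w = ennreal t" "0 < t"
      by (metis ennreal_cases ennreal_neg less_top_ennreal linorder_not_le not_less_zero order_less_trans top.not_eq_extremum)
    define c where "c = - log 2 t / \<kappa>"
    have tc: "2 powr (- \<kappa> * c) = t" "2 powr (- \<kappa> * c * r) = t powr r"
      using t \<open>0 < \<kappa>\<close> by (simp_all add: c_def powr_powr[symmetric])
    have "ennreal (t powr r) \<le> ennreal C * (\<integral>\<^sup>+k. ennreal (2 powr (- \<eta> * \<bar>real_of_int k - c\<bar>)) *
        (ennreal (2 powr (- \<kappa> * k * (r - s0))) * enn_powr (x k) s0
         + ennreal (2 powr (- \<kappa> * k * (r - s1))) * enn_powr (x k) s1) \<partial>count_space UNIV)"
      using bound[of c x] w t unfolding tc by simp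
    also have "\<dots> \<le> E"
    proof -
      have "ennreal (2 powr (- \<eta> * \<bar>real_of_int k - c\<bar>)) * z \<le> z" for k z
      proof -
        have "2 powr (- \<eta> * \<bar>real_of_int k - c\<bar>) \<le> 2 powr 0"
          using C by (intro powr_mono) auto
        then show ?thesis using mult_right_mono[of "ennreal (2 powr (- \<eta> * \<bar>real_of_int k - c\<bar>))" 1 z]
          by (simp add: ennreal_le_1)
      qed
      then show ?thesis unfolding E_def by (intro mult_left_mono nn_integral_mono) auto
    qed
    finally have "ennreal (t powr r) \<le> E" .
    then have "enn_powr (ennreal (t powr r)) (1 / r) \<le> enn_powr E (1 / r)"
      using s by (intro enn_powr_mono) auto
    then show False
      using w t s by (simp add: enn_powr_ennreal powr_powr)
  qed
qed

text \<open>The scalar is the size of the kernel at radius \<open>2 powr k\<close>. The pieces live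
  on full boxes, not on shells; up to a constant their sum dominates the integral with the
  kernel.\<close>

definition heis_piece :: "real \<Rightarrow> ('n::finite heis \<Rightarrow> ennreal) \<Rightarrow> ('n heis \<Rightarrow> ennreal) \<Rightarrow> int \<Rightarrow> 'n heis \<Rightarrow> ennreal" where
  "heis_piece lam f g k x =
     ennreal (2 powr (k * (lam - hom_dim TYPE('n)))) * heis_bilinear (2 powr k) f g x"

lemma measurable_heis_piece [measurable (raw)]:
  fixes f g :: "'n::finite heis \<Rightarrow> ennreal"
  assumes [measurable]: "f \<in> borel_measurable borel" "g \<in> borel_measurable borel"
  shows "heis_piece lam f g k \<in> borel_measurable borel"
  unfolding heis_piece_def[abs_def] by measurable

lemma hom_dim_pos: "0 < hom_dim TYPE('n::finite)"
  by (simp add: hom_dim_def add_pos_pos)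

text \<open>The weight is the one of the dyadic sum lemmas with \<open>\<kappa> = Q / r\<close>.
  After inserting \<open>lam = Q * (a + b - 1 / r)\<close>, the powers of \<open>2 powr k\<close>
  cancel up to the deviations \<open>a - a'\<close> and \<open>b - b'\<close>: the bound is uniform
  in \<open>k\<close> for \<open>a' = a\<close>, \<open>b' = b\<close>, and otherwise each norm
  carries its own scaling factor.\<close>

lemma heis_piece_bound:
  assumes ab: "0 \<le> a'" "a' \<le> 1" "0 \<le> b'" "b' \<le> 1" and "0 < s"
    and s1: "1 / s \<le> a' + b'" and s2: "a' + b' \<le> 1 + 1 / s"
    and "0 < r" and r: "1 / r = a + b - lam / hom_dim TYPE('n::finite)"
  obtains C where "0 < C"
    "\<And>(f :: 'n heis \<Rightarrow> ennreal) g (k :: int). f \<in> borel_measurable borel \<Longrightarrow> g \<in> borel_measurable borel \<Longrightarrow>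
       recip_norm a' f < top \<Longrightarrow> recip_norm b' g < top \<Longrightarrow>
       ennreal (2 powr (- (hom_dim TYPE('n) / r) * k * (r - s))) * (\<integral>\<^sup>+x. enn_powr (heis_piece lam f g k x) s \<partial>lborel)
         \<le> ennreal C * enn_powr ((ennreal (2 powr (k * hom_dim TYPE('n) * (a - a'))) * recip_norm a' f)
                  * (ennreal (2 powr (k * hom_dim TYPE('n) * (b - b'))) * recip_norm b' g)) s"
proof -
  define Q where "Q = hom_dim TYPE('n)"
  have Q: "0 < Q" by (simp add: Q_def hom_dim_pos)
  obtain C where C: "0 < C" and bound:
    "\<And>\<rho> (f :: 'n::finite heis \<Rightarrow> ennreal) g. 0 < \<rho> \<Longrightarrow> f \<in> borel_measurable borel \<Longrightarrow> g \<in> borel_measurable borel \<Longrightarrow>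
       recip_norm a' f < top \<Longrightarrow> recip_norm b' g < top \<Longrightarrow>
       (\<integral>\<^sup>+x. enn_powr (heis_bilinear \<rho> f g x) s \<partial>lborel)
         \<le> ennreal (C * \<rho> powr (Q * (1 + s - s * (a' + b')))) * enn_powr (recip_norm a' f * recip_norm b' g) s"
    using heis_bilinear_bound[OF ab \<open>0 < s\<close> s1 s2, where 'n='n] unfolding Q_def by blast
  show thesis
  proof (rule that[OF C], fold Q_def)
    fix f g :: "'n heis \<Rightarrow> ennreal" and k :: int
    assume [measurable]: "f \<in> borel_measurable borel" "g \<in> borel_measurable borel"
      and fin: "recip_norm a' f < top" "recip_norm b' g < top"
    have "(\<integral>\<^sup>+x. enn_powr (heis_piece lam f g k x) s \<partial>lborel)
      = ennreal (2 powr (k * (lam - Q) * s)) * (\<integral>\<^sup>+x. enn_powr (heis_bilinear (2 powr k) f g x) s \<partial>lborel)"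
      unfolding heis_piece_def enn_powr_mult Q_def
      by (subst nn_integral_cmult) (simp_all add: enn_powr_ennreal powr_powr)
    also have "\<dots> \<le> ennreal (2 powr (k * (lam - Q) * s)) *
       (ennreal (C * (2 powr k) powr (Q * (1 + s - s * (a' + b')))) * enn_powr (recip_norm a' f * recip_norm b' g) s)"
      using fin by (intro mult_left_mono bound) auto
    finally have "ennreal (2 powr (- (Q / r) * k * (r - s))) * (\<integral>\<^sup>+x. enn_powr (heis_piece lam f g k x) s \<partial>lborel)
      \<le> ennreal (2 powr (- (Q / r) * k * (r - s))) * (ennreal (2 powr (k * (lam - Q) * s)) *
       (ennreal (C * (2 powr k) powr (Q * (1 + s - s * (a' + b')))) * enn_powr (recip_norm a' f * recip_norm b' g) s))"
      by (rule mult_left_mono) simp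
    also have "\<dots> = ennreal (2 powr (- (Q / r) * k * (r - s)) * (2 powr (k * (lam - Q) * s) * (C * 2 powr (k * (Q * (1 + s - s * (a' + b')))))))
        * enn_powr (recip_norm a' f * recip_norm b' g) s"
      using C by (simp add: ennreal_mult powr_powr mult.assoc)
    also have "2 powr (- (Q / r) * k * (r - s)) * (2 powr (k * (lam - Q) * s) * (C * 2 powr (k * (Q * (1 + s - s * (a' + b'))))))
       = C * 2 powr (- (Q / r) * k * (r - s) + k * (lam - Q) * s + k * (Q * (1 + s - s * (a' + b'))))"
      by (simp only: powr_add mult_ac)
    also have "- (Q / r) * k * (r - s) + k * (lam - Q) * s + k * (Q * (1 + s - s * (a' + b')))
       = (k * Q * (a - a') + k * Q * (b - b')) * s"
    proof -
      have "lam = Q * (a + b - 1 / r)" using r Q by (simp add: Q_def field_simps)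
      show ?thesis unfolding \<open>lam = _\<close> using \<open>0 < r\<close> by (simp add: field_simps)
    qed
    also have "2 powr ((k * Q * (a - a') + k * Q * (b - b')) * s) = 2 powr (k * Q * (a - a') * s) * 2 powr (k * Q * (b - b') * s)"
      by (simp only: distrib_right powr_add)
    also have "ennreal (C * (2 powr (k * Q * (a - a') * s) * 2 powr (k * Q * (b - b') * s))) * enn_powr (recip_norm a' f * recip_norm b' g) s
       = ennreal C * enn_powr ((ennreal (2 powr (k * Q * (a - a'))) * recip_norm a' f)
                  * (ennreal (2 powr (k * Q * (b - b'))) * recip_norm b' g)) s"
      using C by (simp add: enn_powr_mult enn_powr_ennreal powr_powr ennreal_mult ac_simps)
    finally show "ennreal (2 powr (- (Q / r) * k * (r - s))) * (\<integral>\<^sup>+x. enn_powr (heis_piece lam f g k x) s \<partial>lborel)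
         \<le> ennreal C * enn_powr ((ennreal (2 powr (k * Q * (a - a'))) * recip_norm a' f)
                  * (ennreal (2 powr (k * Q * (b - b'))) * recip_norm b' g)) s" .
  qed
qed

lemma pos_less_finite_set:
  fixes A :: "real set"
  assumes "finite A" "\<forall>x\<in>A. 0 < x"
  shows "\<exists>e>0. \<forall>x\<in>A. e < x"
proof -
  define m where "m = Min (insert 1 A)"
  have "0 < m" using assms unfolding m_def by (subst Min_gr_iff) auto
  have "m / 2 < x" if "x \<in> A" for x
  proof -
    have "m \<le> x" using assms that unfolding m_def by (intro Min_le) auto
    with \<open>0 < m\<close> show ?thesis by linarith
  qed
  with \<open>0 < m\<close> show ?thesis by (intro exI[of _ "m / 2"]) auto
qed

text \<open>Here \<open>a\<close> and \<open>b\<close> stay fixed and only the target exponent moves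
  to both sides of \<open>r\<close>. Each scale contributes a bounded amount, and the weights
  centred at \<open>c\<close>, where \<open>t = 2 powr (- \<kappa> * c)\<close>, make the sum over
  the scales bounded independently of \<open>t\<close>.\<close>

theorem heis_pieces_weak:
  fixes lam a b r :: real
  assumes lam: "0 < lam" "lam < hom_dim TYPE('n::finite)"
    and ab: "0 \<le> a" "a \<le> 1" "0 \<le> b" "b \<le> 1"
    and "0 < r" and r: "1 / r = a + b - lam / hom_dim TYPE('n)"
  obtains C where "0 < C"
    "\<And>(f :: 'n heis \<Rightarrow> ennreal) g t. f \<in> borel_measurable borel \<Longrightarrow> g \<in> borel_measurable borel \<Longrightarrow>
       recip_norm a f \<le> 1 \<Longrightarrow> recip_norm b g \<le> 1 \<Longrightarrow> 0 < t \<Longrightarrow>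
       ennreal (t powr r) * emeasure lborel {x. ennreal t < (\<integral>\<^sup>+k. heis_piece lam f g k x \<partial>count_space UNIV)} \<le> ennreal C"
proof -
  define Q where "Q = hom_dim TYPE('n)"
  have Q: "0 < Q" by (simp add: Q_def hom_dim_pos)
  define \<kappa> where "\<kappa> = Q / r"
  have \<kappa>: "0 < \<kappa>" using Q \<open>0 < r\<close> by (simp add: \<kappa>_def)
  have L: "0 < lam / Q" "lam / Q < 1" using lam Q by (auto simp: Q_def)
  \<comment> \<open>The three bounds give, in this order, \<open>1 / s0 \<le> a + b\<close>,
    \<open>a + b \<le> 1 + 1 / s1\<close> and \<open>0 < s1\<close>.\<close>
  obtain \<epsilon> where \<epsilon>: "0 < \<epsilon>" "\<epsilon> < lam / Q" "\<epsilon> < 1 - lam / Q" "\<epsilon> < 1 / r"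
    using pos_less_finite_set[of "{lam / Q, 1 - lam / Q, 1 / r}"] L \<open>0 < r\<close> by auto
  define s0 s1 where "s0 = 1 / (1 / r + \<epsilon>)" and "s1 = 1 / (1 / r - \<epsilon>)"
  have inv: "1 / s0 = 1 / r + \<epsilon>" "1 / s1 = 1 / r - \<epsilon>" by (auto simp: s0_def s1_def)
  have s: "0 < s0" "s0 < r" "r < s1" "0 < s1"
  proof -
    have "0 < 1 / r" using \<open>0 < r\<close> by simp
    then show "0 < s0" "0 < s1" using \<epsilon> by (auto simp: s0_def s1_def)
    moreover have "1 / r < 1 / s0" "1 / s1 < 1 / r" using \<epsilon> inv by auto
    ultimately show "s0 < r" "r < s1" using \<open>0 < r\<close> by (simp_all add: field_simps)
  qed
  obtain C0 where C0: "0 < C0" and b0: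
    "\<And>(f :: 'n heis \<Rightarrow> ennreal) g (k :: int). f \<in> borel_measurable borel \<Longrightarrow> g \<in> borel_measurable borel \<Longrightarrow>
       recip_norm a f < top \<Longrightarrow> recip_norm b g < top \<Longrightarrow>
       ennreal (2 powr (- \<kappa> * k * (r - s0))) * (\<integral>\<^sup>+x. enn_powr (heis_piece lam f g k x) s0 \<partial>lborel)
         \<le> ennreal C0 * enn_powr (recip_norm a f * recip_norm b g) s0"
    using heis_piece_bound[OF ab s(1) _ _ \<open>0 < r\<close> r] \<epsilon> r unfolding inv Q_def[symmetric] \<kappa>_def by auto
  obtain C1 where C1: "0 < C1" and b1:
    "\<And>(f :: 'n heis \<Rightarrow> ennreal) g (k :: int). f \<in> borel_measurable borel \<Longrightarrow> g \<in> borel_measurable borel \<Longrightarrow>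
       recip_norm a f < top \<Longrightarrow> recip_norm b g < top \<Longrightarrow>
       ennreal (2 powr (- \<kappa> * k * (r - s1))) * (\<integral>\<^sup>+x. enn_powr (heis_piece lam f g k x) s1 \<partial>lborel)
         \<le> ennreal C1 * enn_powr (recip_norm a f * recip_norm b g) s1"
    using heis_piece_bound[OF ab s(4) _ _ \<open>0 < r\<close> r] \<epsilon> r unfolding inv Q_def[symmetric] \<kappa>_def by auto
  obtain C \<eta> where C: "0 < C" "0 < \<eta>" and bound:
    "\<And>(x :: int \<Rightarrow> ennreal) c. ennreal (2 powr (- \<kappa> * c)) \<le> (\<integral>\<^sup>+k. x k \<partial>count_space UNIV) \<Longrightarrow>
      ennreal (2 powr (- \<kappa> * c * r)) \<le> ennreal C * (\<integral>\<^sup>+k. ennreal (2 powr (- \<eta> * \<bar>real_of_int k - c\<bar>)) *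
        (ennreal (2 powr (- \<kappa> * k * (r - s0))) * enn_powr (x k) s0
         + ennreal (2 powr (- \<kappa> * k * (r - s1))) * enn_powr (x k) s1) \<partial>count_space UNIV)"
    by (rule dyadic_sum_powr_bound[OF s(1-3) \<kappa>]) (rule that)
  obtain G where G: "0 < G" "\<And>c. (\<integral>\<^sup>+k. ennreal (2 powr (- \<eta> * \<bar>real_of_int k - c\<bar>)) \<partial>count_space UNIV) \<le> ennreal G"
    using nn_integral_geometric_int[OF C(2)] by blast
  show thesis
  proof (rule that[of "C * (G * (C0 + C1))"])
    show "0 < C * (G * (C0 + C1))" using C G C0 C1 by simp
    fix f g :: "'n heis \<Rightarrow> ennreal" and t :: real
    assume [measurable]: "f \<in> borel_measurable borel" "g \<in> borel_measurable borel"
      and fg: "recip_norm a f \<le> 1" "recip_norm b g \<le> 1" and t: "0 < t"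
    have fin: "recip_norm a f < top" "recip_norm b g < top"
      using fg by (auto intro: le_less_trans)
    have le1: "enn_powr (recip_norm a f * recip_norm b g) s \<le> 1" if "0 < s" for s
      using fg that mult_mono[OF fg] by (intro enn_powr_le_1) auto
    define c where "c = - log 2 t / \<kappa>"
    have tc: "2 powr (- \<kappa> * c) = t" "2 powr (- \<kappa> * c * r) = t powr r"
      using t \<kappa> by (simp_all add: c_def powr_powr[symmetric])
    define Z where "Z k x = ennreal (2 powr (- \<eta> * \<bar>real_of_int k - c\<bar>)) *
        (ennreal (2 powr (- \<kappa> * k * (r - s0))) * enn_powr (heis_piece lam f g k x) s0
         + ennreal (2 powr (- \<kappa> * k * (r - s1))) * enn_powr (heis_piece lam f g k x) s1)" for k x
    have [measurable]: "Z k \<in> borel_measurable borel" for k unfolding Z_def[abs_def] by measurable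
    define E where "E = {x. ennreal t < (\<integral>\<^sup>+k. heis_piece lam f g k x \<partial>count_space UNIV)}"
    have [measurable]: "E \<in> sets borel" unfolding E_def by measurable
    have Zint: "(\<integral>\<^sup>+x. Z k x \<partial>lborel) \<le> ennreal (2 powr (- \<eta> * \<bar>real_of_int k - c\<bar>)) * ennreal (C0 + C1)" for k
    proof -
      have "(\<integral>\<^sup>+x. Z k x \<partial>lborel) = ennreal (2 powr (- \<eta> * \<bar>real_of_int k - c\<bar>)) *
        (ennreal (2 powr (- \<kappa> * k * (r - s0))) * (\<integral>\<^sup>+x. enn_powr (heis_piece lam f g k x) s0 \<partial>lborel)
         + ennreal (2 powr (- \<kappa> * k * (r - s1))) * (\<integral>\<^sup>+x. enn_powr (heis_piece lam f g k x) s1 \<partial>lborel))"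
        unfolding Z_def by (simp add: nn_integral_cmult nn_integral_add)
      also have "\<dots> \<le> ennreal (2 powr (- \<eta> * \<bar>real_of_int k - c\<bar>)) * (ennreal C0 * 1 + ennreal C1 * 1)"
        using fin s
        by (intro mult_left_mono add_mono order_trans[OF b0 mult_left_mono] order_trans[OF b1 mult_left_mono] le1) auto
      finally show ?thesis using C0 C1 by (simp add: ennreal_plus)
    qed
    have "ennreal (t powr r) * emeasure lborel E = (\<integral>\<^sup>+x. ennreal (t powr r) * indicator E x \<partial>lborel)"
      by (simp add: nn_integral_cmult)
    also have "\<dots> \<le> (\<integral>\<^sup>+x. ennreal C * (\<integral>\<^sup>+k. Z k x \<partial>count_space UNIV) \<partial>lborel)"
    proof (rule nn_integral_mono)
      fix x
      show "ennreal (t powr r) * indicator E x \<le> ennreal C * (\<integral>\<^sup>+k. Z k x \<partial>count_space UNIV)"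
        using bound[of c "\<lambda>k. heis_piece lam f g k x"] unfolding tc Z_def by (auto simp: E_def indicator_def)
    qed
    also have "\<dots> = ennreal C * (\<integral>\<^sup>+x. \<integral>\<^sup>+k. Z k x \<partial>count_space UNIV \<partial>lborel)"
      by (rule nn_integral_cmult) measurable
    also have "(\<integral>\<^sup>+x. \<integral>\<^sup>+k. Z k x \<partial>count_space UNIV \<partial>lborel) = (\<integral>\<^sup>+k. \<integral>\<^sup>+x. Z k x \<partial>lborel \<partial>count_space UNIV)"
      by (rule nn_integral_count_space_nn_integral) auto
    also have "\<dots> \<le> (\<integral>\<^sup>+k. ennreal (2 powr (- \<eta> * \<bar>real_of_int k - c\<bar>)) * ennreal (C0 + C1) \<partial>count_space UNIV)"
      by (rule nn_integral_mono[OF Zint])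
    also have "\<dots> = (\<integral>\<^sup>+k. ennreal (2 powr (- \<eta> * \<bar>real_of_int k - c\<bar>)) \<partial>count_space UNIV) * ennreal (C0 + C1)"
      by (rule nn_integral_multc) simp
    also have "\<dots> \<le> ennreal G * ennreal (C0 + C1)"
      by (intro mult_right_mono G) simp
    finally show "ennreal (t powr r) * emeasure lborel {x. ennreal t < (\<integral>\<^sup>+k. heis_piece lam f g k x \<partial>count_space UNIV)}
      \<le> ennreal (C * (G * (C0 + C1)))"
      using C G C0 C1 by (simp add: E_def ennreal_mult mult_left_mono)
  qed
qed

section \<open>Strong type estimate\<close>


text \<open>Encodes that the rescaled norms of \<^term>\<open>\<phi> k\<close> with exponent \<^term>\<open>1 / a'\<close> are summable over the
  scales \<^term>\<open>2 powr k\<close>, where the scaling is that of a fixed function in the space with exponent \<^term>\<open>1 / a\<close>.\<close>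

definition scale_controlled ::
    "real \<Rightarrow> real \<Rightarrow> real \<Rightarrow> real \<Rightarrow> (int \<Rightarrow> 'a::euclidean_space \<Rightarrow> ennreal) \<Rightarrow> bool" where
  "scale_controlled Q a a' F \<phi> \<longleftrightarrow>
     (\<forall>k. \<phi> k \<in> borel_measurable borel) \<and>
     (\<forall>k. ennreal (2 powr (k * Q * (a - a'))) * recip_norm a' (\<phi> k) \<le> ennreal F) \<and>
     (0 < a' \<longrightarrow> (\<integral>\<^sup>+k. enn_powr (ennreal (2 powr (k * Q * (a - a'))) * recip_norm a' (\<phi> k)) (1 / a') \<partial>count_space UNIV)
        \<le> enn_powr (ennreal F) (1 / a'))"

text \<open>The equation between truth values treats both truncations at once: values above the
  height are kept if \<open>a < a'\<close>, values up to it if \<open>a' < a\<close>. For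
  \<open>y = 2 powr (- Q * a * c)\<close> the condition puts \<open>k\<close> on the side of
  \<open>c\<close> where the term equals \<open>2 powr (- \<delta> * \<bar>k - c\<bar>)\<close>
  times \<open>y powr (1 / a)\<close>, so the sum is geometric.\<close>

lemma truncation_pointwise_bound:
  assumes Q: "0 < Q" and a: "0 < a" "0 < a'" "a' \<noteq> a"
  obtains G where "0 < G" "\<And>y. (\<integral>\<^sup>+k. (if (ennreal (2 powr (- (real_of_int k) * Q * a)) < y) = (a < a')
      then ennreal (2 powr (k * Q * (a - a') / a')) * enn_powr y (1 / a') else 0) \<partial>count_space UNIV)
      \<le> ennreal G * enn_powr y (1 / a)"
proof -
  define \<delta> where "\<delta> = Q * \<bar>a - a'\<bar> / a'"
  have "0 < \<delta>" using assms by (simp add: \<delta>_def)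
  then obtain G where G: "0 < G" "\<And>c. (\<integral>\<^sup>+k. ennreal (2 powr (- \<delta> * \<bar>real_of_int k - c\<bar>)) \<partial>count_space UNIV) \<le> ennreal G"
    using nn_integral_geometric_int[of \<delta>] by blast
  show thesis
  proof (rule that[OF G(1)])
    fix y :: ennreal
    consider "y = 0" | "y = top" | z where "y = ennreal z" "0 < z"
      by (metis ennreal_cases ennreal_eq_0_iff not_le)
    then show "(\<integral>\<^sup>+k. (if (ennreal (2 powr (- (real_of_int k) * Q * a)) < y) = (a < a')
      then ennreal (2 powr (k * Q * (a - a') / a')) * enn_powr y (1 / a') else 0) \<partial>count_space UNIV)
      \<le> ennreal G * enn_powr y (1 / a)"
    proof cases
      case 1
      then show ?thesis by (simp cong: if_cong)
    next
      case 2
      then show ?thesis using G by (simp add: ennreal_mult_top)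
    next
      case (3 z)
      define c where "c = - log 2 z / (Q * a)"
      have z: "z = 2 powr (- Q * a * c)" using 3 Q a by (simp add: c_def)
      have "(\<integral>\<^sup>+k. (if (ennreal (2 powr (- (real_of_int k) * Q * a)) < y) = (a < a')
        then ennreal (2 powr (k * Q * (a - a') / a')) * enn_powr y (1 / a') else 0) \<partial>count_space UNIV)
        \<le> (\<integral>\<^sup>+k. ennreal (2 powr (- \<delta> * \<bar>real_of_int k - c\<bar>)) * enn_powr y (1 / a) \<partial>count_space UNIV)"
      proof (rule nn_integral_mono)
        fix k :: int
        have "ennreal (2 powr (k * Q * (a - a') / a')) * enn_powr y (1 / a')
          \<le> ennreal (2 powr (- \<delta> * \<bar>real_of_int k - c\<bar>)) * enn_powr y (1 / a)"
          if "(ennreal (2 powr (- (real_of_int k) * Q * a)) < y) = (a < a')"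
        proof -
          have "(- (real_of_int k) * Q * a < - Q * a * c) = (a < a')"
            using that 3 unfolding z by (simp add: ennreal_less_iff)
          also have "(- (real_of_int k) * Q * a < - Q * a * c) \<longleftrightarrow> (Q * a) * c < (Q * a) * real_of_int k"
            by (simp add: mult_ac)
          also have "\<dots> \<longleftrightarrow> c < k"
            using Q a by simp
          finally have "\<bar>a - a'\<bar> * \<bar>real_of_int k - c\<bar> = (a' - a) * (k - c)"
            using a by (cases "a < a'") (auto simp: abs_if algebra_simps)
          then have "\<delta> * \<bar>real_of_int k - c\<bar> = Q / a' * ((a' - a) * (k - c))"
            by (simp add: \<delta>_def)
          then have "- \<delta> * \<bar>real_of_int k - c\<bar> = - (Q / a' * ((a' - a) * (k - c)))"
            by simp
          then have "k * Q * (a - a') / a' + - Q * a * c * (1 / a') = - \<delta> * \<bar>real_of_int k - c\<bar> + - Q * a * c * (1 / a)"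
            by (simp only:) (use a in \<open>simp add: field_simps\<close>)
          then have "2 powr (k * Q * (a - a') / a') * z powr (1 / a') = 2 powr (- \<delta> * \<bar>real_of_int k - c\<bar>) * z powr (1 / a)"
            unfolding z powr_powr powr_add[symmetric] by simp
          then show ?thesis using 3 by (simp add: enn_powr_ennreal flip: ennreal_mult)
        qed
        then show "(if (ennreal (2 powr (- (real_of_int k) * Q * a)) < y) = (a < a')
          then ennreal (2 powr (k * Q * (a - a') / a')) * enn_powr y (1 / a') else 0)
          \<le> ennreal (2 powr (- \<delta> * \<bar>real_of_int k - c\<bar>)) * enn_powr y (1 / a)"
          by simp
      qed
      also have "\<dots> = (\<integral>\<^sup>+k. ennreal (2 powr (- \<delta> * \<bar>real_of_int k - c\<bar>)) \<partial>count_space UNIV) * enn_powr y (1 / a)"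
        by (rule nn_integral_multc) simp
      also have "\<dots> \<le> ennreal G * enn_powr y (1 / a)"
        by (intro mult_right_mono G) simp
      finally show ?thesis .
    qed
  qed
qed

text \<open>Exchanging the sum over \<open>k\<close> with the integral over \<open>x\<close> reduces
  summability to the pointwise bound. The bound uniform in \<open>k\<close> follows, since a single
  term is at most the sum.\<close>

lemma scale_controlled_truncation:
  assumes Q: "0 < Q" and a: "0 < a" "0 < a'" "a' \<noteq> a"
  obtains F where "0 < F" "\<And>f :: 'a::euclidean_space \<Rightarrow> ennreal. f \<in> borel_measurable borel \<Longrightarrow> recip_norm a f \<le> 1 \<Longrightarrow>
     scale_controlled Q a a' F (\<lambda>k x. if (ennreal (2 powr (- (real_of_int k) * Q * a)) < f x) = (a < a') then f x else 0)"
proof -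
  obtain G where G: "0 < G" and bound: "\<And>y. (\<integral>\<^sup>+k. (if (ennreal (2 powr (- (real_of_int k) * Q * a)) < y) = (a < a')
      then ennreal (2 powr (k * Q * (a - a') / a')) * enn_powr y (1 / a') else 0) \<partial>count_space UNIV)
      \<le> ennreal G * enn_powr y (1 / a)"
    by (rule truncation_pointwise_bound[OF assms]) (rule that)
  show thesis
  proof (rule that[of "G powr a'"])
    show "0 < G powr a'" using G by simp
    fix f :: "'a \<Rightarrow> ennreal"
    assume [measurable]: "f \<in> borel_measurable borel" and f1: "recip_norm a f \<le> 1"
    define \<phi> where "\<phi> k x = (if (ennreal (2 powr (- (real_of_int k) * Q * a)) < f x) = (a < a') then f x else 0)" for k :: int and x
    have meas [measurable]: "\<phi> k \<in> borel_measurable borel" for k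
      unfolding \<phi>_def[abs_def] by measurable
    define X where "X k = ennreal (2 powr (k * Q * (a - a'))) * recip_norm a' (\<phi> k)" for k :: int
    have Xp: "enn_powr (X k) (1 / a') = (\<integral>\<^sup>+x. ennreal (2 powr (k * Q * (a - a') / a')) * enn_powr (\<phi> k x) (1 / a') \<partial>lborel)" for k
      using a by (simp add: X_def recip_norm_def enn_powr_mult enn_powr_powr enn_powr_ennreal powr_powr nn_integral_cmult)
    have "(\<integral>\<^sup>+k. enn_powr (X k) (1 / a') \<partial>count_space UNIV)
      = (\<integral>\<^sup>+x. \<integral>\<^sup>+k. ennreal (2 powr (k * Q * (a - a') / a')) * enn_powr (\<phi> k x) (1 / a') \<partial>count_space UNIV \<partial>lborel)"
      unfolding Xp by (rule nn_integral_count_space_nn_integral[symmetric]) auto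
    also have "\<dots> \<le> (\<integral>\<^sup>+x. ennreal G * enn_powr (f x) (1 / a) \<partial>lborel)"
    proof (rule nn_integral_mono)
      fix x
      have "ennreal (2 powr (k * Q * (a - a') / a')) * enn_powr (\<phi> k x) (1 / a')
        = (if (ennreal (2 powr (- (real_of_int k) * Q * a)) < f x) = (a < a')
      then ennreal (2 powr (k * Q * (a - a') / a')) * enn_powr (f x) (1 / a') else 0)" for k
        by (simp add: \<phi>_def)
      then show "(\<integral>\<^sup>+k. ennreal (2 powr (k * Q * (a - a') / a')) * enn_powr (\<phi> k x) (1 / a') \<partial>count_space UNIV)
        \<le> ennreal G * enn_powr (f x) (1 / a)"
        using bound[of "f x"] by (simp only:)
    qed
    also have "\<dots> = ennreal G * (\<integral>\<^sup>+x. enn_powr (f x) (1 / a) \<partial>lborel)"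
      by (rule nn_integral_cmult) measurable
    also have "\<dots> \<le> ennreal G * 1"
    proof (rule mult_left_mono)
      have "enn_powr (\<integral>\<^sup>+x. enn_powr (f x) (1 / a) \<partial>lborel) a \<le> enn_powr 1 a"
        using f1 a by (simp add: recip_norm_def)
      then show "(\<integral>\<^sup>+x. enn_powr (f x) (1 / a) \<partial>lborel) \<le> 1"
        using a by (subst (asm) enn_powr_le_iff) auto
    qed simp
    finally have sum: "(\<integral>\<^sup>+k. enn_powr (X k) (1 / a') \<partial>count_space UNIV) \<le> ennreal G" by simp
    have FG: "enn_powr (ennreal (G powr a')) (1 / a') = ennreal G"
      using G a by (simp add: enn_powr_ennreal powr_powr)
    have "X k \<le> ennreal (G powr a')" for k
    proof -
      have "enn_powr (X k) (1 / a') \<le> (\<integral>\<^sup>+k. enn_powr (X k) (1 / a') \<partial>count_space UNIV)"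
        by (rule nn_integral_ge_point) simp
      also note sum
      finally have "enn_powr (X k) (1 / a') \<le> enn_powr (ennreal (G powr a')) (1 / a')"
        unfolding FG .
      then show ?thesis using a by (subst (asm) enn_powr_le_iff) auto
    qed
    with sum meas show "scale_controlled Q a a' (G powr a')
        (\<lambda>k x. if (ennreal (2 powr (- (real_of_int k) * Q * a)) < f x) = (a < a') then f x else 0)"
      unfolding scale_controlled_def FG unfolding X_def \<phi>_def[abs_def] by auto
  qed
qed

lemma scale_controlled_mono:
  assumes "scale_controlled Q a a' F \<phi>" "F \<le> F'" "0 \<le> a'"
  shows "scale_controlled Q a a' F' \<phi>"
proof -
  have "ennreal F \<le> ennreal F'" using assms by (intro ennreal_leI)
  moreover from this have "enn_powr (ennreal F) (1 / a') \<le> enn_powr (ennreal F') (1 / a')"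
    using assms by (intro enn_powr_mono) auto
  ultimately show ?thesis
    using assms(1) unfolding scale_controlled_def by (meson order_trans)
qed

text \<open>For \<open>0 < a\<close> the parts above and below the height are measured with
  \<open>a + \<epsilon>\<close> and \<open>a - \<epsilon>\<close>. For \<open>a = 0\<close> the
  function itself is controlled with \<open>a' = 0\<close>: the scaling factor is 1 and the
  summability clause is void.\<close>

lemma scale_controlled_split:
  assumes Q: "0 < Q" and a: "0 \<le> a" and \<epsilon>: "0 < \<epsilon>" "0 < a \<Longrightarrow> \<epsilon> < a"
  obtains F a1 a2 where "0 < F" "0 \<le> a1" "0 \<le> a2" "\<bar>a1 - a\<bar> \<le> \<epsilon>" "\<bar>a2 - a\<bar> \<le> \<epsilon>"
    "\<And>f :: 'a::euclidean_space \<Rightarrow> ennreal. f \<in> borel_measurable borel \<Longrightarrow> recip_norm a f \<le> 1 \<Longrightarrow>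
       \<exists>f1 f2. scale_controlled Q a a1 F f1 \<and> scale_controlled Q a a2 F f2 \<and> (\<forall>k x. f x = f1 k x + f2 k x)"
proof (cases "a = 0")
  case True
  show thesis
  proof (rule that[of 1 0 0])
    fix f :: "'a \<Rightarrow> ennreal"
    assume "f \<in> borel_measurable borel" "recip_norm a f \<le> 1"
    then have "scale_controlled Q a 0 1 (\<lambda>_. f)" "scale_controlled Q a 0 1 (\<lambda>_ _. 0 :: ennreal)"
      using True by (auto simp: scale_controlled_def recip_norm_def)
    then show "\<exists>f1 f2. scale_controlled Q a 0 1 f1 \<and> scale_controlled Q a 0 1 f2 \<and> (\<forall>k x. f x = f1 k x + f2 k x)"
      by (intro exI[of _ "\<lambda>_. f"] exI[of _ "\<lambda>_ _. 0"]) auto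
  qed (use True \<epsilon> in auto)
next
  case False
  with a \<epsilon> have a: "0 < a" "\<epsilon> < a" by auto
  obtain F1 where F1: "0 < F1" and c1: "\<And>f :: 'a::euclidean_space \<Rightarrow> ennreal. f \<in> borel_measurable borel \<Longrightarrow> recip_norm a f \<le> 1 \<Longrightarrow>
     scale_controlled Q a (a + \<epsilon>) F1 (\<lambda>k x. if (ennreal (2 powr (- (real_of_int k) * Q * a)) < f x) = (a < a + \<epsilon>) then f x else 0)"
    by (rule scale_controlled_truncation[OF Q, of a "a + \<epsilon>"]) (use a \<epsilon> in auto)
  obtain F2 where F2: "0 < F2" and c2: "\<And>f :: 'a::euclidean_space \<Rightarrow> ennreal. f \<in> borel_measurable borel \<Longrightarrow> recip_norm a f \<le> 1 \<Longrightarrow>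
     scale_controlled Q a (a - \<epsilon>) F2 (\<lambda>k x. if (ennreal (2 powr (- (real_of_int k) * Q * a)) < f x) = (a < a - \<epsilon>) then f x else 0)"
    by (rule scale_controlled_truncation[OF Q, of a "a - \<epsilon>"]) (use a \<epsilon> in auto)
  show thesis
  proof (rule that[of "max F1 F2" "a + \<epsilon>" "a - \<epsilon>"])
    fix f :: "'a \<Rightarrow> ennreal"
    assume f: "f \<in> borel_measurable borel" "recip_norm a f \<le> 1"
    show "\<exists>f1 f2. scale_controlled Q a (a + \<epsilon>) (max F1 F2) f1 \<and> scale_controlled Q a (a - \<epsilon>) (max F1 F2) f2
        \<and> (\<forall>k x. f x = f1 k x + f2 k x)"
      using \<epsilon> a scale_controlled_mono[OF c1[OF f], of "max F1 F2"] scale_controlled_mono[OF c2[OF f], of "max F1 F2"]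
      by (intro exI conjI) auto
  qed (use a \<epsilon> F1 in auto)
qed

text \<open>Now the sum over the scales converges without any decaying weight: the rescaled norms
  form sequences in \<open>l^(1/a')\<close> and \<open>l^(1/b')\<close>, and
  \<open>1 / s \<le> a' + b'\<close> puts their product into \<open>l^s\<close>.\<close>

lemma scale_controlled_pair_bound:
  assumes ab: "0 \<le> a'" "a' \<le> 1" "0 \<le> b'" "b' \<le> 1" and "0 < s"
    and s1: "1 / s \<le> a' + b'" and s2: "a' + b' \<le> 1 + 1 / s"
    and "0 < r" and r: "1 / r = a + b - lam / hom_dim TYPE('n::finite)"
  obtains C where "0 < C"
    "\<And>(f :: int \<Rightarrow> 'n heis \<Rightarrow> ennreal) g. scale_controlled (hom_dim TYPE('n)) a a' F f \<Longrightarrow>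
       scale_controlled (hom_dim TYPE('n)) b b' G g \<Longrightarrow>
       (\<integral>\<^sup>+k. ennreal (2 powr (- (hom_dim TYPE('n) / r) * k * (r - s)))
          * (\<integral>\<^sup>+x. enn_powr (heis_piece lam (f k) (g k) k x) s \<partial>lborel) \<partial>count_space UNIV) \<le> ennreal C"
proof -
  define Q where "Q = hom_dim TYPE('n)"
  obtain C where C: "0 < C" and bound:
    "\<And>(f :: 'n heis \<Rightarrow> ennreal) g (k :: int). f \<in> borel_measurable borel \<Longrightarrow> g \<in> borel_measurable borel \<Longrightarrow>
       recip_norm a' f < top \<Longrightarrow> recip_norm b' g < top \<Longrightarrow>
       ennreal (2 powr (- (Q / r) * k * (r - s))) * (\<integral>\<^sup>+x. enn_powr (heis_piece lam f g k x) s \<partial>lborel)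
         \<le> ennreal C * enn_powr ((ennreal (2 powr (k * Q * (a - a'))) * recip_norm a' f)
                  * (ennreal (2 powr (k * Q * (b - b'))) * recip_norm b' g)) s"
    by (rule heis_piece_bound[OF assms, folded Q_def]) (rule that)
  show thesis
  \<comment> \<open>The maxima imitate \<open>ennreal\<close>, which sends negative reals to 0;
    adding 1 keeps the constant positive if \<open>F\<close> or \<open>G\<close> is not.\<close>
  proof (rule that[of "C * (2 * (max F 0 * max G 0) powr s) + 1"])
    show "0 < C * (2 * (max F 0 * max G 0) powr s) + 1" using C by (simp add: add_nonneg_pos)
    fix f g :: "int \<Rightarrow> 'n heis \<Rightarrow> ennreal"
    assume fg: "scale_controlled (hom_dim TYPE('n)) a a' F f" "scale_controlled (hom_dim TYPE('n)) b b' G g"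
    define X where "X k = ennreal (2 powr (k * Q * (a - a'))) * recip_norm a' (f k)" for k :: int
    define Y where "Y k = ennreal (2 powr (k * Q * (b - b'))) * recip_norm b' (g k)" for k :: int
    have XY: "X k \<le> ennreal F" "Y k \<le> ennreal G" for k
      using fg by (auto simp: scale_controlled_def X_def Y_def Q_def)
    have fin: "recip_norm a' (f k) < top" "recip_norm b' (g k) < top" for k
      using XY[of k] by (auto simp: X_def Y_def ennreal_mult_less_top top.not_eq_extremum ennreal_mult_eq_top_iff
            dest!: le_less_trans[OF _ ennreal_less_top])
    have "(\<integral>\<^sup>+k. ennreal (2 powr (- (Q / r) * k * (r - s)))
          * (\<integral>\<^sup>+x. enn_powr (heis_piece lam (f k) (g k) k x) s \<partial>lborel) \<partial>count_space UNIV)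
       \<le> (\<integral>\<^sup>+k. ennreal C * enn_powr (X k * Y k) s \<partial>count_space UNIV)"
      unfolding X_def Y_def using fg fin by (intro nn_integral_mono bound) (auto simp: scale_controlled_def)
    also have "\<dots> = ennreal C * (\<integral>\<^sup>+k. enn_powr (X k * Y k) s \<partial>count_space UNIV)"
      by (rule nn_integral_cmult) simp
    also have "(\<integral>\<^sup>+k. enn_powr (X k * Y k) s \<partial>count_space UNIV) \<le> 2 * 1 * enn_powr (ennreal F * ennreal G) s"
      using ab \<open>0 < s\<close> s1 XY fg
      by (intro nn_integral_product_powr_le[of a' b'])
         (auto simp: field_simps X_def Y_def scale_controlled_def Q_def)
    also have "ennreal C * (2 * 1 * enn_powr (ennreal F * ennreal G) s) = ennreal (C * (2 * (max F 0 * max G 0) powr s))"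
    proof -
      have FG: "ennreal F * ennreal G = ennreal (max F 0 * max G 0)"
        by (auto simp: max_def ennreal_neg ennreal_mult)
      have FGs: "enn_powr (ennreal (max F 0 * max G 0)) s = ennreal ((max F 0 * max G 0) powr s)"
        by (rule enn_powr_ennreal) simp
      show ?thesis
        unfolding FG FGs using C by (simp add: ennreal_mult)
    qed
    also have "\<dots> \<le> ennreal (C * (2 * (max F 0 * max G 0) powr s) + 1)"
      by (intro ennreal_leI) simp
    finally show "(\<integral>\<^sup>+k. ennreal (2 powr (- (hom_dim TYPE('n) / r) * k * (r - s)))
          * (\<integral>\<^sup>+x. enn_powr (heis_piece lam (f k) (g k) k x) s \<partial>lborel) \<partial>count_space UNIV)
        \<le> ennreal (C * (2 * (max F 0 * max G 0) powr s) + 1)"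
      by (simp add: Q_def mult_left_mono)
  qed
qed

lemma heis_piece_add_left:
  fixes f f' g :: "'n::finite heis \<Rightarrow> ennreal"
  assumes [measurable]: "f \<in> borel_measurable borel" "f' \<in> borel_measurable borel" "g \<in> borel_measurable borel"
  shows "heis_piece lam (\<lambda>x. f x + f' x) g k x = heis_piece lam f g k x + heis_piece lam f' g k x"
  unfolding heis_piece_def heis_bilinear_def by (simp add: distrib_left distrib_right nn_integral_add)

lemma heis_piece_add_right:
  fixes f g g' :: "'n::finite heis \<Rightarrow> ennreal"
  assumes [measurable]: "f \<in> borel_measurable borel" "g \<in> borel_measurable borel" "g' \<in> borel_measurable borel"
  shows "heis_piece lam f (\<lambda>x. g x + g' x) k x = heis_piece lam f g k x + heis_piece lam f g' k x"
  unfolding heis_piece_def heis_bilinear_def by (simp add: distrib_left distrib_right nn_integral_add)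

text \<open>Splitting both functions and using \<open>s\<close> on both sides of \<open>r\<close>
  leads to eight pair bounds. The strict bounds on \<open>a\<close> and \<open>b\<close> leave room
  for the exponents \<open>a + \<epsilon>\<close> and \<open>b + \<epsilon>\<close> below 1.\<close>

theorem heis_pieces_strong:
  fixes lam a b r :: real
  assumes lam: "0 < lam" "lam < hom_dim TYPE('n::finite)"
    and ab: "0 \<le> a" "a < 1" "0 \<le> b" "b < 1"
    and "0 < r" and r: "1 / r = a + b - lam / hom_dim TYPE('n)"
  obtains C where "0 < C"
    "\<And>(f :: 'n heis \<Rightarrow> ennreal) g. f \<in> borel_measurable borel \<Longrightarrow> g \<in> borel_measurable borel \<Longrightarrow>
       recip_norm a f \<le> 1 \<Longrightarrow> recip_norm b g \<le> 1 \<Longrightarrow>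
       (\<integral>\<^sup>+x. enn_powr (\<integral>\<^sup>+k. heis_piece lam f g k x \<partial>count_space UNIV) r \<partial>lborel) \<le> ennreal C"
proof -
  define Q where "Q = hom_dim TYPE('n)"
  have Q: "0 < Q" by (simp add: Q_def hom_dim_pos)
  define \<kappa> where "\<kappa> = Q / r"
  have \<kappa>: "0 < \<kappa>" using Q \<open>0 < r\<close> by (simp add: \<kappa>_def)
  have L: "0 < lam / Q" "lam / Q < 1" using lam Q by (auto simp: Q_def)
  \<comment> \<open>The value 1 is a dummy: it makes \<open>\<epsilon> < a\<close> a constraint only
    when \<open>a\<close> is positive, and likewise for \<open>b\<close>.\<close>
  define a0 b0 where "a0 = (if 0 < a then a else 1)" and "b0 = (if 0 < b then b else 1)"
  have "0 < a0" "0 < b0" by (auto simp: a0_def b0_def)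
  then obtain \<epsilon> where "0 < \<epsilon>" "\<epsilon> < lam / Q / 3" "\<epsilon> < (1 - lam / Q) / 3" "\<epsilon> < 1 / r" "\<epsilon> < 1 - a" "\<epsilon> < 1 - b"
      "\<epsilon> < a0" "\<epsilon> < b0"
    using pos_less_finite_set[of "{lam / Q / 3, (1 - lam / Q) / 3, 1 / r, 1 - a, 1 - b, a0, b0}"] L \<open>0 < r\<close> ab by auto
  then have \<epsilon>: "0 < \<epsilon>" "\<epsilon> < lam / Q / 3" "\<epsilon> < (1 - lam / Q) / 3" "\<epsilon> < 1 / r" "\<epsilon> < 1 - a" "\<epsilon> < 1 - b"
      "0 < a \<Longrightarrow> \<epsilon> < a" "0 < b \<Longrightarrow> \<epsilon> < b"
    by (simp_all add: a0_def b0_def)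
  define s0 s1 where "s0 = 1 / (1 / r + \<epsilon>)" and "s1 = 1 / (1 / r - \<epsilon>)"
  have inv: "1 / s0 = 1 / r + \<epsilon>" "1 / s1 = 1 / r - \<epsilon>" by (auto simp: s0_def s1_def)
  have s: "0 < s0" "s0 < r" "r < s1" "0 < s1"
  proof -
    have "0 < 1 / r" using \<open>0 < r\<close> by simp
    then show "0 < s0" "0 < s1" using \<epsilon> by (auto simp: s0_def s1_def)
    moreover have "1 / r < 1 / s0" "1 / s1 < 1 / r" using \<epsilon> inv by auto
    ultimately show "s0 < r" "r < s1" using \<open>0 < r\<close> by (simp_all add: field_simps)
  qed
  obtain F a1 a2 where F: "0 < F" "0 \<le> a1" "0 \<le> a2" "\<bar>a1 - a\<bar> \<le> \<epsilon>" "\<bar>a2 - a\<bar> \<le> \<epsilon>" and splita: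
    "\<And>f :: 'n heis \<Rightarrow> ennreal. f \<in> borel_measurable borel \<Longrightarrow> recip_norm a f \<le> 1 \<Longrightarrow>
       \<exists>f1 f2. scale_controlled Q a a1 F f1 \<and> scale_controlled Q a a2 F f2 \<and> (\<forall>k x. f x = f1 k x + f2 k x)"
    by (rule scale_controlled_split[OF Q ab(1) \<epsilon>(1,7)]) (assumption, rule that)
  obtain G b1 b2 where G: "0 < G" "0 \<le> b1" "0 \<le> b2" "\<bar>b1 - b\<bar> \<le> \<epsilon>" "\<bar>b2 - b\<bar> \<le> \<epsilon>" and splitb:
    "\<And>f :: 'n heis \<Rightarrow> ennreal. f \<in> borel_measurable borel \<Longrightarrow> recip_norm b f \<le> 1 \<Longrightarrow>
       \<exists>f1 f2. scale_controlled Q b b1 G f1 \<and> scale_controlled Q b b2 G f2 \<and> (\<forall>k x. f x = f1 k x + f2 k x)"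
    by (rule scale_controlled_split[OF Q ab(3) \<epsilon>(1,8)]) (assumption, rule that)
  define N where "N s f g = (\<integral>\<^sup>+k. ennreal (2 powr (- \<kappa> * real_of_int k * (r - s)))
          * (\<integral>\<^sup>+x. enn_powr (heis_piece lam (f k) (g k) k x) s \<partial>lborel) \<partial>count_space UNIV)"
    for s and f g :: "int \<Rightarrow> 'n heis \<Rightarrow> ennreal"
  have pair: "\<exists>C>0. \<forall>f g. scale_controlled Q a a' F f \<longrightarrow> scale_controlled Q b b' G g \<longrightarrow> N s f g \<le> ennreal C"
    if "a' = a1 \<or> a' = a2" "b' = b1 \<or> b' = b2" "s = s0 \<or> s = s1" for a' b' s
  proof -
    have *: "0 \<le> a'" "\<bar>a' - a\<bar> \<le> \<epsilon>" "0 \<le> b'" "\<bar>b' - b\<bar> \<le> \<epsilon>" "0 < s" "\<bar>1 / s - 1 / r\<bar> \<le> \<epsilon>"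
      using that F G s inv \<epsilon> by auto
    have le: "a' \<le> 1" "b' \<le> 1" "1 / s \<le> a' + b'" "a' + b' \<le> 1 + 1 / s"
    \<comment> \<open>Three quantities, \<open>a'\<close>, \<open>b'\<close> and
      \<open>1 / s\<close>, each move by at most \<open>\<epsilon>\<close>, so
      \<open>3 * \<epsilon>\<close> must fit into both gaps \<open>lam / Q\<close> and
      \<open>1 - lam / Q\<close>.\<close>
    proof -
      define l i j where "l = lam / Q" and "i = 1 / s" and "j = 1 / r"
      have "\<bar>a' - a\<bar> \<le> \<epsilon>" "\<bar>b' - b\<bar> \<le> \<epsilon>" "\<bar>i - j\<bar> \<le> \<epsilon>" "3 * \<epsilon> < l" "3 * \<epsilon> < 1 - l" "\<epsilon> < 1 - a" "\<epsilon> < 1 - b" "j = a + b - l"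
        using * \<epsilon> r by (auto simp: l_def i_def j_def Q_def)
      then show "a' \<le> 1" "b' \<le> 1" "1 / s \<le> a' + b'" "a' + b' \<le> 1 + 1 / s"
        unfolding i_def[symmetric] by - linarith+
    qed
    obtain C where "0 < C" "\<And>(f :: int \<Rightarrow> 'n heis \<Rightarrow> ennreal) g. scale_controlled Q a a' F f \<Longrightarrow>
       scale_controlled Q b b' G g \<Longrightarrow> N s f g \<le> ennreal C"
      by (rule scale_controlled_pair_bound[OF *(1) le(1) *(3) le(2) *(5) le(3,4) \<open>0 < r\<close> r, folded Q_def, of F G])
         (rule that, assumption, simp only: N_def \<kappa>_def)
    then show ?thesis by blast
  qed
  have key: "\<exists>C>0. \<forall>f g. f \<in> borel_measurable borel \<longrightarrow> g \<in> borel_measurable borel \<longrightarrow>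
       recip_norm a f \<le> 1 \<longrightarrow> recip_norm b g \<le> 1 \<longrightarrow> N s (\<lambda>_. f) (\<lambda>_. g) \<le> ennreal C"
    if ss: "s = s0 \<or> s = s1" for s
  proof -
    obtain C11 where C11: "0 < C11" "\<And>f g. scale_controlled Q a a1 F f \<Longrightarrow> scale_controlled Q b b1 G g \<Longrightarrow> N s f g \<le> ennreal C11"
      using pair[OF _ _ ss, of a1 b1] by blast
    obtain C12 where C12: "0 < C12" "\<And>f g. scale_controlled Q a a1 F f \<Longrightarrow> scale_controlled Q b b2 G g \<Longrightarrow> N s f g \<le> ennreal C12"
      using pair[OF _ _ ss, of a1 b2] by blast
    obtain C21 where C21: "0 < C21" "\<And>f g. scale_controlled Q a a2 F f \<Longrightarrow> scale_controlled Q b b1 G g \<Longrightarrow> N s f g \<le> ennreal C21"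
      using pair[OF _ _ ss, of a2 b1] by blast
    obtain C22 where C22: "0 < C22" "\<And>f g. scale_controlled Q a a2 F f \<Longrightarrow> scale_controlled Q b b2 G g \<Longrightarrow> N s f g \<le> ennreal C22"
      using pair[OF _ _ ss, of a2 b2] by blast
    have "0 < s" using ss s by auto
    \<comment> \<open>Four summands are separated by two rounds of the quasi-triangle inequality,
      each costing \<open>2 powr s\<close>.\<close>
    define c where "c = 2 powr s * 2 powr s"
    have c: "0 < c" "enn_powr 2 s * enn_powr 2 s = ennreal c"
      using enn_powr_ennreal[of 2 s] by (simp_all add: c_def ennreal_mult)
    have "N s (\<lambda>_. f) (\<lambda>_. g) \<le> ennreal (c * (C11 + C12 + (C21 + C22)))"
      if f: "f \<in> borel_measurable borel" "recip_norm a f \<le> 1" and g: "g \<in> borel_measurable borel" "recip_norm b g \<le> 1" for f g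
    proof -
      obtain f1 f2 where f12: "scale_controlled Q a a1 F f1" "scale_controlled Q a a2 F f2" "\<And>k x. f x = f1 k x + f2 k x"
        using splita[OF f] by blast
      obtain g1 g2 where g12: "scale_controlled Q b b1 G g1" "scale_controlled Q b b2 G g2" "\<And>k x. g x = g1 k x + g2 k x"
        using splitb[OF g] by blast
      have [measurable]: "f1 k \<in> borel_measurable borel" "f2 k \<in> borel_measurable borel"
        "g1 k \<in> borel_measurable borel" "g2 k \<in> borel_measurable borel" for k
        using f12 g12 by (auto simp: scale_controlled_def)
      define P where "P \<phi> \<psi> k x = enn_powr (heis_piece lam (\<phi> k) (\<psi> k) k x) s"
        for \<phi> \<psi> :: "int \<Rightarrow> 'n heis \<Rightarrow> ennreal" and k x
      have [measurable]: "P \<phi> \<psi> k \<in> borel_measurable borel"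
        if "\<phi> k \<in> borel_measurable borel" "\<psi> k \<in> borel_measurable borel" for \<phi> \<psi> k
        using that unfolding P_def[abs_def] by measurable
      have pw: "enn_powr (heis_piece lam f g k x) s
        \<le> ennreal c * (P f1 g1 k x + P f1 g2 k x + (P f2 g1 k x + P f2 g2 k x))" for k x
      proof -
        have four: "enn_powr (p + q + (u + v)) s \<le> ennreal c * (enn_powr p s + enn_powr q s + (enn_powr u s + enn_powr v s))" for p q u v
        proof -
          have "enn_powr (p + q + (u + v)) s \<le> enn_powr 2 s * (enn_powr (p + q) s + enn_powr (u + v) s)"
            using \<open>0 < s\<close> by (intro enn_powr_add_le) simp
          also have "\<dots> \<le> enn_powr 2 s * (enn_powr 2 s * (enn_powr p s + enn_powr q s) + enn_powr 2 s * (enn_powr u s + enn_powr v s))"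
            using \<open>0 < s\<close> by (intro mult_left_mono add_mono enn_powr_add_le) simp_all
          also have "\<dots> = ennreal c * (enn_powr p s + enn_powr q s + (enn_powr u s + enn_powr v s))"
            by (simp add: distrib_left mult.assoc flip: c(2))
          finally show ?thesis .
        qed
        have "f = (\<lambda>x. f1 k x + f2 k x)" "g = (\<lambda>x. g1 k x + g2 k x)"
          using f12(3) g12(3) by auto
        then have "heis_piece lam f g k x = heis_piece lam (f1 k) (g1 k) k x + heis_piece lam (f1 k) (g2 k) k x
           + (heis_piece lam (f2 k) (g1 k) k x + heis_piece lam (f2 k) (g2 k) k x)"
          by (simp add: heis_piece_add_left heis_piece_add_right)
        then show ?thesis unfolding P_def by (simp only: four)
      qed
      define w where "w k = ennreal (2 powr (- \<kappa> * real_of_int k * (r - s)))" for k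
      have Neq: "N s \<phi> \<psi> = (\<integral>\<^sup>+k. w k * (\<integral>\<^sup>+x. P \<phi> \<psi> k x \<partial>lborel) \<partial>count_space UNIV)" for \<phi> \<psi>
        by (simp add: N_def P_def w_def)
      have "N s (\<lambda>_. f) (\<lambda>_. g)
        \<le> (\<integral>\<^sup>+k. w k * (\<integral>\<^sup>+x. ennreal c * (P f1 g1 k x + P f1 g2 k x + (P f2 g1 k x + P f2 g2 k x)) \<partial>lborel) \<partial>count_space UNIV)"
        unfolding N_def w_def[symmetric] by (intro nn_integral_mono mult_left_mono pw) simp_all
      also have "\<dots> = (\<integral>\<^sup>+k. ennreal c * (w k * (\<integral>\<^sup>+x. P f1 g1 k x \<partial>lborel) + w k * (\<integral>\<^sup>+x. P f1 g2 k x \<partial>lborel)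
           + (w k * (\<integral>\<^sup>+x. P f2 g1 k x \<partial>lborel) + w k * (\<integral>\<^sup>+x. P f2 g2 k x \<partial>lborel))) \<partial>count_space UNIV)"
        by (intro nn_integral_cong) (simp add: nn_integral_cmult nn_integral_add distrib_left mult_ac)
      also have "\<dots> = ennreal c * (N s f1 g1 + N s f1 g2 + (N s f2 g1 + N s f2 g2))"
        unfolding Neq by (simp add: nn_integral_cmult nn_integral_add)
      also have "\<dots> \<le> ennreal c * (ennreal C11 + ennreal C12 + (ennreal C21 + ennreal C22))"
        using f12 g12 by (intro mult_left_mono add_mono C11 C12 C21 C22) auto
      also have "\<dots> = ennreal (c * (C11 + C12 + (C21 + C22)))"
        using c C11 C12 C21 C22 by (simp add: ennreal_mult)
      finally show ?thesis .
    qed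
    then show ?thesis
      using c C11 C12 C21 C22 by (intro exI[of _ "c * (C11 + C12 + (C21 + C22))"]) auto
  qed
  obtain C0 where C0: "0 < C0" "\<And>f g. f \<in> borel_measurable borel \<Longrightarrow> g \<in> borel_measurable borel \<Longrightarrow>
       recip_norm a f \<le> 1 \<Longrightarrow> recip_norm b g \<le> 1 \<Longrightarrow> N s0 (\<lambda>_. f) (\<lambda>_. g) \<le> ennreal C0"
    using key[of s0] by blast
  obtain C1 where C1: "0 < C1" "\<And>f g. f \<in> borel_measurable borel \<Longrightarrow> g \<in> borel_measurable borel \<Longrightarrow>
       recip_norm a f \<le> 1 \<Longrightarrow> recip_norm b g \<le> 1 \<Longrightarrow> N s1 (\<lambda>_. f) (\<lambda>_. g) \<le> ennreal C1"
    using key[of s1] by blast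
  obtain C where C: "0 < C" and bound:
    "\<And>x :: int \<Rightarrow> ennreal. enn_powr (\<integral>\<^sup>+k. x k \<partial>count_space UNIV) r \<le> ennreal C * (\<integral>\<^sup>+k.
        (ennreal (2 powr (- \<kappa> * k * (r - s0))) * enn_powr (x k) s0
         + ennreal (2 powr (- \<kappa> * k * (r - s1))) * enn_powr (x k) s1) \<partial>count_space UNIV)"
    by (rule dyadic_sum_powr_le[OF s(1-3) \<kappa>]) (rule that)
  show thesis
  proof (rule that[of "C * (C0 + C1)"])
    show "0 < C * (C0 + C1)" using C C0 C1 by simp
    fix f g :: "'n heis \<Rightarrow> ennreal"
    assume [measurable]: "f \<in> borel_measurable borel" "g \<in> borel_measurable borel"
      and fg: "recip_norm a f \<le> 1" "recip_norm b g \<le> 1"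
    define Z where "Z k x = ennreal (2 powr (- \<kappa> * real_of_int k * (r - s0))) * enn_powr (heis_piece lam f g k x) s0
         + ennreal (2 powr (- \<kappa> * real_of_int k * (r - s1))) * enn_powr (heis_piece lam f g k x) s1" for k x
    have [measurable]: "Z k \<in> borel_measurable borel" for k unfolding Z_def[abs_def] by measurable
    have "(\<integral>\<^sup>+x. enn_powr (\<integral>\<^sup>+k. heis_piece lam f g k x \<partial>count_space UNIV) r \<partial>lborel)
      \<le> (\<integral>\<^sup>+x. ennreal C * (\<integral>\<^sup>+k. Z k x \<partial>count_space UNIV) \<partial>lborel)"
      unfolding Z_def by (intro nn_integral_mono bound)
    also have "\<dots> = ennreal C * (\<integral>\<^sup>+x. \<integral>\<^sup>+k. Z k x \<partial>count_space UNIV \<partial>lborel)"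
      by (rule nn_integral_cmult) measurable
    also have "(\<integral>\<^sup>+x. \<integral>\<^sup>+k. Z k x \<partial>count_space UNIV \<partial>lborel) = (\<integral>\<^sup>+k. \<integral>\<^sup>+x. Z k x \<partial>lborel \<partial>count_space UNIV)"
      by (rule nn_integral_count_space_nn_integral) auto
    also have "\<dots> = N s0 (\<lambda>_. f) (\<lambda>_. g) + N s1 (\<lambda>_. f) (\<lambda>_. g)"
      unfolding Z_def N_def by (simp add: nn_integral_add nn_integral_cmult)
    also have "\<dots> \<le> ennreal C0 + ennreal C1"
      using fg by (intro add_mono C0 C1) auto
    finally show "(\<integral>\<^sup>+x. enn_powr (\<integral>\<^sup>+k. heis_piece lam f g k x \<partial>count_space UNIV) r \<partial>lborel) \<le> ennreal (C * (C0 + C1))"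
      using C C0 C1 by (simp add: ennreal_mult mult_left_mono)
  qed
qed

section \<open>The fractional integral\<close>


definition heis_riesz :: "real \<Rightarrow> ('n::finite heis \<Rightarrow> ennreal) \<Rightarrow> ('n heis \<Rightarrow> ennreal) \<Rightarrow> 'n heis \<Rightarrow> ennreal" where
  "heis_riesz lam f g x = (\<integral>\<^sup>+y. f (heis_mult x (heis_inv y)) * g (heis_mult x y)
     * ennreal (1 / koranyi y powr (hom_dim TYPE('n) - lam)) \<partial>lborel)"

lemma measurable_koranyi [measurable]: "koranyi \<in> borel_measurable (borel :: 'n::finite heis measure)"
  unfolding koranyi_def split_beta borel_prod[symmetric] by measurable

lemma measurable_heis_riesz [measurable (raw)]:
  fixes f g :: "'n::finite heis \<Rightarrow> ennreal"
  assumes [measurable]: "f \<in> borel_measurable borel" "g \<in> borel_measurable borel"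
  shows "heis_riesz lam f g \<in> borel_measurable borel"
  unfolding heis_riesz_def[abs_def] by measurable

text \<open>A single term suffices: for \<open>2 powr (k - 1) \<le> koranyi y < 2 powr k\<close> the
  kernel is within the factor \<open>2 powr e\<close> of its value at the scale \<open>k\<close>.
  The \<open>+ 1\<close> in \<open>k\<close> gives the strict inequality that places
  \<open>y\<close> in the box. At norm zero the left-hand side is 0 by the convention for division
  by zero.\<close>

lemma koranyi_kernel_le_dyadic:
  fixes y :: "'n::finite heis"
  assumes "0 < e"
  shows "ennreal (1 / koranyi y powr e)
    \<le> ennreal (2 powr e) * (\<integral>\<^sup>+k. ennreal (2 powr (k * - e)) * indicator (heis_box (2 powr k)) y \<partial>count_space (UNIV :: int set))"
proof (cases "koranyi y = 0")
  case False
  have ky: "0 < koranyi y"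
    using False by (simp add: koranyi_def split: prod.splits)
  define k where "k = \<lfloor>log 2 (koranyi y)\<rfloor> + 1"
  have k: "log 2 (koranyi y) < k" "k - 1 \<le> log 2 (koranyi y)"
    by (auto simp: k_def)
  have "koranyi y = 2 powr (log 2 (koranyi y))" using ky by simp
  also have "\<dots> < 2 powr k" using k by simp
  finally have box: "y \<in> heis_box (2 powr k)" by (rule koranyi_less_imp_heis_box)
  have "2 powr (k - 1) \<le> koranyi y"
    using k ky by (simp add: le_log_iff)
  then have "(2 powr (k - 1)) powr e \<le> koranyi y powr e"
    using assms by (intro powr_mono2) auto
  then have "1 / koranyi y powr e \<le> 1 / (2 powr (k - 1)) powr e"
    using ky by (intro divide_left_mono) auto
  also have "1 / (2 powr (k - 1)) powr e = 2 powr e * 2 powr (k * - e)"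
    by (simp add: powr_powr powr_minus_divide[symmetric] algebra_simps flip: powr_add)
  finally have "ennreal (1 / koranyi y powr e) \<le> ennreal (2 powr e) * (ennreal (2 powr (k * - e)) * indicator (heis_box (2 powr k)) y)"
    using box by (simp flip: ennreal_mult)
  also have "\<dots> \<le> ennreal (2 powr e) * (\<integral>\<^sup>+k. ennreal (2 powr (k * - e)) * indicator (heis_box (2 powr k)) y \<partial>count_space (UNIV :: int set))"
    by (intro mult_left_mono nn_integral_ge_point[of k]) auto
  finally show ?thesis .
qed (simp add: ennreal_0)

lemma heis_riesz_le_pieces:
  fixes f g :: "'n::finite heis \<Rightarrow> ennreal"
  assumes [measurable]: "f \<in> borel_measurable borel" "g \<in> borel_measurable borel"
    and lam: "lam < hom_dim TYPE('n)"
  shows "heis_riesz lam f g x \<le> ennreal (2 powr (hom_dim TYPE('n) - lam)) * (\<integral>\<^sup>+k. heis_piece lam f g k x \<partial>count_space UNIV)"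
proof -
  define e where "e = hom_dim TYPE('n) - lam"
  have e: "0 < e" using lam by (simp add: e_def)
  let ?F = "\<lambda>y. f (heis_mult x (heis_inv y)) * g (heis_mult x y)"
  have "heis_riesz lam f g x \<le> (\<integral>\<^sup>+y. ?F y * (ennreal (2 powr e) * (\<integral>\<^sup>+k. ennreal (2 powr (k * - e)) * indicator (heis_box (2 powr k)) y \<partial>count_space (UNIV :: int set))) \<partial>lborel)"
    unfolding heis_riesz_def e_def[symmetric]
    by (intro nn_integral_mono mult_left_mono koranyi_kernel_le_dyadic e) simp
  also have "\<dots> = (\<integral>\<^sup>+y. ennreal (2 powr e) * (\<integral>\<^sup>+k. ennreal (2 powr (k * - e)) * (indicator (heis_box (2 powr k)) y * ?F y) \<partial>count_space (UNIV :: int set)) \<partial>lborel)"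
    by (intro nn_integral_cong) (simp add: ac_simps flip: nn_integral_cmult)
  also have "\<dots> = ennreal (2 powr e) * (\<integral>\<^sup>+y. \<integral>\<^sup>+k. ennreal (2 powr (k * - e)) * (indicator (heis_box (2 powr k)) y * ?F y) \<partial>count_space (UNIV :: int set) \<partial>lborel)"
    by (rule nn_integral_cmult) measurable
  also have "(\<integral>\<^sup>+y. \<integral>\<^sup>+k. ennreal (2 powr (k * - e)) * (indicator (heis_box (2 powr k)) y * ?F y) \<partial>count_space (UNIV :: int set) \<partial>lborel)
    = (\<integral>\<^sup>+k. \<integral>\<^sup>+y. ennreal (2 powr (k * - e)) * (indicator (heis_box (2 powr k)) y * ?F y) \<partial>lborel \<partial>count_space (UNIV :: int set))"
    by (rule nn_integral_count_space_nn_integral) auto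
  also have "\<dots> = (\<integral>\<^sup>+k. heis_piece lam f g k x \<partial>count_space UNIV)"
    by (intro nn_integral_cong) (simp add: heis_piece_def heis_bilinear_def e_def nn_integral_cmult)
  finally show ?thesis by (simp add: e_def)
qed

section \<open>Reduction by homogeneity to functions of norm at most one\<close>

lemma recip_norm_cmult:
  fixes f :: "'a::euclidean_space \<Rightarrow> ennreal"
  assumes [measurable]: "f \<in> borel_measurable borel" and "0 \<le> a"
  shows "recip_norm a (\<lambda>x. c * f x) = c * recip_norm a f"
  using assms(2) by (auto simp: recip_norm_def enn_powr_mult enn_powr_powr nn_integral_cmult SUP_mult_left_ennreal)

lemma heis_riesz_cmult:
  fixes f g :: "'n::finite heis \<Rightarrow> ennreal"
  assumes [measurable]: "f \<in> borel_measurable borel" "g \<in> borel_measurable borel"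
  shows "heis_riesz lam (\<lambda>x. c * f x) (\<lambda>x. d * g x) x = c * d * heis_riesz lam f g x"
proof -
  have "heis_riesz lam (\<lambda>x. c * f x) (\<lambda>x. d * g x) x = (\<integral>\<^sup>+y. (c * d) * (f (heis_mult x (heis_inv y)) * g (heis_mult x y)
     * ennreal (1 / koranyi y powr (hom_dim TYPE('n) - lam))) \<partial>lborel)"
    unfolding heis_riesz_def by (intro nn_integral_cong) (simp add: ac_simps)
  also have "\<dots> = c * d * heis_riesz lam f g x"
    unfolding heis_riesz_def by (rule nn_integral_cmult) measurable
  finally show ?thesis .
qed

lemma recip_norm_eq_0_imp_AE:
  fixes f :: "'a::euclidean_space \<Rightarrow> ennreal"
  assumes [measurable]: "f \<in> borel_measurable borel" and "recip_norm a f = 0"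
  shows "AE x in lborel. f x = 0"
proof (cases "a = 0")
  case True
  then have "f x \<le> 0" for x using assms(2) SUP_upper[of x UNIV f] by (simp add: recip_norm_def)
  then show ?thesis by simp
next
  case False
  then show ?thesis using assms(2) by (simp add: recip_norm_def nn_integral_0_iff_AE)
qed

lemma AE_heis_translate:
  fixes P :: "'n::finite heis \<Rightarrow> bool"
  assumes "AE w in lborel. P w"
  shows "AE y in lborel. P (heis_mult x y)" "AE y in lborel. P (heis_mult x (heis_inv y))"
proof -
  obtain N where N: "{w \<in> space lborel. \<not> P w} \<subseteq> N" "emeasure lborel N = 0" "N \<in> sets lborel"
    using assms by (rule AE_E)
  then have [measurable]: "N \<in> sets borel" by simp
  have PN: "P w" if "(indicator N w :: ennreal) = 0" for w
    using N(1) that by (auto simp: indicator_def split: if_splits)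
  have "(\<integral>\<^sup>+y. indicator N (heis_mult x y) \<partial>lborel) = (0 :: ennreal)"
    "(\<integral>\<^sup>+y. indicator N (heis_mult x (heis_inv y)) \<partial>lborel) = (0 :: ennreal)"
    using N by (simp_all add: nn_integral_heis_left_translate nn_integral_heis_left_translate_inv)
  then have AE1: "AE y in lborel. (indicator N (heis_mult x y) :: ennreal) = 0"
    and AE2: "AE y in lborel. (indicator N (heis_mult x (heis_inv y)) :: ennreal) = 0"
    by (subst (asm) (1 2) nn_integral_0_iff_AE; auto)+
  show "AE y in lborel. P (heis_mult x y)"
    using AE1 by eventually_elim (rule PN)
  show "AE y in lborel. P (heis_mult x (heis_inv y))"
    using AE2 by eventually_elim (rule PN)
qed

text \<open>Covers the case in which a function cannot be divided by its norm; translations and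
  inversion preserve null sets.\<close>

lemma heis_riesz_eq_0:
  fixes f g :: "'n::finite heis \<Rightarrow> ennreal"
  assumes [measurable]: "f \<in> borel_measurable borel" "g \<in> borel_measurable borel"
    and "recip_norm a f = 0 \<or> recip_norm b g = 0"
  shows "heis_riesz lam f g x = 0"
proof -
  have "(AE w in lborel. f w = 0) \<or> (AE w in lborel. g w = 0)"
    using assms by (auto dest: recip_norm_eq_0_imp_AE[rotated])
  then have "AE y in lborel. f (heis_mult x (heis_inv y)) = 0 \<or> g (heis_mult x y) = 0"
  proof
    assume "AE w in lborel. f w = 0"
    from AE_heis_translate(2)[OF this, of x] show ?thesis by eventually_elim simp
  next
    assume "AE w in lborel. g w = 0"
    from AE_heis_translate(1)[OF this, of x] show ?thesis by eventually_elim simp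
  qed
  then have "AE y in lborel. f (heis_mult x (heis_inv y)) * g (heis_mult x y)
     * ennreal (1 / koranyi y powr (hom_dim TYPE('n) - lam)) = 0"
    by eventually_elim auto
  then show ?thesis
    unfolding heis_riesz_def by (subst nn_integral_0_iff_AE) auto
qed

lemma recip_norm_normalize:
  fixes f :: "'a::euclidean_space \<Rightarrow> ennreal"
  assumes f [measurable]: "f \<in> borel_measurable borel" and "0 \<le> a" "recip_norm a f \<noteq> 0" "recip_norm a f < top"
  obtains f0 where "f0 \<in> borel_measurable borel" "recip_norm a f0 \<le> 1" "f = (\<lambda>x. recip_norm a f * f0 x)"
proof -
  obtain c where c: "recip_norm a f = ennreal c" "0 < c"
    using assms by (metis ennreal_cases ennreal_eq_0_iff not_le less_top)
  show thesis
  proof (rule that[of "\<lambda>x. ennreal (1 / c) * f x"])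
    show "recip_norm a (\<lambda>x. ennreal (1 / c) * f x) \<le> 1"
      using c \<open>0 \<le> a\<close> by (simp add: recip_norm_cmult flip: ennreal_mult)
    show "f = (\<lambda>x. recip_norm a f * (ennreal (1 / c) * f x))"
      using c by (simp add: mult.assoc[symmetric] flip: ennreal_mult)
  qed measurable
qed

theorem heis_riesz_strong:
  fixes lam a b r :: real
  assumes lam: "0 < lam" "lam < hom_dim TYPE('n::finite)"
    and ab: "0 \<le> a" "a < 1" "0 \<le> b" "b < 1"
    and "0 < r" and r: "1 / r = a + b - lam / hom_dim TYPE('n)"
  obtains K where "0 < K"
    "\<And>(f :: 'n heis \<Rightarrow> ennreal) g. f \<in> borel_measurable borel \<Longrightarrow> g \<in> borel_measurable borel \<Longrightarrow>
       recip_norm a f < top \<Longrightarrow> recip_norm b g < top \<Longrightarrow>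
       enn_powr (\<integral>\<^sup>+x. enn_powr (heis_riesz lam f g x) r \<partial>lborel) (1 / r) \<le> ennreal K * (recip_norm a f * recip_norm b g)"
proof -
  define c where "c = 2 powr (hom_dim TYPE('n) - lam)"
  obtain C where C: "0 < C" and bound:
    "\<And>(f :: 'n heis \<Rightarrow> ennreal) g. f \<in> borel_measurable borel \<Longrightarrow> g \<in> borel_measurable borel \<Longrightarrow>
       recip_norm a f \<le> 1 \<Longrightarrow> recip_norm b g \<le> 1 \<Longrightarrow>
       (\<integral>\<^sup>+x. enn_powr (\<integral>\<^sup>+k. heis_piece lam f g k x \<partial>count_space UNIV) r \<partial>lborel) \<le> ennreal C"
    by (rule heis_pieces_strong[OF assms]) (rule that)
  show thesis
  proof (rule that[of "c * C powr (1 / r)"])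
    show "0 < c * C powr (1 / r)" using C by (simp add: c_def)
    fix f g :: "'n heis \<Rightarrow> ennreal"
    assume [measurable]: "f \<in> borel_measurable borel" "g \<in> borel_measurable borel"
      and fin: "recip_norm a f < top" "recip_norm b g < top"
    show "enn_powr (\<integral>\<^sup>+x. enn_powr (heis_riesz lam f g x) r \<partial>lborel) (1 / r) \<le> ennreal (c * C powr (1 / r)) * (recip_norm a f * recip_norm b g)"
    proof (cases "recip_norm a f = 0 \<or> recip_norm b g = 0")
      case True
      then show ?thesis by (simp add: heis_riesz_eq_0)
    next
      case False
      define D where "D = recip_norm a f * recip_norm b g"
      obtain f0 where f0 [measurable]: "f0 \<in> borel_measurable borel" and f0': "recip_norm a f0 \<le> 1" "f = (\<lambda>x. recip_norm a f * f0 x)"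
        using recip_norm_normalize[of f a] False fin ab by auto
      obtain g0 where g0 [measurable]: "g0 \<in> borel_measurable borel" and g0': "recip_norm b g0 \<le> 1" "g = (\<lambda>x. recip_norm b g * g0 x)"
        using recip_norm_normalize[of g b] False fin ab by auto
      have "heis_riesz lam f g x = D * heis_riesz lam f0 g0 x" for x
        unfolding D_def by (subst f0'(2), subst g0'(2)) (simp add: heis_riesz_cmult)
      also have "D * heis_riesz lam f0 g0 x \<le> D * (ennreal c * (\<integral>\<^sup>+k. heis_piece lam f0 g0 k x \<partial>count_space UNIV))" for x
        unfolding c_def using lam by (intro mult_left_mono heis_riesz_le_pieces) auto
      finally have pw: "heis_riesz lam f g x \<le> (D * ennreal c) * (\<integral>\<^sup>+k. heis_piece lam f0 g0 k x \<partial>count_space UNIV)" for x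
        by (simp add: mult.assoc)
      have "(\<integral>\<^sup>+x. enn_powr (heis_riesz lam f g x) r \<partial>lborel)
        \<le> (\<integral>\<^sup>+x. enn_powr (D * ennreal c) r * enn_powr (\<integral>\<^sup>+k. heis_piece lam f0 g0 k x \<partial>count_space UNIV) r \<partial>lborel)"
        unfolding enn_powr_mult[of "D * ennreal c", symmetric]
        using \<open>0 < r\<close> by (intro nn_integral_mono enn_powr_mono pw) auto
      also have "\<dots> = enn_powr (D * ennreal c) r * (\<integral>\<^sup>+x. enn_powr (\<integral>\<^sup>+k. heis_piece lam f0 g0 k x \<partial>count_space UNIV) r \<partial>lborel)"
        by (rule nn_integral_cmult) measurable
      also have "\<dots> \<le> enn_powr (D * ennreal c) r * ennreal C"
        using f0' g0' by (intro mult_left_mono bound) auto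
      finally have "enn_powr (\<integral>\<^sup>+x. enn_powr (heis_riesz lam f g x) r \<partial>lborel) (1 / r)
        \<le> enn_powr (enn_powr (D * ennreal c) r * ennreal C) (1 / r)"
        using \<open>0 < r\<close> by (intro enn_powr_mono) auto
      also have "\<dots> = D * ennreal c * ennreal (C powr (1 / r))"
        unfolding enn_powr_mult[of _ "ennreal C"] enn_powr_powr using \<open>0 < r\<close> C by (simp add: enn_powr_ennreal)
      also have "\<dots> = ennreal (c * C powr (1 / r)) * D"
        by (simp add: ennreal_mult c_def ac_simps)
      finally show ?thesis by (simp add: D_def)
    qed
  qed
qed

theorem heis_riesz_weak:
  fixes lam a b r :: real
  assumes lam: "0 < lam" "lam < hom_dim TYPE('n::finite)"
    and ab: "0 \<le> a" "a \<le> 1" "0 \<le> b" "b \<le> 1"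
    and "0 < r" and r: "1 / r = a + b - lam / hom_dim TYPE('n)"
  obtains K where "0 < K"
    "\<And>(f :: 'n heis \<Rightarrow> ennreal) g t. f \<in> borel_measurable borel \<Longrightarrow> g \<in> borel_measurable borel \<Longrightarrow>
       recip_norm a f < top \<Longrightarrow> recip_norm b g < top \<Longrightarrow> 0 < t \<Longrightarrow>
       ennreal t * enn_powr (emeasure lborel {x. ennreal t < heis_riesz lam f g x}) (1 / r)
         \<le> ennreal K * (recip_norm a f * recip_norm b g)"
proof -
  define c where "c = 2 powr (hom_dim TYPE('n) - lam)"
  have "0 < c" by (simp add: c_def)
  obtain C where C: "0 < C" and bound:
    "\<And>(f :: 'n heis \<Rightarrow> ennreal) g t. f \<in> borel_measurable borel \<Longrightarrow> g \<in> borel_measurable borel \<Longrightarrow>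
       recip_norm a f \<le> 1 \<Longrightarrow> recip_norm b g \<le> 1 \<Longrightarrow> 0 < t \<Longrightarrow>
       ennreal (t powr r) * emeasure lborel {x. ennreal t < (\<integral>\<^sup>+k. heis_piece lam f g k x \<partial>count_space UNIV)} \<le> ennreal C"
    by (rule heis_pieces_weak[OF assms]) (rule that)
  show thesis
  proof (rule that[of "c * C powr (1 / r)"])
    show "0 < c * C powr (1 / r)" using C by (simp add: c_def)
    fix f g :: "'n heis \<Rightarrow> ennreal" and t :: real
    assume [measurable]: "f \<in> borel_measurable borel" "g \<in> borel_measurable borel"
      and fin: "recip_norm a f < top" "recip_norm b g < top" and t: "0 < t"
    show "ennreal t * enn_powr (emeasure lborel {x. ennreal t < heis_riesz lam f g x}) (1 / r)
         \<le> ennreal (c * C powr (1 / r)) * (recip_norm a f * recip_norm b g)"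
    proof (cases "recip_norm a f = 0 \<or> recip_norm b g = 0")
      case True
      then show ?thesis by (simp add: heis_riesz_eq_0)
    next
      case False
      define D where "D = recip_norm a f * recip_norm b g"
      have "D \<noteq> 0" "D < top" using False fin by (auto simp: D_def ennreal_mult_less_top)
      then obtain d where d: "D = ennreal d" "0 < d"
        by (metis ennreal_cases ennreal_eq_0_iff not_le less_top)
      obtain f0 where f0 [measurable]: "f0 \<in> borel_measurable borel" and f0': "recip_norm a f0 \<le> 1" "f = (\<lambda>x. recip_norm a f * f0 x)"
        using recip_norm_normalize[of f a] False fin ab by auto
      obtain g0 where g0 [measurable]: "g0 \<in> borel_measurable borel" and g0': "recip_norm b g0 \<le> 1" "g = (\<lambda>x. recip_norm b g * g0 x)"
        using recip_norm_normalize[of g b] False fin ab by auto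
      define S where "S x = (\<integral>\<^sup>+k. heis_piece lam f0 g0 k x \<partial>count_space UNIV)" for x
      have [measurable]: "S \<in> borel_measurable borel" unfolding S_def[abs_def] by measurable
      have "heis_riesz lam f g x = D * heis_riesz lam f0 g0 x" for x
        unfolding D_def by (subst f0'(2), subst g0'(2)) (simp add: heis_riesz_cmult)
      also have "D * heis_riesz lam f0 g0 x \<le> D * (ennreal c * S x)" for x
        unfolding c_def S_def using lam by (intro mult_left_mono heis_riesz_le_pieces) auto
      finally have pw: "heis_riesz lam f g x \<le> ennreal (d * c) * S x" for x
        using d \<open>0 < c\<close> by (simp add: ennreal_mult mult.assoc)
      \<comment> \<open>The height \<open>t\<close> rescaled to the normalized functions.\<close>
      define \<tau> where "\<tau> = t / (d * c)"
      have \<tau>: "0 < \<tau>" "t = \<tau> * (d * c)" using t d \<open>0 < c\<close> by (auto simp: \<tau>_def)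
      have sub: "{x. ennreal t < heis_riesz lam f g x} \<subseteq> {x. ennreal \<tau> < S x}"
      proof safe
        fix x assume "ennreal t < heis_riesz lam f g x"
        also note pw[of x]
        finally have "ennreal (d * c) * ennreal \<tau> < ennreal (d * c) * S x"
          using \<tau> d \<open>0 < c\<close> by (simp add: mult.commute flip: ennreal_mult)
        then show "ennreal \<tau> < S x"
          using mult_left_mono[of "S x" "ennreal \<tau>" "ennreal (d * c)"] by (meson leD leI zero_le)
      qed
      have "ennreal t * enn_powr (emeasure lborel {x. ennreal t < heis_riesz lam f g x}) (1 / r)
        \<le> ennreal t * enn_powr (emeasure lborel {x. ennreal \<tau> < S x}) (1 / r)"
        using \<open>0 < r\<close> by (intro mult_left_mono enn_powr_mono emeasure_mono sub) auto
      also have "\<dots> = ennreal (d * c) * enn_powr (ennreal (\<tau> powr r) * emeasure lborel {x. ennreal \<tau> < S x}) (1 / r)"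
        using \<tau> d \<open>0 < c\<close> \<open>0 < r\<close> by (simp add: enn_powr_mult enn_powr_ennreal powr_powr ennreal_mult ac_simps)
      also have "\<dots> \<le> ennreal (d * c) * enn_powr (ennreal C) (1 / r)"
        unfolding S_def using \<tau> f0' g0' \<open>0 < r\<close> by (intro mult_left_mono enn_powr_mono bound) auto
      also have "\<dots> = ennreal (c * C powr (1 / r)) * D"
        using C d \<open>0 < c\<close> by (simp add: enn_powr_ennreal ennreal_mult ac_simps)
      finally show ?thesis by (simp add: D_def)
    qed
  qed
qed

text \<open>Passes from Lebesgue measurable complex functions to Borel functions into
  \<open>ennreal\<close>. For \<open>p = \<infinity>\<close> the norm \<open>recip_norm 0\<close> is
  a true supremum, so the Borel version is cut off at the essential supremum of
  \<open>f\<close>.\<close>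

lemma Lp_borel_majorant:
  fixes f :: "'a::euclidean_space \<Rightarrow> complex"
  assumes f: "in_Lp lebesgue p f" and p: "1 \<le> p"
  obtains f' where "f' \<in> borel_measurable borel" "AE x in lborel. ennreal (cmod (f x)) = f' x"
    "recip_norm (exp_inv p) f' \<le> Lp_norm lebesgue p f"
proof -
  have "(\<lambda>x. ennreal (cmod (f x))) \<in> borel_measurable (completion lborel)"
    using f unfolding in_Lp_def by auto
  from completion_ex_borel_measurable[OF this] obtain h where
    h [measurable]: "h \<in> borel_measurable borel" and AE: "AE x in lborel. ennreal (cmod (f x)) = h x"
    by (auto simp: measurable_lborel1)
  show thesis
  proof (cases "p = \<infinity>")
    case True
    define A where "A = {C::ennreal. AE x in lebesgue. ennreal (cmod (f x)) \<le> C}"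
    define c where "c = Inf A"
    have c: "c = Lp_norm lebesgue p f" by (simp add: c_def A_def Lp_norm_def True)
    have "top \<in> A" by (simp add: A_def)
    \<comment> \<open>The infimum is reached along a sequence, so that only countably many null sets
      are united and the essential supremum is itself an essential bound.\<close>
    then obtain B where B: "range B \<subseteq> A" "decseq B" "c = (INF i. B i)"
      using ennreal_Inf_countable_INF[of A] unfolding c_def by auto
    have "AE x in lborel. \<forall>i::nat. ennreal (cmod (f x)) \<le> B i"
      using B(1) by (subst AE_all_countable) (auto simp: A_def AE_completion_iff)
    with AE have "AE x in lborel. ennreal (cmod (f x)) = min (h x) c"
    proof eventually_elim
      case (elim x)
      then have "h x \<le> c" unfolding B(3) by (auto intro: INF_greatest)
      with elim show ?case by (simp add: min_absorb1)
    qed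
    then show ?thesis
      using True c by (intro that[of "\<lambda>x. min (h x) c"]) (auto simp: recip_norm_def exp_inv_def intro!: SUP_least)
  next
    case False
    then obtain P where P: "p = ennreal P" "1 \<le> P"
      using p by (cases p) (auto simp: ennreal_le_iff2 simp flip: ennreal_1)
    have "(\<integral>\<^sup>+x. ennreal (cmod (f x) powr P) \<partial>lebesgue) = (\<integral>\<^sup>+x. ennreal (cmod (f x) powr P) \<partial>lborel)"
      by (rule nn_integral_completion)
    also have "\<dots> = (\<integral>\<^sup>+x. enn_powr (h x) P \<partial>lborel)"
      using AE by (intro nn_integral_cong_AE) (auto elim!: eventually_mono simp: enn_powr_ennreal[symmetric])
    finally have "recip_norm (exp_inv p) h = Lp_norm lebesgue p f"
      using P by (simp add: recip_norm_def exp_inv_def Lp_norm_def)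
    then show ?thesis using AE h by (intro that[of h]) auto
  qed
qed

lemma cmod_B_lambda_le:
  fixes f g :: "'n::finite heis \<Rightarrow> complex"
  assumes f: "AE x in lborel. ennreal (cmod (f x)) = f' x" and g: "AE x in lborel. ennreal (cmod (g x)) = g' x"
  shows "ennreal (cmod (B_lambda lam f g x)) \<le> heis_riesz lam f' g' x"
proof -
  let ?h = "\<lambda>y. f (heis_mult x (heis_inv y)) * g (heis_mult x y)
       / complex_of_real (koranyi y powr (hom_dim TYPE('n) - lam))"
  have "ennreal (cmod (B_lambda lam f g x)) \<le> (\<integral>\<^sup>+y. ennreal (cmod (?h y)) \<partial>lebesgue)"
  proof (cases "integrable lebesgue ?h")
    case True
    then show ?thesis unfolding B_lambda_def by (rule integral_norm_bound_ennreal)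
  next
    case False
    \<comment> \<open>Without integrability the Bochner integral takes its default value 0.\<close>
    then show ?thesis unfolding B_lambda_def by (simp add: not_integrable_integral_eq)
  qed
  also have "\<dots> = (\<integral>\<^sup>+y. ennreal (cmod (?h y)) \<partial>lborel)"
    by (rule nn_integral_completion)
  also have "\<dots> = heis_riesz lam f' g' x"
    unfolding heis_riesz_def
  proof (rule nn_integral_cong_AE)
    show "AE y in lborel. ennreal (cmod (?h y)) = f' (heis_mult x (heis_inv y)) * g' (heis_mult x y)
        * ennreal (1 / koranyi y powr (hom_dim TYPE('n) - lam))"
      using AE_heis_translate(2)[OF f, of x] AE_heis_translate(1)[OF g, of x]
    proof eventually_elim
      case (elim y)
      have "cmod (?h y) = cmod (f (heis_mult x (heis_inv y))) * cmod (g (heis_mult x y)) * (1 / koranyi y powr (hom_dim TYPE('n) - lam))"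
        by (simp add: norm_mult norm_divide)
      then show ?case by (simp add: ennreal_mult elim del: times_divide_eq_right)
    qed
  qed
  finally show ?thesis .
qed

theorem theorem1p1:
  fixes lam :: real and p q :: ennreal and r :: real
  assumes lam: "0 < lam" "lam < hom_dim TYPE('n::finite)"
    and p: "1 \<le> p" and q: "1 \<le> q"
    and rpos: "exp_inv p + exp_inv q - lam / hom_dim TYPE('n) > 0"
    and r_def: "r = 1 / (exp_inv p + exp_inv q - lam / hom_dim TYPE('n))"
  shows "(1 < p \<and> 1 < q \<longrightarrow>
            (\<exists>K::real. \<forall>f g :: 'n heis \<Rightarrow> complex.
               in_Lp lebesgue p f \<longrightarrow> in_Lp lebesgue q g \<longrightarrow>
               Lp_norm lebesgue (ennreal r) (B_lambda lam f g)
                 \<le> ennreal K * Lp_norm lebesgue p f * Lp_norm lebesgue q g))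
       \<and> (p = 1 \<or> q = 1 \<longrightarrow>
            (\<exists>K::real. \<forall>f g :: 'n heis \<Rightarrow> complex.
               in_Lp lebesgue p f \<longrightarrow> in_Lp lebesgue q g \<longrightarrow>
               weak_Lr_norm lebesgue r (B_lambda lam f g)
                 \<le> ennreal K * Lp_norm lebesgue p f * Lp_norm lebesgue q g))"
proof (intro conjI impI)
  have r: "0 < r" "1 / r = exp_inv p + exp_inv q - lam / hom_dim TYPE('n)"
    using rpos by (auto simp: r_def)
  have inv: "0 \<le> exp_inv u \<and> exp_inv u \<le> 1 \<and> (1 < u \<longrightarrow> exp_inv u < 1)" if "1 \<le> u" for u
  proof (cases u)
    case (real x)
    with that have "1 \<le> x" by (simp flip: ennreal_1)
    with real show ?thesis by (auto simp: exp_inv_def one_less_ennreal)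
  qed (auto simp: exp_inv_def)
  {
    assume "1 < p \<and> 1 < q"
    obtain K where K: "0 < K" and bound:
      "\<And>(f :: 'n heis \<Rightarrow> ennreal) g. f \<in> borel_measurable borel \<Longrightarrow> g \<in> borel_measurable borel \<Longrightarrow>
       recip_norm (exp_inv p) f < top \<Longrightarrow> recip_norm (exp_inv q) g < top \<Longrightarrow>
       enn_powr (\<integral>\<^sup>+x. enn_powr (heis_riesz lam f g x) r \<partial>lborel) (1 / r)
         \<le> ennreal K * (recip_norm (exp_inv p) f * recip_norm (exp_inv q) g)"
      by (rule heis_riesz_strong[OF lam, of "exp_inv p" "exp_inv q" r])
         (use inv[OF p] inv[OF q] \<open>1 < p \<and> 1 < q\<close> r in auto)
    show "\<exists>K::real. \<forall>f g :: 'n heis \<Rightarrow> complex. in_Lp lebesgue p f \<longrightarrow> in_Lp lebesgue q g \<longrightarrow>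
        Lp_norm lebesgue (ennreal r) (B_lambda lam f g) \<le> ennreal K * Lp_norm lebesgue p f * Lp_norm lebesgue q g"
    proof (intro exI[of _ K] allI impI)
      fix f g :: "'n heis \<Rightarrow> complex"
      assume f: "in_Lp lebesgue p f" and g: "in_Lp lebesgue q g"
      obtain f' where f': "f' \<in> borel_measurable borel" "AE x in lborel. ennreal (cmod (f x)) = f' x"
        "recip_norm (exp_inv p) f' \<le> Lp_norm lebesgue p f" using Lp_borel_majorant[OF f p] by blast
      obtain g' where g': "g' \<in> borel_measurable borel" "AE x in lborel. ennreal (cmod (g x)) = g' x"
        "recip_norm (exp_inv q) g' \<le> Lp_norm lebesgue q g" using Lp_borel_majorant[OF g q] by blast
      have fin: "recip_norm (exp_inv p) f' < top" "recip_norm (exp_inv q) g' < top"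
        using f g f'(3) g'(3) by (auto simp: in_Lp_def)
      have "Lp_norm lebesgue (ennreal r) (B_lambda lam f g)
        = enn_powr (\<integral>\<^sup>+x. ennreal (cmod (B_lambda lam f g x) powr r) \<partial>lborel) (1 / r)"
        using r(1) by (simp add: Lp_norm_def nn_integral_completion)
      also have "\<dots> \<le> enn_powr (\<integral>\<^sup>+x. enn_powr (heis_riesz lam f' g' x) r \<partial>lborel) (1 / r)"
        unfolding enn_powr_ennreal[OF norm_ge_zero, symmetric]
        using r(1) by (intro enn_powr_mono nn_integral_mono cmod_B_lambda_le f' g') auto
      also have "\<dots> \<le> ennreal K * (recip_norm (exp_inv p) f' * recip_norm (exp_inv q) g')"
        by (rule bound[OF f'(1) g'(1) fin])
      also have "\<dots> \<le> ennreal K * (Lp_norm lebesgue p f * Lp_norm lebesgue q g)"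
        by (intro mult_left_mono mult_mono f' g') auto
      finally show "Lp_norm lebesgue (ennreal r) (B_lambda lam f g) \<le> ennreal K * Lp_norm lebesgue p f * Lp_norm lebesgue q g"
        by (simp add: mult.assoc)
    qed
  }
  obtain K where K: "0 < K" and bound:
    "\<And>(f :: 'n heis \<Rightarrow> ennreal) g t. f \<in> borel_measurable borel \<Longrightarrow> g \<in> borel_measurable borel \<Longrightarrow>
       recip_norm (exp_inv p) f < top \<Longrightarrow> recip_norm (exp_inv q) g < top \<Longrightarrow> 0 < t \<Longrightarrow>
       ennreal t * enn_powr (emeasure lborel {x. ennreal t < heis_riesz lam f g x}) (1 / r)
         \<le> ennreal K * (recip_norm (exp_inv p) f * recip_norm (exp_inv q) g)"
    by (rule heis_riesz_weak[OF lam, of "exp_inv p" "exp_inv q" r]) (use inv[OF p] inv[OF q] r in auto)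
  show "\<exists>K::real. \<forall>f g :: 'n heis \<Rightarrow> complex. in_Lp lebesgue p f \<longrightarrow> in_Lp lebesgue q g \<longrightarrow>
      weak_Lr_norm lebesgue r (B_lambda lam f g) \<le> ennreal K * Lp_norm lebesgue p f * Lp_norm lebesgue q g"
  proof (intro exI[of _ K] allI impI)
    fix f g :: "'n heis \<Rightarrow> complex"
    assume f: "in_Lp lebesgue p f" and g: "in_Lp lebesgue q g"
    obtain f' where f': "f' \<in> borel_measurable borel" "AE x in lborel. ennreal (cmod (f x)) = f' x"
      "recip_norm (exp_inv p) f' \<le> Lp_norm lebesgue p f" using Lp_borel_majorant[OF f p] by blast
    obtain g' where g': "g' \<in> borel_measurable borel" "AE x in lborel. ennreal (cmod (g x)) = g' x"
      "recip_norm (exp_inv q) g' \<le> Lp_norm lebesgue q g" using Lp_borel_majorant[OF g q] by blast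
    have fin: "recip_norm (exp_inv p) f' < top" "recip_norm (exp_inv q) g' < top"
      using f g f'(3) g'(3) by (auto simp: in_Lp_def)
    note [measurable] = f'(1) g'(1)
    show "weak_Lr_norm lebesgue r (B_lambda lam f g) \<le> ennreal K * Lp_norm lebesgue p f * Lp_norm lebesgue q g"
      unfolding weak_Lr_norm_def
    proof (rule SUP_least)
      fix t :: real assume "t \<in> {0<..}"
      then have t: "0 < t" by simp
      have E: "{x. ennreal t < heis_riesz lam f' g' x} \<in> sets borel" by measurable
      \<comment> \<open>\<open>emeasure_mono\<close> asks for measurability of the larger set, which
        is Borel because \<open>f'\<close> and \<open>g'\<close> are Borel functions.\<close>
      have "emeasure lebesgue {x \<in> space lebesgue. t < cmod (B_lambda lam f g x)}
        \<le> emeasure lebesgue {x. ennreal t < heis_riesz lam f' g' x}"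
      proof (rule emeasure_mono)
        show "{x \<in> space lebesgue. t < cmod (B_lambda lam f g x)} \<subseteq> {x. ennreal t < heis_riesz lam f' g' x}"
          using t by (auto simp: ennreal_less_iff intro!: less_le_trans[OF _ cmod_B_lambda_le[OF f'(2) g'(2)]])
        show "{x. ennreal t < heis_riesz lam f' g' x} \<in> sets lebesgue" using E by auto
      qed
      also have "\<dots> = emeasure lborel {x. ennreal t < heis_riesz lam f' g' x}"
        using E by (simp add: emeasure_completion)
      finally have "ennreal t * enn_powr (emeasure lebesgue {x \<in> space lebesgue. t < cmod (B_lambda lam f g x)}) (1 / r)
        \<le> ennreal t * enn_powr (emeasure lborel {x. ennreal t < heis_riesz lam f' g' x}) (1 / r)"
        using r(1) by (intro mult_left_mono enn_powr_mono) auto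
      also have "\<dots> \<le> ennreal K * (recip_norm (exp_inv p) f' * recip_norm (exp_inv q) g')"
        by (rule bound[OF f'(1) g'(1) fin t])
      also have "\<dots> \<le> ennreal K * (Lp_norm lebesgue p f * Lp_norm lebesgue q g)"
        by (intro mult_left_mono mult_mono f' g') auto
      finally show "ennreal t * enn_powr (emeasure lebesgue {x \<in> space lebesgue. t < cmod (B_lambda lam f g x)}) (1 / r)
        \<le> ennreal K * Lp_norm lebesgue p f * Lp_norm lebesgue q g"
        by (simp add: mult.assoc)
    qed
  qed
qed

end
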